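(* Let $k=k(n)$ be a positive-integer-valued function with $k=\omega(1)$ and $k=O(\sqrt n)$. Consider best-of-$(2k+1)$ on an Erdős–Rényi graph $G(n,p)$ with vertex set $V$, where $p=p(n)=\Omega(k/\sqrt n)$. Then, w.h.p. over $G(n,p)$, for every $A\subseteq V$, $T_{\mathrm{cons}}(A)=O\left(\frac{\log n}{\log k}\right)$ holds w.h.p.
   Context: $G(n,p)$ is the random graph on $n$ vertices in which each of the $\binom n2$ pairs is an edge independently with probability $p$. Best-of-$m$: each vertex holds opinion $0$ or $1$; in each synchronous round every vertex $v$ independently samples $m$ neighbours uniformly at random with replacement, and if at least $\lfloor m/2\rfloor+1$ of the samples hold the same opinion, $v$ adopts that opinion; otherwise $v$ keeps its own. All vertices update simultaneously. $A_t$ is the set of vertices of opinion $0$ after $t$ rounds, and $T_{\mathrm{cons}}(A)=\min\{t\ge0:A_t\in\{\emptyset,V\}\}$ for the process started at $A_0=A$. Conventions: "w.h.p." means with probability at least $1-n^{-c}$ for a constant $c>0$, and $n$ is sufficiently large. The outer "w.h.p." refers to the randomness of the graph, the inner one to the randomness of the voting process on the realized graph. Constants hidden in $O$ and in w.h.p. do not depend on $n$, on the realized graph or on $A$. *)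

theory Defs
  imports "HOL-Probability.Probability" "HOL-Library.Landau_Symbols"
begin

text \<open>A simple graph is given by its vertex set and the set of its edges, each edge being
  a two-element set of vertices.\<close>

definition gnp :: "nat \<Rightarrow> real \<Rightarrow> nat set set pmf" where
  "gnp n p = map_pmf (\<lambda>f. {e. f e})
     (Pi_pmf {e. e \<subseteq> {..<n} \<and> card e = 2} False (\<lambda>_. bernoulli_pmf p))"

definition nbrs :: "'a set set \<Rightarrow> 'a \<Rightarrow> 'a set" where
  "nbrs E v = {w. w \<noteq> v \<and> {v, w} \<in> E}"

text \<open>An isolated vertex has no neighbour to sample. By convention it samples itself,
  so that it keeps its opinion forever.\<close>

definition nbr_pmf :: "'a set set \<Rightarrow> 'a \<Rightarrow> 'a pmf" where
  "nbr_pmf E v = (if nbrs E v = {} then return_pmf v else pmf_of_set (nbrs E v))"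

text \<open>The samples of one round: \<open>s v i\<close>, for \<open>i < m\<close>, is the \<open>i\<close>-th neighbour sampled by
  the vertex \<open>v\<close>.\<close>

definition samples_pmf :: "nat \<Rightarrow> 'a set \<Rightarrow> 'a set set \<Rightarrow> ('a \<Rightarrow> nat \<Rightarrow> 'a) pmf" where
  "samples_pmf m V E =
     Pi_pmf V undefined (\<lambda>v. Pi_pmf {..<m} undefined (\<lambda>_. nbr_pmf E v))"

text \<open>A configuration is the set \<open>A\<close> of the vertices of opinion 0; vertices outside \<open>A\<close> have
  opinion 1.\<close>

definition best_of :: "nat \<Rightarrow> 'a set \<Rightarrow> ('a \<Rightarrow> nat \<Rightarrow> 'a) \<Rightarrow> 'a set \<Rightarrow> 'a set" where
  "best_of m V s A =
     {v \<in> V. if card {i. i < m \<and> s v i \<in> A} \<ge> m div 2 + 1 then True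
             else if card {i. i < m \<and> s v i \<notin> A} \<ge> m div 2 + 1 then False
             else v \<in> A}"

text \<open>The voting process is driven by an i.i.d. sequence of such samples, one per round.\<close>

definition voting_space :: "nat \<Rightarrow> 'a set \<Rightarrow> 'a set set \<Rightarrow> ('a \<Rightarrow> nat \<Rightarrow> 'a) stream measure" where
  "voting_space m V E = stream_space (measure_pmf (samples_pmf m V E))"

primrec opinion0 ::
  "nat \<Rightarrow> 'a set \<Rightarrow> 'a set \<Rightarrow> ('a \<Rightarrow> nat \<Rightarrow> 'a) stream \<Rightarrow> nat \<Rightarrow> 'a set" where
  "opinion0 m V A \<omega> 0 = A"
| "opinion0 m V A \<omega> (Suc t) = best_of m V (\<omega> !! t) (opinion0 m V A \<omega> t)"

text \<open>The consensus time is \<open>\<infinity>\<close> if consensus is never reached.\<close>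

definition T_cons ::
  "nat \<Rightarrow> 'a set \<Rightarrow> 'a set \<Rightarrow> ('a \<Rightarrow> nat \<Rightarrow> 'a) stream \<Rightarrow> enat" where
  "T_cons m V A \<omega> = (INF t\<in>{t. opinion0 m V A \<omega> t \<in> {{}, V}}. enat t)"

end

theory Submission
  imports Defs "HOL-Real_Asymp.Real_Asymp"
begin

text \<open>
  Let \<open>mass A\<close> be the stationary measure of \<open>A\<close>, i.e. its share of the total degree. Conditionally
  on the current set \<open>A\<close>, the vertices decide independently, \<open>v\<close> adopting opinion 0 with probability
  \<open>f (\<alpha>\<^sub>v)\<close>, where \<open>\<alpha>\<^sub>v\<close> is the fraction of its neighbours in \<open>A\<close> and \<open>f\<close> is the upper half of the
  binomial distribution \<open>Bin (2k+1, x)\<close>. As \<open>mass A\<close> is the stationary average of the \<open>\<alpha>\<^sub>v\<close>, the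
  first-order term of a Taylor expansion of \<open>f\<close> around it averages out, and since \<open>\<bar>f''\<bar> = O(k)\<close> and the
  variance of the \<open>\<alpha>\<^sub>v\<close> is \<open>O(1/(n p)) = O(1/(k sqrt n))\<close>, the expectation of the next mass differs
  from \<open>f (mass A)\<close> only by \<open>O(1/sqrt n)\<close>, the order of its standard deviation. The slope of \<open>f\<close> at
  \<open>1/2\<close> is of order \<open>sqrt k\<close>, so a bias \<open>\<bar>mass A - 1/2\<bar>\<close> well above \<open>1/sqrt n\<close> is amplified by that
  factor until it is constant; below it, anticoncentration of the one-round noise breaks the tie, except with
  probability polynomially small in \<open>k\<close>; and a minority of mass at most \<open>3/8\<close> shrinks by a factor of order \<open>k\<close>.
  All three regimes are captured by one potential, polynomially bounded above and, away from
  consensus, below, whose expectation decreases by a factor polynomial in \<open>k\<close> in every round. Markov's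
  inequality after \<open>O(ln n / ln k)\<close> rounds finishes the proof.

  The properties of the graph come from a single Chernoff bound for linear combinations of
  degrees into a set, together with union bounds.
\<close>

section \<open>Sums of independent indicators\<close>

text \<open>Two scales make the regimes quantitative: \<kappa>, the fourth root of k, and \<delta>,
  the fourth root of \<kappa>. The slope at 1/2 is of order \<open>\<kappa>\<^sup>2\<close>, so a
  bias of 1/(\<kappa> sqrt n) grows to order \<kappa>/sqrt n, ahead of the error of the mean and of
  the noise. Below that bias only the noise helps: it leaves a window of half-width about
  1/(\<open>\<delta>\<^sup>2\<close> sqrt n) except with probability O(1/\<delta>), and outside the
  window the potential is of order at most \<open>\<delta>\<^sup>2\<close>, which is at most
  \<kappa>/\<delta>. The constant value \<kappa>/sqrt n at intermediate bias is placed so that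
  entering and leaving that range both gain a factor of order at least \<kappa>. The initial set may
  depend on the graph, so the graph estimates must hold for all 2^n sets at once. No bound at every
  single vertex survives this (take A to be a neighbourhood); what survives is a mean-square bound
  over the vertices and a count of exceptional vertices. \<open>rand_subset\<close> serves twice:
  for the edges of the graph, and for the vertices of opinion 0 after a round.\<close>

definition rand_subset :: "'a set \<Rightarrow> ('a \<Rightarrow> real) \<Rightarrow> 'a set pmf" where
  "rand_subset V q = map_pmf (\<lambda>f. {v\<in>V. f v}) (Pi_pmf V False (\<lambda>v. bernoulli_pmf (q v)))"

lemma set_rand_subset: "set_pmf (rand_subset V q) \<subseteq> Pow V"
  by (auto simp: rand_subset_def)

lemma pmf_rand_subset:
  assumes V: "finite V" and q: "\<And>v. v \<in> V \<Longrightarrow> q v \<in> {0..1}" and S: "S \<subseteq> V"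
  shows "pmf (rand_subset V q) S = (\<Prod>v\<in>S. q v) * (\<Prod>v\<in>V - S. 1 - q v)"
proof -
  let ?P = "Pi_pmf V False (\<lambda>v. bernoulli_pmf (q v))"
  have "pmf (rand_subset V q) S = measure_pmf.prob ?P ((\<lambda>f. {v\<in>V. f v}) -` {S})"
    by (simp add: rand_subset_def pmf_map)
  also have "\<dots> = measure_pmf.prob ?P {\<lambda>v. v \<in> S}"
  proof (rule measure_prob_cong_0)
    fix f assume "f \<in> (\<lambda>f. {v\<in>V. f v}) -` {S} - {\<lambda>v. v \<in> S}"
    then have "\<exists>v. v \<notin> V \<and> f v \<noteq> False" using S by auto
    then show "pmf ?P f = 0" by (rule pmf_Pi_outside[OF V])
  qed (use S in auto)
  also have "\<dots> = pmf ?P (\<lambda>v. v \<in> S)"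
    by (simp add: measure_pmf_single)
  also have "\<dots> = (\<Prod>v\<in>V. pmf (bernoulli_pmf (q v)) (v \<in> S))"
    using S by (intro pmf_Pi' V) auto
  also have "\<dots> = (\<Prod>v\<in>V. if v \<in> S then q v else 1 - q v)"
    using q by (intro prod.cong) auto
  also have "\<dots> = (\<Prod>v\<in>S. q v) * (\<Prod>v\<in>V - S. 1 - q v)"
    using S by (subst prod.If_cases[OF V]) (simp add: Int_absorb1 Diff_eq)
  finally show ?thesis .
qed

lemma expectation_rand_subset:
  fixes f :: "'a set \<Rightarrow> 'b::{banach, second_countable_topology}"
  assumes "finite V"
  shows "measure_pmf.expectation (rand_subset V q) f = (\<Sum>S\<in>Pow V. pmf (rand_subset V q) S *\<^sub>R f S)"
proof (rule integral_measure_pmf)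
  show "S \<in> Pow V" if "S \<in> set_pmf (rand_subset V q)" for S
    using that set_rand_subset[of V q] by blast
qed (use assms in simp)

lemma integrable_rand_subset [simp, intro]:
  fixes f :: "'a set \<Rightarrow> 'b::{banach, second_countable_topology}"
  assumes "finite V"
  shows "integrable (measure_pmf (rand_subset V q)) f"
  using finite_subset[OF set_rand_subset[of V q]] assms by (intro integrable_measure_pmf_finite) simp

text \<open>Multiplying out the product over \<open>V\<close> gives one term per subset, weighted as
  in \<open>pmf_rand_subset\<close>. The value type is a general field so that the same identity
  yields moments, exponential moments and complex characteristic functions.\<close>

lemma expectation_prod_rand_subset:
  fixes a b :: "'a \<Rightarrow> 'b::{real_normed_field, banach, second_countable_topology}"
  assumes V: "finite V" and q: "\<And>v. v \<in> V \<Longrightarrow> q v \<in> {0..1}"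
  shows "measure_pmf.expectation (rand_subset V q) (\<lambda>S. \<Prod>v\<in>V. if v \<in> S then a v else b v)
    = (\<Prod>v\<in>V. of_real (q v) * a v + of_real (1 - q v) * b v)"
proof -
  have "(\<Prod>v\<in>V. of_real (q v) * a v + of_real (1 - q v) * b v) =
     (\<Sum>S\<in>Pow V. (\<Prod>v\<in>S. of_real (q v) * a v) * (\<Prod>v\<in>V - S. of_real (1 - q v) * b v))"
    by (rule prod_add[OF V])
  also have "\<dots> = (\<Sum>S\<in>Pow V. pmf (rand_subset V q) S *\<^sub>R (\<Prod>v\<in>V. if v \<in> S then a v else b v))"
  proof (rule sum.cong)
    fix S assume "S \<in> Pow V"
    then have S: "S \<subseteq> V" by simp
    have "(\<Prod>v\<in>V. if v \<in> S then a v else b v) = (\<Prod>v\<in>S. a v) * (\<Prod>v\<in>V - S. b v)"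
      using S by (subst prod.If_cases[OF V]) (simp add: Int_absorb1 Diff_eq)
    then show "(\<Prod>v\<in>S. of_real (q v) * a v) * (\<Prod>v\<in>V - S. of_real (1 - q v) * b v)
      = pmf (rand_subset V q) S *\<^sub>R (\<Prod>v\<in>V. if v \<in> S then a v else b v)"
      by (simp add: pmf_rand_subset[OF V q S] scaleR_conv_of_real prod.distrib of_real_prod mult_ac)
  qed simp
  also have "\<dots> = measure_pmf.expectation (rand_subset V q) (\<lambda>S. \<Prod>v\<in>V. if v \<in> S then a v else b v)"
    by (rule expectation_rand_subset[OF V, symmetric])
  finally show ?thesis ..
qed

lemma expectation_mem_rand_subset:
  assumes V: "finite V" and q: "\<And>v. v \<in> V \<Longrightarrow> q v \<in> {0..1}" and v: "v \<in> V"
  shows "measure_pmf.expectation (rand_subset V q) (\<lambda>S. of_bool (v \<in> S)) = q v"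
proof -
  \<comment> \<open>The indicator of \<open>v \<in> S\<close> is itself a product over
    \<open>V\<close>; its only factor that is not constantly 1 sits at \<open>v\<close>.\<close>
  let ?b = "\<lambda>w. if w = v then 0 else 1 :: real"
  have "measure_pmf.expectation (rand_subset V q) (\<lambda>S. of_bool (v \<in> S)) =
    measure_pmf.expectation (rand_subset V q) (\<lambda>S. \<Prod>w\<in>V. if w \<in> S then 1 else ?b w)"
  proof (rule arg_cong[of _ _ "measure_pmf.expectation _"], rule ext)
    fix S
    have "(\<Prod>w\<in>V. if w \<in> S then 1 else ?b w) = (\<Prod>w\<in>{v}. if w \<in> S then 1 else ?b w)"
      using V v by (intro prod.mono_neutral_right) auto
    then show "of_bool (v \<in> S) = (\<Prod>w\<in>V. if w \<in> S then 1 else ?b w)" by simp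
  qed
  also have "\<dots> = (\<Prod>w\<in>V. q w + (1 - q w) * ?b w)"
    by (subst expectation_prod_rand_subset[OF V q]) auto
  also have "\<dots> = (\<Prod>w\<in>{v}. q w + (1 - q w) * ?b w)"
    using V v by (intro prod.mono_neutral_right) auto
  finally show ?thesis by simp
qed

lemma expectation_sum_rand_subset:
  assumes V: "finite V" and q: "\<And>v. v \<in> V \<Longrightarrow> q v \<in> {0..1}"
  shows "measure_pmf.expectation (rand_subset V q) (\<lambda>S. \<Sum>v\<in>V. w v * of_bool (v \<in> S)) = (\<Sum>v\<in>V. w v * q v)"
  by (subst Bochner_Integration.integral_sum)
    (auto simp: V expectation_mem_rand_subset[OF V q] simp del: of_bool_eq_iff)

lemma covariance_rand_subset:
  assumes V: "finite V" and q: "\<And>v. v \<in> V \<Longrightarrow> q v \<in> {0..1}" and uv: "u \<in> V" "v \<in> V"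
  shows "measure_pmf.expectation (rand_subset V q) (\<lambda>S. (of_bool (u \<in> S) - q u) * (of_bool (v \<in> S) - q v))
    = (if u = v then q v * (1 - q v) else 0)"
proof (cases "u = v")
  case True
  have "(\<lambda>S. (of_bool (u \<in> S) - q u) * (of_bool (v \<in> S) - q v))
      = (\<lambda>S. (1 - 2 * q v) * of_bool (v \<in> S) + (q v)\<^sup>2)"
    using True by (auto simp: power2_eq_square algebra_simps fun_eq_iff)
  then show ?thesis using True
    by (simp add: V expectation_mem_rand_subset[OF V q uv(2)] power2_eq_square algebra_simps)
next
  case False
  \<comment> \<open>Both centred indicators become one product over \<open>V\<close>; for distinct
    \<open>u\<close> and \<open>v\<close> the factor at \<open>v\<close> averages to 0.\<close>
  let ?a = "\<lambda>w. if w = u \<or> w = v then 1 - q w else 1"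
  let ?b = "\<lambda>w. if w = u \<or> w = v then - q w else 1"
  have "measure_pmf.expectation (rand_subset V q) (\<lambda>S. (of_bool (u \<in> S) - q u) * (of_bool (v \<in> S) - q v))
    = measure_pmf.expectation (rand_subset V q) (\<lambda>S. \<Prod>w\<in>V. if w \<in> S then ?a w else ?b w)"
  proof (rule arg_cong[of _ _ "measure_pmf.expectation _"], rule ext)
    fix S
    have "(\<Prod>w\<in>V. if w \<in> S then ?a w else ?b w) = (\<Prod>w\<in>{u,v}. if w \<in> S then ?a w else ?b w)"
      using V uv by (intro prod.mono_neutral_right) auto
    then show "(of_bool (u \<in> S) - q u) * (of_bool (v \<in> S) - q v) = (\<Prod>w\<in>V. if w \<in> S then ?a w else ?b w)"
      using False by simp
  qed
  also have "\<dots> = (\<Prod>w\<in>V. q w * ?a w + (1 - q w) * ?b w)"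
    by (subst expectation_prod_rand_subset[OF V q]) auto
  also have "\<dots> = 0"
    using V uv by (intro prod_zero bexI[of _ v]) (auto simp: algebra_simps)
  finally show ?thesis using False by simp
qed

lemma variance_sum_rand_subset:
  assumes V: "finite V" and q: "\<And>v. v \<in> V \<Longrightarrow> q v \<in> {0..1}"
  shows "measure_pmf.expectation (rand_subset V q)
      (\<lambda>S. ((\<Sum>v\<in>V. w v * of_bool (v \<in> S)) - (\<Sum>v\<in>V. w v * q v))\<^sup>2) = (\<Sum>v\<in>V. (w v)\<^sup>2 * (q v * (1 - q v)))"
proof -
  have "(\<lambda>S. ((\<Sum>v\<in>V. w v * of_bool (v \<in> S)) - (\<Sum>v\<in>V. w v * q v))\<^sup>2) =
    (\<lambda>S. \<Sum>u\<in>V. \<Sum>v\<in>V. (w u * w v) * ((of_bool (u \<in> S) - q u) * (of_bool (v \<in> S) - q v)))"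
    by (rule ext) (simp add: sum_subtractf[symmetric] power2_eq_square sum_product algebra_simps)
  then have "measure_pmf.expectation (rand_subset V q)
      (\<lambda>S. ((\<Sum>v\<in>V. w v * of_bool (v \<in> S)) - (\<Sum>v\<in>V. w v * q v))\<^sup>2)
    = (\<Sum>u\<in>V. \<Sum>v\<in>V. (w u * w v) * measure_pmf.expectation (rand_subset V q)
        (\<lambda>S. (of_bool (u \<in> S) - q u) * (of_bool (v \<in> S) - q v)))"
    by (simp add: V)
  also have "\<dots> = (\<Sum>u\<in>V. \<Sum>v\<in>V. (w u * w v) * (if u = v then q v * (1 - q v) else 0))"
    by (intro sum.cong refl arg_cong2[of _ _ _ _ "(*)"] covariance_rand_subset[OF V q])
  also have "\<dots> = (\<Sum>v\<in>V. (w v)\<^sup>2 * (q v * (1 - q v)))"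
    using V by (intro sum.cong) (auto simp: power2_eq_square if_distrib cong: if_cong)
  finally show ?thesis .
qed

section \<open>Exponential moments and the Chernoff bound\<close>

lemma exp_le_quadratic:
  fixes t :: real
  assumes "\<bar>t\<bar> \<le> 1"
  shows "exp t \<le> 1 + t + t\<^sup>2"
proof (cases "t \<ge> 0")
  case True
  then show ?thesis using exp_bound assms by auto
next
  case False
  define s where "s = - t"
  have s: "0 \<le> s" "s \<le> 1" using False assms by (auto simp: s_def)
  \<comment> \<open>The candidate bound \<open>1 - s + s\<^sup>2\<close> times the quadratic Taylor
    minorant of \<open>exp s\<close> is at least 1; hence it dominates
    \<open>exp (-s)\<close>.\<close>
  have "1 \<le> 1 + s\<^sup>2/2 + s^3/2 + s^4/2" using s by simp
  also have "\<dots> = (1 - s + s\<^sup>2) * (1 + s + s\<^sup>2/2)"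
    by (simp add: field_simps power2_eq_square power3_eq_cube power4_eq_xxxx)
  also have "\<dots> \<le> (1 - s + s\<^sup>2) * exp s"
    using s exp_lower_Taylor_quadratic[of s] by (intro mult_left_mono) auto
  finally have "exp (-s) \<le> 1 - s + s\<^sup>2" by (simp add: exp_minus field_simps)
  then show ?thesis by (simp add: s_def)
qed

text \<open>The factor \<open>p\<close> in the exponent, which Hoeffding's bound does not have,
  keeps the tails sharp when the edge probability tends to 0. The price is the restriction on
  \<open>c\<close>.\<close>

lemma expectation_exp_centred_bernoulli:
  fixes p c :: real
  assumes p: "p \<in> {0..1}" and c: "\<bar>c\<bar> \<le> 1"
  shows "p * exp (c * (1 - p)) + (1 - p) * exp (c * (0 - p)) \<le> exp (p * c\<^sup>2)"
proof -
  have "p * exp (c * (1 - p)) + (1 - p) * exp (c * (0 - p)) = exp (- (c * p)) * (1 + p * (exp c - 1))"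
    by (simp add: algebra_simps exp_diff exp_minus field_simps)
  also have "\<dots> \<le> exp (- (c * p)) * (1 + p * (c + c\<^sup>2))"
    using p exp_le_quadratic[OF c] by (intro mult_left_mono add_left_mono mult_left_mono) auto
  also have "\<dots> \<le> exp (- (c * p)) * exp (p * (c + c\<^sup>2))"
    by (intro mult_left_mono) auto
  also have "\<dots> = exp (p * c\<^sup>2)"
    by (simp add: exp_add[symmetric] algebra_simps)
  finally show ?thesis .
qed

text \<open>Exponential Markov inequality with a free parameter \<open>u\<close>, which each
  application fixes for itself. Arbitrary real coefficients are allowed because the graph is tested
  against weighted combinations of degrees.\<close>

lemma Chernoff_rand_subset:
  assumes V: "finite V" and p: "p \<in> {0..1}" and u: "u \<ge> 0" and c: "\<And>v. v \<in> V \<Longrightarrow> u * \<bar>c v\<bar> \<le> 1"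
  shows "measure_pmf.prob (rand_subset V (\<lambda>_. p)) {S. (\<Sum>v\<in>V. c v * (of_bool (v \<in> S) - p)) \<ge> \<tau>}
    \<le> exp (- u * \<tau> + p * u\<^sup>2 * (\<Sum>v\<in>V. (c v)\<^sup>2))"
proof -
  let ?M = "rand_subset V (\<lambda>_. p)"
  have "measure_pmf.prob ?M {S. (\<Sum>v\<in>V. c v * (of_bool (v \<in> S) - p)) \<ge> \<tau>}
    = measure_pmf.expectation ?M (indicator {S. (\<Sum>v\<in>V. c v * (of_bool (v \<in> S) - p)) \<ge> \<tau>})"
    by simp
  also have "\<dots> \<le> measure_pmf.expectation ?M
      (\<lambda>S. exp (- u * \<tau>) * (\<Prod>v\<in>V. if v \<in> S then exp (u * c v * (1 - p)) else exp (u * c v * (0 - p))))"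
  proof (rule integral_mono)
    fix S
    have "exp (- u * \<tau>) * (\<Prod>v\<in>V. if v \<in> S then exp (u * c v * (1 - p)) else exp (u * c v * (0 - p)))
       = exp (- u * \<tau>) * (\<Prod>v\<in>V. exp (u * (c v * (of_bool (v \<in> S) - p))))"
      by (intro arg_cong2[of _ _ _ _ "(*)"] prod.cong) (auto simp: mult_ac)
    also have "\<dots> = exp (- u * \<tau>) * exp (u * (\<Sum>v\<in>V. c v * (of_bool (v \<in> S) - p)))"
      by (simp only: exp_sum[OF V] sum_distrib_left)
    also have "\<dots> = exp (u * ((\<Sum>v\<in>V. c v * (of_bool (v \<in> S) - p)) - \<tau>))"
      by (simp only: exp_add[symmetric] right_diff_distrib) simp
    finally show "indicator {S. (\<Sum>v\<in>V. c v * (of_bool (v \<in> S) - p)) \<ge> \<tau>} S \<le>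
       exp (- u * \<tau>) * (\<Prod>v\<in>V. if v \<in> S then exp (u * c v * (1 - p)) else exp (u * c v * (0 - p)))"
      using u by (auto simp: indicator_def)
  qed (use V in auto)
  also have "\<dots> = exp (- u * \<tau>) * (\<Prod>v\<in>V. p * exp (u * c v * (1 - p)) + (1 - p) * exp (u * c v * (0 - p)))"
    using expectation_prod_rand_subset[OF V, of "\<lambda>_. p" "\<lambda>v. exp (u * c v * (1 - p))" "\<lambda>v. exp (u * c v * (0 - p))"] p
    by simp
  also have "\<dots> \<le> exp (- u * \<tau>) * (\<Prod>v\<in>V. exp (p * (u * c v)\<^sup>2))"
    using p u c by (intro mult_left_mono prod_mono conjI add_nonneg_nonneg mult_nonneg_nonneg
      expectation_exp_centred_bernoulli) (auto simp: abs_mult)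
  also have "\<dots> = exp (- u * \<tau> + p * u\<^sup>2 * (\<Sum>v\<in>V. (c v)\<^sup>2))"
    by (simp add: V exp_sum[symmetric] exp_add[symmetric] sum_distrib_left power_mult_distrib mult_ac
      flip: exp_sum)
  finally show ?thesis .
qed


section \<open>Characteristic functions and anticoncentration\<close>

lemma cos_le_quadratic:
  fixes x :: real
  assumes "\<bar>x\<bar> \<le> 1"
  shows "cos x \<le> 1 - x\<^sup>2 / 4"
proof -
  \<comment> \<open>As 1 < pi/3, the cosine is at least 1/2 on [0,1]; integrating this twice gives
    the quadratic bound.\<close>
  have cos_half: "1 \<le> cos y * 2" if "0 \<le> y" "y \<le> 1" for y :: real
    using cos_monotone_0_pi_le[of y "pi/3"] that pi_gt3 by (simp add: cos_60)
  have sin_half: "y \<le> sin y * 2" if y: "0 \<le> y" "y \<le> 1" for y :: real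
  proof -
    have "sin 0 - 0/2 \<le> sin y - y / 2"
      using y by (intro DERIV_nonneg_imp_nondecreasing[of 0 y "\<lambda>y. sin y - y/2"])
        (auto intro!: exI derivative_eq_intros cos_half)
    then show ?thesis by simp
  qed
  have "1 - 0\<^sup>2 / 4 - cos 0 \<le> 1 - \<bar>x\<bar>\<^sup>2 / 4 - cos \<bar>x\<bar>"
    using assms by (intro DERIV_nonneg_imp_nondecreasing[of 0 "\<bar>x\<bar>" "\<lambda>y. 1 - y\<^sup>2 / 4 - cos y"])
      (auto intro!: exI derivative_eq_intros sin_half)
  then show ?thesis by simp
qed

text \<open>The squared modulus is exactly \<open>1 - 2 * (q * (1 - q)) * (1 - cos x)\<close>, so
  the decay is governed by the variance \<open>q * (1 - q)\<close>.\<close>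

lemma norm_char_bernoulli_le:
  fixes q x :: real
  assumes q: "q \<in> {0..1}" and x: "\<bar>x\<bar> \<le> 1"
  shows "cmod (of_real q * cis x + of_real (1 - q) * 1) \<le> exp (- (x\<^sup>2 * (q * (1 - q)) / 4))"
proof -
  let ?z = "of_real q * cis x + of_real (1 - q) * 1"
  have "(cmod ?z)\<^sup>2 = (q * cos x + (1 - q))\<^sup>2 + (q * sin x)\<^sup>2"
    by (simp add: cmod_power2)
  also have "\<dots> = 1 - 2 * (q * (1 - q)) * (1 - cos x)"
    using sin_cos_squared_add[of x] by algebra
  also have "\<dots> \<le> 1 - 2 * (q * (1 - q)) * (x\<^sup>2 / 4)"
    using q cos_le_quadratic[OF x] by (intro diff_left_mono mult_left_mono) auto
  also have "\<dots> \<le> exp (- 2 * (q * (1 - q)) * (x\<^sup>2 / 4))"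
    using exp_ge_add_one_self[of "- 2 * (q * (1 - q)) * (x\<^sup>2 / 4)"] by simp
  also have "\<dots> = (exp (- (x\<^sup>2 * (q * (1 - q)) / 4)))\<^sup>2"
    by (simp add: power2_eq_square exp_add[symmetric] algebra_simps)
  finally show ?thesis by (rule power2_le_imp_le) simp
qed

lemma norm_char_rand_subset_le:
  fixes w :: "'a \<Rightarrow> real"
  assumes V: "finite V" and q: "\<And>v. v \<in> V \<Longrightarrow> q v \<in> {0..1}"
    and w: "\<And>v. v \<in> V \<Longrightarrow> \<bar>s * w v\<bar> \<le> 1"
  shows "cmod (measure_pmf.expectation (rand_subset V q) (\<lambda>S. cis (s * ((\<Sum>v\<in>V. w v * of_bool (v \<in> S)) - c))))
    \<le> exp (- (s\<^sup>2 * (\<Sum>v\<in>V. (w v)\<^sup>2 * (q v * (1 - q v))) / 4))"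
proof -
  have cis_sum: "cis (\<Sum>v\<in>V. f v) = (\<Prod>v\<in>V. cis (f v))" for f
    using V by (induction rule: finite_induct) (auto simp: cis_mult[symmetric])
  have "(\<lambda>S. cis (s * ((\<Sum>v\<in>V. w v * of_bool (v \<in> S)) - c)))
      = (\<lambda>S. cis (- s * c) * (\<Prod>v\<in>V. if v \<in> S then cis (s * w v) else 1))"
  proof
    fix S
    have "(\<Prod>v\<in>V. if v \<in> S then cis (s * w v) else 1) = cis (\<Sum>v\<in>V. s * (w v * of_bool (v \<in> S)))"
      unfolding cis_sum by (intro prod.cong) auto
    then show "cis (s * ((\<Sum>v\<in>V. w v * of_bool (v \<in> S)) - c))
       = cis (- s * c) * (\<Prod>v\<in>V. if v \<in> S then cis (s * w v) else 1)"
      by (simp add: cis_mult sum_distrib_left[symmetric] algebra_simps)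
  qed
  then have "cmod (measure_pmf.expectation (rand_subset V q) (\<lambda>S. cis (s * ((\<Sum>v\<in>V. w v * of_bool (v \<in> S)) - c))))
    = (\<Prod>v\<in>V. cmod (of_real (q v) * cis (s * w v) + of_real (1 - q v) * 1))"
    using expectation_prod_rand_subset[OF V q, where a = "\<lambda>v. cis (s * w v)" and b = "\<lambda>_. 1"]
    by (simp add: norm_mult prod_norm)
  also have "\<dots> \<le> (\<Prod>v\<in>V. exp (- ((s * w v)\<^sup>2 * (q v * (1 - q v)) / 4)))"
    using q w by (intro prod_mono conjI norm_char_bernoulli_le) auto
  also have "\<dots> = exp (\<Sum>v\<in>V. - ((s * w v)\<^sup>2 * (q v * (1 - q v)) / 4))"
    by (rule exp_sum[OF V, symmetric])
  also have "(\<Sum>v\<in>V. - ((s * w v)\<^sup>2 * (q v * (1 - q v)) / 4)) = - (s\<^sup>2 * (\<Sum>v\<in>V. (w v)\<^sup>2 * (q v * (1 - q v))) / 4)"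
    by (simp add: sum_negf sum_distrib_left sum_divide_distrib power_mult_distrib mult_ac)
  finally show ?thesis .
qed

text \<open>Instead of Fourier inversion, the event is compared with the discrete Fejer kernel
  \<open>\<bar>\<Sum>j<M. exp (i j t Y)\<bar>\<^sup>2\<close>, which is at least \<open>M\<^sup>2 / 4\<close> when \<open>\<bar>M t Y\<bar> \<le> 1\<close> and whose
  expectation is a finite sum of values of the characteristic function.\<close>

lemma anticoncentration_rand_subset:
  fixes w :: "'a \<Rightarrow> real"
  assumes V: "finite V" and q: "\<And>v. v \<in> V \<Longrightarrow> q v \<in> {0..1}"
    and M: "M \<ge> 1" and t: "t > 0" and w: "\<And>v. v \<in> V \<Longrightarrow> real M * t * \<bar>w v\<bar> \<le> 1"
  shows "measure_pmf.prob (rand_subset V q) {S. \<bar>(\<Sum>v\<in>V. w v * of_bool (v \<in> S)) - c\<bar> \<le> 1 / (real M * t)}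
    \<le> 4 / real M + 4 * exp (- (t\<^sup>2 * (\<Sum>v\<in>V. (w v)\<^sup>2 * (q v * (1 - q v))) / 4))"
proof -
  let ?R = "rand_subset V q"
  define Y where "Y S = (\<Sum>v\<in>V. w v * of_bool (v \<in> S)) - c" for S
  define \<sigma> where "\<sigma> = (\<Sum>v\<in>V. (w v)\<^sup>2 * (q v * (1 - q v)))"
  have \<sigma>: "\<sigma> \<ge> 0" using q by (auto simp: \<sigma>_def intro!: sum_nonneg mult_nonneg_nonneg)
  define Z where "Z S = (\<Sum>j<M. cis (real j * t * Y S))" for S
  have Z_sq: "of_real ((cmod (Z S))\<^sup>2) = (\<Sum>j<M. \<Sum>l<M. cis ((real j - real l) * t * Y S))" for S
    unfolding complex_norm_square Z_def cnj_sum sum_product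
    by (intro sum.cong refl) (simp add: cis_cnj cis_mult algebra_simps)
  have Z_ge: "(real M / 2)\<^sup>2 \<le> (cmod (Z S))\<^sup>2" if S: "\<bar>Y S\<bar> \<le> 1 / (real M * t)" for S
  proof -
    have "1/2 \<le> cos (real j * t * Y S)" if "j < M" for j
    proof -
      have "\<bar>real j * t * Y S\<bar> = (real j * t) * \<bar>Y S\<bar>" using t by (simp add: abs_mult)
      also have "\<dots> \<le> (real M * t) * (1 / (real M * t))"
        using S that t M by (intro mult_mono) auto
      also have "\<dots> = 1" using t M by simp
      finally have "\<bar>real j * t * Y S\<bar> \<le> 1" .
      then have "cos (pi/3) \<le> cos \<bar>real j * t * Y S\<bar>"
        using pi_gt3 by (intro cos_monotone_0_pi_le) auto
      then show ?thesis by (simp add: cos_60)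
    qed
    then have "(\<Sum>j<M. 1/2) \<le> (\<Sum>j<M. cos (real j * t * Y S))" by (intro sum_mono) auto
    then have "real M / 2 \<le> Re (Z S)" by (simp add: Z_def)
    also have "\<dots> \<le> cmod (Z S)" by (rule complex_Re_le_cmod)
    finally show ?thesis by (intro power_mono) auto
  qed
  have "(real M / 2)\<^sup>2 * measure_pmf.prob ?R {S. \<bar>Y S\<bar> \<le> 1 / (real M * t)}
    = measure_pmf.expectation ?R (\<lambda>S. (real M / 2)\<^sup>2 * indicator {S. \<bar>Y S\<bar> \<le> 1 / (real M * t)} S)"
    by simp
  also have "\<dots> \<le> measure_pmf.expectation ?R (\<lambda>S. (cmod (Z S))\<^sup>2)"
    using Z_ge by (intro integral_mono) (auto simp: V indicator_def)
  also have "\<dots> \<le> cmod (measure_pmf.expectation ?R (\<lambda>S. of_real ((cmod (Z S))\<^sup>2)))"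
    by (subst integral_complex_of_real) (simp add: norm_of_real)
  also have "\<dots> = cmod (\<Sum>j<M. \<Sum>l<M. measure_pmf.expectation ?R (\<lambda>S. cis ((real j - real l) * t * Y S)))"
    unfolding Z_sq by (simp add: V)
  also have "\<dots> \<le> (\<Sum>j<M. \<Sum>l<M. cmod (measure_pmf.expectation ?R (\<lambda>S. cis ((real j - real l) * t * Y S))))"
    by (intro order_trans[OF norm_sum] sum_mono) simp
  \<comment> \<open>The \<open>M\<close> diagonal terms contribute 1 each. Off the diagonal the
    frequency is at least \<open>t\<close> in absolute value, and the hypothesis on \<open>w\<close>
    keeps all frequencies in the range of the quadratic bound on the cosine.\<close>
  also have "\<dots> \<le> (\<Sum>j<M. \<Sum>l<M. of_bool (j = l) + exp (- (t\<^sup>2 * \<sigma> / 4)))"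
  proof (intro sum_mono)
    fix j l assume "j \<in> {..<M}" "l \<in> {..<M}"
    then have jl: "\<bar>real j - real l\<bar> \<le> real M" by auto
    have "\<bar>(real j - real l) * t * w v\<bar> \<le> 1" if "v \<in> V" for v
    proof -
      have "\<bar>(real j - real l) * t * w v\<bar> = \<bar>real j - real l\<bar> * (t * \<bar>w v\<bar>)"
        using t by (simp add: abs_mult)
      also have "\<dots> \<le> real M * (t * \<bar>w v\<bar>)" using jl t by (intro mult_right_mono) auto
      finally show ?thesis using w[OF that] by (simp add: mult_ac)
    qed
    from norm_char_rand_subset_le[OF V q this, where c = c]
    have "cmod (measure_pmf.expectation ?R (\<lambda>S. cis ((real j - real l) * t * Y S)))
       \<le> exp (- (((real j - real l) * t)\<^sup>2 * \<sigma> / 4))" by (simp add: Y_def \<sigma>_def)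
    also have "\<dots> \<le> of_bool (j = l) + exp (- (t\<^sup>2 * \<sigma> / 4))"
    proof (cases "j = l")
      case False
      then have "1 \<le> \<bar>real j - real l\<bar>" by linarith
      then have "1 \<le> (real j - real l)\<^sup>2" 
        using one_le_power[of "\<bar>real j - real l\<bar>" 2] by simp
      then have "1 * (t\<^sup>2 * \<sigma>) \<le> (real j - real l)\<^sup>2 * (t\<^sup>2 * \<sigma>)"
        using \<sigma> by (intro mult_right_mono) auto
      then show ?thesis using False by (simp add: power_mult_distrib mult_ac)
    qed simp
    finally show "cmod (measure_pmf.expectation ?R (\<lambda>S. cis ((real j - real l) * t * Y S)))
      \<le> of_bool (j = l) + exp (- (t\<^sup>2 * \<sigma> / 4))" .
  qed
  also have "\<dots> = real M + (real M)\<^sup>2 * exp (- (t\<^sup>2 * \<sigma> / 4))"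
    by (simp add: sum.distrib power2_eq_square distrib_left)
  finally have "measure_pmf.prob ?R {S. \<bar>Y S\<bar> \<le> 1 / (real M * t)}
     \<le> (real M + (real M)\<^sup>2 * exp (- (t\<^sup>2 * \<sigma> / 4))) / (real M / 2)\<^sup>2"
    using M by (simp add: field_simps)
  also have "\<dots> = 4 / real M + 4 * exp (- (t\<^sup>2 * \<sigma> / 4))"
    using M by (simp add: power_divide add_divide_distrib power2_eq_square)
  finally show ?thesis by (simp add: Y_def \<sigma>_def)
qed

section \<open>The majority polynomial\<close>

definition maj :: "nat \<Rightarrow> real \<Rightarrow> real" where
  "maj k x = (\<Sum>j=k+1..2*k+1. real ((2*k+1) choose j) * x ^ j * (1 - x) ^ (2*k+1-j))"

text \<open>The density of the Beta distribution with both parameters k+1; it turns out to be the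
  derivative of \<open>maj k\<close>.\<close>

definition maj' :: "nat \<Rightarrow> real \<Rightarrow> real" where
  "maj' k x = real ((2*k+1) * ((2*k) choose k)) * (x * (1 - x)) ^ k"

lemma maj_add_complement: "maj k x + maj k (1 - x) = 1"
proof -
  let ?t = "\<lambda>j. real ((2*k+1) choose j) * x ^ j * (1 - x) ^ (2*k+1-j)"
  have "maj k (1 - x) = (\<Sum>j=0..k. ?t j)"
    unfolding maj_def
    by (rule sum.reindex_bij_witness[of _ "\<lambda>j. 2*k+1-j" "\<lambda>j. 2*k+1-j"])
      (auto simp: binomial_symmetric[symmetric] mult_ac)
  moreover have "{..2*k+1} = {0..k} \<union> {k+1..2*k+1}" by auto
  then have "(\<Sum>j\<le>2*k+1. ?t j) = (\<Sum>j=0..k. ?t j) + (\<Sum>j=k+1..2*k+1. ?t j)"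
    by (simp only:) (rule sum.union_disjoint, auto)
  ultimately have "maj k x + maj k (1 - x) = (\<Sum>j\<le>2*k+1. ?t j)" by (simp add: maj_def)
  also have "\<dots> = (x + (1 - x)) ^ (2*k+1)" by (rule binomial_ring[symmetric])
  finally show ?thesis by simp
qed

lemma maj_half: "maj k (1/2) = 1/2"
  using maj_add_complement[of k "1/2"] by simp

lemma maj_nonneg: "x \<in> {0..1} \<Longrightarrow> maj k x \<ge> 0"
  unfolding maj_def by (intro sum_nonneg mult_nonneg_nonneg) auto

lemma maj_mem_unit: "x \<in> {0..1} \<Longrightarrow> maj k x \<in> {0..1}"
  using maj_nonneg[of x k] maj_nonneg[of "1 - x" k] maj_add_complement[of k x] by auto

text \<open>Each summand differentiates to two terms, and the identity (m-j) C(m,j) = (j+1) C(m,j+1)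
  makes the second one cancel against the next summand. Only the first term of index k+1 is
  left.\<close>

lemma has_real_derivative_maj: "(maj k has_real_derivative maj' k x) (at x)"
proof -
  define m where "m = 2*k+1"
  define t where "t j = real (j * (m choose j)) * x ^ (j-1) * (1 - x) ^ (m-j)" for j
  have "(maj k has_real_derivative (\<Sum>j=k+1..m. real (m choose j) *
      (real j * x ^ (j-1) * (1 - x) ^ (m-j) - real (m-j) * x ^ j * (1 - x) ^ (m-j-1)))) (at x)"
    unfolding maj_def[abs_def] m_def[symmetric]
    by (rule derivative_eq_intros refl sum.cong | simp add: algebra_simps)+
  also have "(\<Sum>j=k+1..m. real (m choose j) *
      (real j * x ^ (j-1) * (1 - x) ^ (m-j) - real (m-j) * x ^ j * (1 - x) ^ (m-j-1)))
    = (\<Sum>j=k+1..m. t j - t (Suc j))"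
  proof (rule sum.cong)
    fix j assume j: "j \<in> {k+1..m}"
    have *: "(m - j) * (m choose j) = Suc j * (m choose Suc j)"
      by (metis binomial_absorb_comp binomial_absorption)
    have "real (m-j) * real (m choose j) = real (Suc j) * real (m choose Suc j)"
      using * by (metis of_nat_mult)
    have "real (m choose j) * (real j * x ^ (j-1) * (1 - x) ^ (m-j) - real (m-j) * x ^ j * (1 - x) ^ (m-j-1))
       = t j - (real (m-j) * real (m choose j)) * x ^ j * (1 - x) ^ (m-j-1)"
      by (simp add: t_def right_diff_distrib mult_ac)
    also have "(real (m-j) * real (m choose j)) * x ^ j * (1 - x) ^ (m-j-1) = t (Suc j)"
      unfolding \<open>real (m-j) * real (m choose j) = _\<close> by (simp only: t_def of_nat_mult) simp
    finally show "real (m choose j) * (real j * x ^ (j-1) * (1 - x) ^ (m-j) - real (m-j) * x ^ j * (1 - x) ^ (m-j-1))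
       = t j - t (Suc j)" .
  qed simp
  also have "\<dots> = t (k+1) - t (Suc m)"
    using sum_telescope''[of "k+1" m "\<lambda>j. - t (j)"] sum_Suc_diff[of "k+1" m "\<lambda>j. - t j"]
    by (simp add: m_def)
  also have "t (Suc m) = 0" by (simp add: t_def binomial_eq_0 del: binomial_Suc_Suc)
  also have "t (k+1) - 0 = maj' k x"
  proof -
    have "Suc k * (m choose Suc k) = (2*k+1) * ((2*k) choose k)"
      using Suc_times_binomial_eq[of "2*k" k] by (simp add: m_def mult.commute del: binomial_Suc_Suc)
    moreover have "m - (k+1) = k" by (simp add: m_def)
    ultimately show ?thesis
      unfolding t_def maj'_def by (simp only: Suc_eq_plus1 add_diff_cancel_right' power_mult_distrib mult.assoc diff_zero)
  qed
  finally show ?thesis .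
qed

lemma has_real_derivative_maj':
  assumes "k \<ge> 1"
  shows "(maj' k has_real_derivative
    real ((2*k+1) * ((2*k) choose k)) * (real k * (x * (1 - x)) ^ (k - 1) * (1 - 2 * x))) (at x)"
  unfolding maj'_def[abs_def]
  by (rule derivative_eq_intros refl | simp add: algebra_simps)+

section \<open>Central binomial coefficients and the size of the slope at 1/2\<close>

lemma central_binomial_Suc:
  "real (Suc k) * real ((2 * Suc k) choose (Suc k)) = 2 * real (2*k+1) * real ((2*k) choose k)"
proof -
  have *: "2 * Suc k = Suc (2*k+1)" "2*k+1 = Suc (2*k)" by simp_all
  have "2 * Suc k * ((2*k+1) choose k) = ((2 * Suc k) choose Suc k) * Suc k"
    unfolding *(1) by (rule Suc_times_binomial_eq)
  then have 1: "(2 * Suc k) choose Suc k = 2 * ((2*k+1) choose k)"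
    by (metis mult.assoc mult.commute nat_mult_eq_cancel1 zero_less_Suc)
  have 2: "(2*k+1) choose k = (2*k+1) choose Suc k"
    using binomial_symmetric[of k "2*k+1"] by (simp del: binomial_Suc_Suc)
  have 3: "(2*k+1) * ((2*k) choose k) = ((2*k+1) choose Suc k) * Suc k"
    unfolding *(2) by (rule Suc_times_binomial_eq)
  have "Suc k * ((2 * Suc k) choose (Suc k)) = 2 * ((2*k+1) * ((2*k) choose k))"
    unfolding 1 2 3 by simp
  then show ?thesis by (metis of_nat_mult of_nat_numeral mult.assoc)
qed

text \<open>The normalised square changes by an explicit rational factor, so both bounds below are
  inductions: times 2k+1 the quantity decreases, times 4k it increases.\<close>

lemma central_binomial_sq_Suc:
  "(real ((2 * Suc k) choose (Suc k)))\<^sup>2 / 16 ^ Suc k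
    = (real ((2*k) choose k))\<^sup>2 / 16 ^ k * ((real (2*k+1))\<^sup>2 / (real (2*k+2))\<^sup>2)"
proof -
  have "x\<^sup>2 / 16 ^ Suc k = y\<^sup>2 / 16 ^ k * ((real (2*k+1))\<^sup>2 / (real (2*k+2))\<^sup>2)"
    if "real (Suc k) * x = 2 * real (2*k+1) * y" for x y :: real
  proof -
    have "x = 4 * (y * (real (2*k+1) / real (2*k+2)))" using that by (simp add: field_simps)
    then have "x\<^sup>2 = 16 * (y\<^sup>2 * ((real (2*k+1))\<^sup>2 / (real (2*k+2))\<^sup>2))"
      by (simp only: power_mult_distrib power_divide) simp
    then show ?thesis by simp
  qed
  then show ?thesis using central_binomial_Suc by blast
qed

lemma central_binomial_upper: "real ((2*k) choose k) * sqrt (real (2*k+1)) \<le> 4 ^ k"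
proof -
  have "(real ((2*k) choose k))\<^sup>2 / 16 ^ k * real (2*k+1) \<le> 1"
  proof (induction k)
    case (Suc k)
    have "real (2 * Suc k + 1) * real (2*k+1) \<le> (real (2*k+2))\<^sup>2"
      by (simp add: power2_eq_square algebra_simps)
    then have le: "real (2 * Suc k + 1) * real (2*k+1) / (real (2*k+2))\<^sup>2 \<le> 1" by simp
    have "(real ((2 * Suc k) choose (Suc k)))\<^sup>2 / 16 ^ Suc k * real (2 * Suc k + 1)
      = ((real ((2*k) choose k))\<^sup>2 / 16 ^ k * real (2*k+1)) * (real (2 * Suc k + 1) * real (2*k+1) / (real (2*k+2))\<^sup>2)"
      unfolding central_binomial_sq_Suc by (simp add: power2_eq_square)
    also have "\<dots> \<le> 1 * 1" using Suc le by (intro mult_mono) auto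
    finally show ?case by simp
  qed simp
  moreover have "(4 ^ k)\<^sup>2 = (16 :: real) ^ k" by (simp add: power2_eq_square flip: power_mult_distrib)
  moreover have "(real ((2*k) choose k) * sqrt (real (2*k+1)))\<^sup>2 = (real ((2*k) choose k))\<^sup>2 * real (2*k+1)"
    by (simp add: power_mult_distrib)
  ultimately have "(real ((2*k) choose k) * sqrt (real (2*k+1)))\<^sup>2 \<le> (4 ^ k)\<^sup>2"
    by (simp add: pos_divide_le_eq)
  then show ?thesis by (rule power2_le_imp_le) simp
qed

lemma central_binomial_lower:
  assumes "k \<ge> 1"
  shows "4 ^ k \<le> real ((2*k) choose k) * (2 * sqrt (real k))"
proof -
  have "1 \<le> (real ((2*k) choose k))\<^sup>2 / 16 ^ k * (4 * real k)" using assms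
  proof (induction k rule: dec_induct)
    case (step k)
    have "4 * real k * real (Suc k) \<le> (real (2*k+1))\<^sup>2"
      by (simp add: power2_eq_square algebra_simps)
    then have le: "1 \<le> (real (2*k+1))\<^sup>2 / (4 * real k * real (Suc k))" using step by simp
    have "1 * 1 \<le> ((real ((2*k) choose k))\<^sup>2 / 16 ^ k * (4 * real k)) * ((real (2*k+1))\<^sup>2 / (4 * real k * real (Suc k)))"
      using step.IH le by (intro mult_mono) auto
    also have "\<dots> = (real ((2*k) choose k))\<^sup>2 / 16 ^ k * ((real (2*k+1))\<^sup>2 / (real (2*k+2))\<^sup>2) * (4 * real (Suc k))"
    proof -
      have "4 * real k * ((real (2*k+1))\<^sup>2 / (4 * real k * real (Suc k))) = (real (2*k+1))\<^sup>2 / real (Suc k)"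
        using step.hyps by simp
      have "A / (2 * S)\<^sup>2 * (4 * S) = A / S" if "S > 0" for A S :: real
        using that by (simp add: power2_eq_square)
      note this[of "real (Suc k)" "(real (2*k+1))\<^sup>2"]
      moreover have "2 * real (Suc k) = real (2*k+2)" by simp
      ultimately have "(real (2*k+1))\<^sup>2 / (real (2*k+2))\<^sup>2 * (4 * real (Suc k)) = (real (2*k+1))\<^sup>2 / real (Suc k)"
        by (simp only:)
      with \<open>4 * real k * _ = _\<close> show ?thesis by (simp only: mult.assoc)
    qed
    also have "\<dots> = (real ((2 * Suc k) choose (Suc k)))\<^sup>2 / 16 ^ Suc k * (4 * real (Suc k))"
      unfolding central_binomial_sq_Suc by simp
    finally show ?case by simp
  qed simp
  moreover have "(4 ^ k)\<^sup>2 = (16 :: real) ^ k" by (simp add: power2_eq_square flip: power_mult_distrib)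
  moreover have "(real ((2*k) choose k) * (2 * sqrt (real k)))\<^sup>2 = (real ((2*k) choose k))\<^sup>2 * (4 * real k)"
    by (simp add: power_mult_distrib)
  ultimately have "(4 ^ k)\<^sup>2 \<le> (real ((2*k) choose k) * (2 * sqrt (real k)))\<^sup>2"
    by (simp add: pos_le_divide_eq)
  then show ?thesis by (rule power2_le_imp_le) simp
qed

text \<open>As b is at most 1-b, every term with at least k+1 successes is at most its coefficient
  times \<open>b ^ (k+1) * (1 - b) ^ k\<close>, and \<open>maj_half\<close> evaluates the sum of
  these coefficients as half of 2^(2k+1).\<close>

lemma maj_le_of_le_half:
  assumes b: "0 \<le> b" "b \<le> 1/2"
  shows "maj k b \<le> b * (4 * b * (1 - b)) ^ k"
proof -
  have "maj k b \<le> (\<Sum>j=k+1..2*k+1. real ((2*k+1) choose j) * (b ^ (k+1) * (1 - b) ^ k))"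
    unfolding maj_def
  proof (rule sum_mono)
    fix j assume j: "j \<in> {k+1..2*k+1}"
    have "b ^ j * (1 - b) ^ (2*k+1-j) = b ^ (k+1) * (b ^ (j-(k+1)) * (1 - b) ^ (2*k+1-j))"
      using j by (simp add: power_add[symmetric] del: power_Suc)
    also have "\<dots> \<le> b ^ (k+1) * ((1 - b) ^ (j-(k+1)) * (1 - b) ^ (2*k+1-j))"
      using b by (intro mult_left_mono mult_right_mono power_mono) auto
    also have "\<dots> = b ^ (k+1) * (1 - b) ^ k"
      using j by (simp add: power_add[symmetric])
    finally show "real ((2*k+1) choose j) * b ^ j * (1 - b) ^ (2*k+1-j) \<le> real ((2*k+1) choose j) * (b ^ (k+1) * (1 - b) ^ k)"
      by (simp add: mult.assoc mult_left_mono)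
  qed
  also have "\<dots> = maj k (1/2) * 2 ^ (2*k+1) * (b ^ (k+1) * (1 - b) ^ k)"
  proof -
    have "maj k (1/2) = (\<Sum>j=k+1..2*k+1. real ((2*k+1) choose j) * (1/2) ^ (2*k+1))"
      unfolding maj_def
      by (intro sum.cong refl) (simp add: mult.assoc power_add[symmetric] del: power_Suc)
    then have "maj k (1/2) * 2 ^ (2*k+1) = (\<Sum>j=k+1..2*k+1. real ((2*k+1) choose j))"
      using power_mult_distrib[of "1/2 :: real" 2 "2*k+1"]
      by (simp only: sum_distrib_right mult.assoc) simp
    then show ?thesis by (simp only: sum_distrib_right)
  qed
  also have "\<dots> = b * (4 * b * (1 - b)) ^ k"
    by (simp add: maj_half power_mult_distrib power_mult)
  finally show ?thesis .
qed

lemma maj'_half: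
  "maj' k (1/2 - x) = real ((2*k+1) * ((2*k) choose k)) / 4 ^ k * (1 - 4 * x\<^sup>2) ^ k"
proof -
  have "(1/2 - x) * (1 - (1/2 - x)) = (1 - 4 * x\<^sup>2) / 4" by (simp add: power2_eq_square algebra_simps)
  then show ?thesis by (simp only: maj'_def power_divide times_divide_eq_right times_divide_eq_left)
qed

text \<open>The left side is \<open>maj' k (1/2)\<close>, the slope at a tie, by
  \<open>maj'_half\<close>; with the next lemma it is of order sqrt k.\<close>

lemma central_factor_upper: "real ((2*k+1) * ((2*k) choose k)) / 4 ^ k \<le> sqrt (real (2*k+1))"
proof -
  have "sqrt (real (2*k+1)) * sqrt (real (2*k+1)) = real (2*k+1)" by simp
  then have "real ((2*k+1) * ((2*k) choose k)) = sqrt (real (2*k+1)) * (real ((2*k) choose k) * sqrt (real (2*k+1)))"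
    by (metis of_nat_mult mult.assoc mult.commute)
  also have "\<dots> \<le> sqrt (real (2*k+1)) * 4 ^ k"
    by (intro mult_left_mono central_binomial_upper) auto
  finally show ?thesis by (simp add: field_simps)
qed

lemma central_factor_lower:
  assumes "k \<ge> 1"
  shows "sqrt (real k) \<le> real ((2*k+1) * ((2*k) choose k)) / 4 ^ k"
proof -
  have "sqrt (real k) * 4 ^ k \<le> sqrt (real k) * (real ((2*k) choose k) * (2 * sqrt (real k)))"
    by (intro mult_left_mono central_binomial_lower assms) auto
  also have "\<dots> = real ((2*k) * ((2*k) choose k))" by simp
  also have "\<dots> \<le> real ((2*k+1) * ((2*k) choose k))" by (intro of_nat_mono mult_right_mono) auto
  finally show ?thesis by (simp add: field_simps)
qed

text \<open>Within distance 1/(4 sqrt k) of 1/2, Bernoulli's inequality keeps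
  \<open>(1 - 4 * y\<^sup>2) ^ k\<close> above 3/4, so the slope stays above 3/4 sqrt k.\<close>

lemma maj_drift:
  assumes k: "k \<ge> 1" and x: "0 \<le> x" "x \<le> 1 / (4 * sqrt (real k))"
  shows "maj k (1/2 - x) \<le> 1/2 - 3/4 * sqrt (real k) * x"
proof -
  have "1/2 - maj k (1/2 - 0) - 3/4 * sqrt (real k) * 0 \<le> 1/2 - maj k (1/2 - x) - 3/4 * sqrt (real k) * x"
  proof (rule DERIV_nonneg_imp_nondecreasing[of 0 x "\<lambda>x. 1/2 - maj k (1/2 - x) - 3/4 * sqrt (real k) * x"])
    fix y assume y: "0 \<le> y" "y \<le> x"
    have "y\<^sup>2 \<le> (1 / (4 * sqrt (real k)))\<^sup>2" using x y by (intro power_mono) auto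
    then have "y\<^sup>2 * (16 * real k) \<le> 1" using k by (simp add: power_divide power_mult_distrib field_simps)
    then have y2: "4 * y\<^sup>2 * real k \<le> 1/4" by simp
    have "4 * y\<^sup>2 \<le> 4 * y\<^sup>2 * real k" using k by (simp add: mult_le_cancel_left1)
    then have "3/4 \<le> 1 + real k * (- (4 * y\<^sup>2))" "-1 \<le> - (4 * y\<^sup>2)" using y2 by (simp_all add: mult_ac)
    then have "3/4 \<le> (1 - 4 * y\<^sup>2) ^ k"
      using Bernoulli_inequality[of "- (4 * y\<^sup>2)" k] by simp
    then have "sqrt (real k) * (3/4) \<le> real ((2*k+1) * ((2*k) choose k)) / 4 ^ k * (1 - 4 * y\<^sup>2) ^ k"
      by (intro mult_mono central_factor_lower k) auto
    then have "maj' k (1/2 - y) - 3/4 * sqrt (real k) \<ge> 0" unfolding maj'_half by simp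
    moreover have "((\<lambda>x. 1/2 - maj k (1/2 - x) - 3/4 * sqrt (real k) * x) has_real_derivative
        maj' k (1/2 - y) - 3/4 * sqrt (real k)) (at y)"
      by (auto intro!: derivative_eq_intros DERIV_chain2[OF has_real_derivative_maj])
    ultimately show "\<exists>d. ((\<lambda>x. 1/2 - maj k (1/2 - x) - 3/4 * sqrt (real k) * x) has_real_derivative d) (at y) \<and> 0 \<le> d"
      by blast
  qed (use x in auto)
  then show ?thesis by (simp add: maj_half)
qed

lemma maj_mono:
  assumes "0 \<le> x" "x \<le> y" "y \<le> 1"
  shows "maj k x \<le> maj k y"
  using assms
  by (intro DERIV_nonneg_imp_nondecreasing[of x y "maj k"])
    (auto intro!: exI[of _ "maj' k _"] has_real_derivative_maj simp: maj'_def)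

lemma maj'_bound:
  assumes k: "k \<ge> 1" and x: "x \<in> {0..1}"
  shows "\<bar>maj' k x\<bar> \<le> 2 * sqrt (real k)"
proof -
  have "x * (1 - x) \<le> 1/4" using sum_squares_ge_zero[of "x - 1/2" 0] by (simp add: algebra_simps)
  then have "(x * (1 - x)) ^ k \<le> (1/4) ^ k" using x by (intro power_mono) auto
  then have "maj' k x \<le> real ((2*k+1) * ((2*k) choose k)) * (1/4) ^ k"
    unfolding maj'_def by (intro mult_left_mono) auto
  also have "\<dots> \<le> sqrt (real (2*k+1))" using central_factor_upper[of k] by (simp add: power_divide)
  also have "\<dots> \<le> sqrt (4 * real k)" using k by simp
  finally have "maj' k x \<le> 2 * sqrt (real k)" by (simp add: real_sqrt_mult)
  moreover have "maj' k x \<ge> 0" using x by (auto simp: maj'_def)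
  ultimately show ?thesis by simp
qed

lemma maj_Lipschitz:
  assumes k: "k \<ge> 1" and "x \<in> {0..1}" "y \<in> {0..1}"
  shows "\<bar>maj k x - maj k y\<bar> \<le> 2 * sqrt (real k) * \<bar>x - y\<bar>"
  using field_differentiable_bound[of "{0..1}" "maj k" "maj' k" "2 * sqrt (real k)" x y] assms
    maj'_bound[OF k] has_real_derivative_maj[of k]
  by (auto intro: DERIV_subset)

text \<open>The prefactors alone are of order k sqrt k. With u = 1-2x, the remaining factor
  \<open>\<bar>u\<bar> * (1 - u\<^sup>2) ^ (k - 1)\<close> is at most 1/sqrt k, since the factor u
  vanishes where the power is large. This saving of sqrt k is what reduces the error of the mean to
  order 1/sqrt n.\<close>

lemma maj''_bound:
  assumes k: "k \<ge> 2" and x: "x \<in> {0..1}"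
  shows "\<bar>real ((2*k+1) * ((2*k) choose k)) * (real k * (x * (1 - x)) ^ (k - 1) * (1 - 2 * x))\<bar> \<le> 8 * real k"
proof -
  define u where "u = 1 - 2 * x"
  have u1: "u\<^sup>2 \<le> 1" using x by (auto simp: u_def abs_square_le_1 abs_le_iff)
  have xu: "x * (1 - x) = (1 - u\<^sup>2) / 4" by (simp add: u_def power2_eq_square algebra_simps)
  have pos: "0 < 1 + real k * u\<^sup>2" by (simp add: add_pos_nonneg)
  have dec: "(1 - u\<^sup>2) ^ (2 * (k - 1)) \<le> 1 / (1 + real k * u\<^sup>2)"
  proof -
    \<comment> \<open>Here k \<ge> 2 enters, through 2(k-1) \<ge> k.\<close>
    have "(1 - u\<^sup>2) ^ (2 * (k - 1)) \<le> (1 - u\<^sup>2) ^ k"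
      using k u1 by (intro power_decreasing) auto
    moreover have "(1 - u\<^sup>2) ^ k * (1 + real k * u\<^sup>2) \<le> (1 - u\<^sup>2) ^ k * (1 + u\<^sup>2) ^ k"
      using u1 Bernoulli_inequality[of "u\<^sup>2" k] order_trans[of "-1" 0 "u\<^sup>2"] by (intro mult_left_mono) auto
    moreover have "(1 - u\<^sup>2) ^ k * (1 + u\<^sup>2) ^ k = (1 - u^4) ^ k"
      by (simp add: power_mult_distrib[symmetric] algebra_simps power2_eq_square power4_eq_xxxx)
    moreover have "(1 - u^4) ^ k \<le> 1"
    proof (rule power_le_one)
      have "u^4 = (u\<^sup>2)\<^sup>2" by (simp add: power2_eq_square power4_eq_xxxx)
      then show "0 \<le> 1 - u^4" using u1 power_le_one[of "u\<^sup>2" 2] by simp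
      show "1 - u^4 \<le> 1" by simp
    qed
    ultimately have "(1 - u\<^sup>2) ^ (2 * (k - 1)) * (1 + real k * u\<^sup>2) \<le> 1"
      by (smt (verit, best) mult_right_mono pos)
    then show ?thesis using pos by (simp add: field_simps)
  qed
  have "(sqrt (real k) * (\<bar>u\<bar> * (1 - u\<^sup>2) ^ (k - 1)))\<^sup>2 = real k * u\<^sup>2 * (1 - u\<^sup>2) ^ (2 * (k - 1))"
    by (simp add: power_mult_distrib power_even_eq)
  also have "\<dots> \<le> real k * u\<^sup>2 * (1 / (1 + real k * u\<^sup>2))"
    by (intro mult_left_mono dec) auto
  also have "\<dots> \<le> 1\<^sup>2" using pos by (simp add: field_simps)
  finally have su: "sqrt (real k) * (\<bar>u\<bar> * (1 - u\<^sup>2) ^ (k - 1)) \<le> 1" by (rule power2_le_imp_le) simp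
  have "\<bar>real ((2*k+1) * ((2*k) choose k)) * (real k * (x * (1 - x)) ^ (k - 1) * (1 - 2 * x))\<bar>
     = 4 * (real ((2*k+1) * ((2*k) choose k)) / 4 ^ k) * real k * (\<bar>u\<bar> * (1 - u\<^sup>2) ^ (k - 1))"
  proof -
    have "(4::real) ^ k = 4 * 4 ^ (k - 1)" using k by (cases k) auto
    then show ?thesis using u1 unfolding xu u_def[symmetric]
      by (simp add: abs_mult power_divide power_abs abs_of_nonneg del: of_nat_mult of_nat_add)
  qed
  also have "\<dots> \<le> 4 * (2 * sqrt (real k)) * real k * (\<bar>u\<bar> * (1 - u\<^sup>2) ^ (k - 1))"
  proof -
    have "sqrt (real (2*k+1)) \<le> sqrt (4 * real k)" using k by simp
    then have "real ((2*k+1) * ((2*k) choose k)) / 4 ^ k \<le> 2 * sqrt (real k)"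
      using central_factor_upper[of k] by (simp add: real_sqrt_mult)
    then show ?thesis using u1 by (intro mult_right_mono mult_left_mono) auto
  qed
  also have "\<dots> = 8 * real k * (sqrt (real k) * (\<bar>u\<bar> * (1 - u\<^sup>2) ^ (k - 1)))" by simp
  also have "\<dots> \<le> 8 * real k * 1" by (intro mult_left_mono su) auto
  finally show ?thesis by simp
qed

text \<open>The mean value inequality is applied to \<open>maj'\<close> and then to
  \<open>maj k\<close> minus its tangent slope times y; this loses only the factor 1/2 of Taylor's
  formula.\<close>

lemma maj_Taylor:
  assumes k: "k \<ge> 2" and x: "x \<in> {0..1}" and a: "a \<in> {0..1}"
  shows "\<bar>maj k x - maj k a - maj' k a * (x - a)\<bar> \<le> 8 * real k * (x - a)\<^sup>2"
proof -
  have seg: "closed_segment a x \<subseteq> {0..1}"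
    using x a by (intro closed_segment_subset) auto
  have lip: "\<bar>maj' k y - maj' k a\<bar> \<le> 8 * real k * \<bar>y - a\<bar>" if "y \<in> {0..1}" for y
    using field_differentiable_bound[of "{0..1}" "maj' k"
      "\<lambda>x. real ((2*k+1) * ((2*k) choose k)) * (real k * (x * (1 - x)) ^ (k - 1) * (1 - 2 * x))" "8 * real k" y a]
      that a k maj''_bound[OF k] has_real_derivative_maj'[of k]
    by (auto intro: DERIV_subset simp del: of_nat_mult)
  have "norm ((maj k x - maj' k a * x) - (maj k a - maj' k a * a)) \<le> (8 * real k * \<bar>x - a\<bar>) * norm (x - a)"
  proof (rule field_differentiable_bound[where S = "closed_segment a x" and f = "\<lambda>y. maj k y - maj' k a * y" and f' = "\<lambda>y. maj' k y - maj' k a"])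
    fix y assume y: "y \<in> closed_segment a x"
    show "((\<lambda>y. maj k y - maj' k a * y) has_field_derivative maj' k y - maj' k a) (at y within closed_segment a x)"
      by (auto intro!: derivative_eq_intros DERIV_subset[OF has_real_derivative_maj])
    have "\<bar>y - a\<bar> \<le> \<bar>x - a\<bar>" using y by (auto simp: closed_segment_eq_real_ivl split: if_splits)
    then have "8 * real k * \<bar>y - a\<bar> \<le> 8 * real k * \<bar>x - a\<bar>" by (intro mult_left_mono) auto
    moreover have "y \<in> {0..1}" using y seg by auto
    ultimately show "norm (maj' k y - maj' k a) \<le> 8 * real k * \<bar>x - a\<bar>" using lip[of y] by simp
  qed auto
  moreover have "(maj k x - maj' k a * x) - (maj k a - maj' k a * a) = maj k x - maj k a - maj' k a * (x - a)"
    by (simp add: algebra_simps)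
  moreover have "(8 * real k * \<bar>x - a\<bar>) * norm (x - a) = 8 * real k * (x - a)\<^sup>2"
    by (simp add: power2_eq_square[symmetric])
  ultimately show ?thesis by (metis real_norm_def)
qed

text \<open>63/64 is the value of 4b(1-b) at b = 7/16, the largest share of the minority that an
  unexceptional neighbourhood may have. The bound is Bernoulli's inequality for 64/63 = 1 +
  1/63.\<close>

lemma power_63_64_le:
  assumes "k \<ge> 1"
  shows "(63/64 :: real) ^ k \<le> 64 / real k"
proof -
  have "(63/64 :: real) ^ k * (real k / 64) \<le> (63/64) ^ k * (1 + 1/63) ^ k"
    using Bernoulli_inequality[of "1/63 :: real" k] by (intro mult_left_mono) auto
  also have "\<dots> = 1" by (simp add: power_mult_distrib[symmetric])
  finally show ?thesis using assms by (simp add: pos_le_divide_eq)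
qed

section \<open>One round of best-of-(2k+1)\<close>

lemma bool_pmf_eq_bernoulli:
  assumes "pmf M True = p"
  shows "M = bernoulli_pmf p"
proof -
  have "p \<in> {0..1}" using assms pmf_nonneg[of M True] pmf_le_1[of M True] by auto
  then show ?thesis using assms
    by (intro pmf_eqI) (case_tac i, auto simp: pmf_False_conv_True)
qed

lemma map_binomial_pmf_majority:
  assumes p: "p \<in> {0..1}"
  shows "map_pmf (\<lambda>c. c \<ge> k + 1) (binomial_pmf (2*k+1) p) = bernoulli_pmf (maj k p)"
proof (rule bool_pmf_eq_bernoulli)
  let ?B = "binomial_pmf (2*k+1) p"
  have "pmf (map_pmf (\<lambda>c. c \<ge> k + 1) ?B) True = measure_pmf.prob ?B {c. c \<ge> k + 1}"
    by (simp add: pmf_map vimage_def)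
  also have "\<dots> = measure_pmf.prob ?B {k+1..2*k+1}"
  proof (rule measure_prob_cong_0)
    fix c assume "c \<in> {c. c \<ge> k + 1} - {k+1..2*k+1}"
    then have "c > 2*k+1" by auto
    then show "pmf ?B c = 0" using p by (simp add: binomial_eq_0 del: binomial_Suc_Suc)
  qed auto
  also have "\<dots> = maj k p"
    using p by (simp add: measure_measure_pmf_finite maj_def del: binomial_Suc_Suc)
  finally show "pmf (map_pmf (\<lambda>c. c \<ge> k + 1) ?B) True = maj k p" .
qed

lemma map_pmf_of_set_mem:
  assumes "finite N" "N \<noteq> {}"
  shows "map_pmf (\<lambda>x. x \<in> A) (pmf_of_set N) = bernoulli_pmf (real (card (N \<inter> A)) / real (card N))"
proof (rule bool_pmf_eq_bernoulli)
  have "N \<inter> ((\<lambda>x. x \<in> A) -` {True}) = N \<inter> A" by auto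
  then show "pmf (map_pmf (\<lambda>x. x \<in> A) (pmf_of_set N)) True = real (card (N \<inter> A)) / real (card N)"
    using assms by (simp add: pmf_map measure_pmf_of_set)
qed

lemma map_samples_majority:
  assumes N: "finite N" "N \<noteq> {}"
  shows "map_pmf (\<lambda>r. card {i. i < 2*k+1 \<and> r i \<in> A} \<ge> k+1) (Pi_pmf {..<2*k+1} d (\<lambda>_. pmf_of_set N))
    = bernoulli_pmf (maj k (real (card (N \<inter> A)) / real (card N)))"
proof -
  let ?P = "Pi_pmf {..<2*k+1} d (\<lambda>_. pmf_of_set N)" and ?b = "real (card (N \<inter> A)) / real (card N)"
  have b: "?b \<in> {0..1}" using N by (auto simp: divide_le_eq_1 card_gt_0_iff card_mono)
  have "map_pmf (\<lambda>r. card {i. i < 2*k+1 \<and> r i \<in> A} \<ge> k+1) ?P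
    = map_pmf (\<lambda>c. c \<ge> k+1) (map_pmf (\<lambda>f. card {i\<in>{..<2*k+1}. f i}) (map_pmf (\<lambda>h. (\<lambda>x. x \<in> A) \<circ> h) ?P))"
    by (simp add: map_pmf_comp o_def)
  also have "map_pmf (\<lambda>h. (\<lambda>x. x \<in> A) \<circ> h) ?P = Pi_pmf {..<2*k+1} (d \<in> A) (\<lambda>_. bernoulli_pmf ?b)"
    by (subst Pi_pmf_map[symmetric, where dflt' = "d \<in> A"]) (simp_all add: map_pmf_of_set_mem[OF N])
  also have "map_pmf (\<lambda>f. card {i\<in>{..<2*k+1}. f i}) \<dots> = binomial_pmf (2*k+1) ?b"
    by (rule binomial_pmf_altdef'[symmetric]) (use b in auto)
  finally show ?thesis by (simp only: map_binomial_pmf_majority[OF b])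
qed

lemma map_Pi_pmf_rand_subset:
  assumes V: "finite V" and g: "\<And>v. v \<in> V \<Longrightarrow> map_pmf g (P v) = bernoulli_pmf (q v)"
  shows "map_pmf (\<lambda>s. {v\<in>V. g (s v)}) (Pi_pmf V d P) = rand_subset V q"
proof -
  have "map_pmf (\<lambda>s. {v\<in>V. g (s v)}) (Pi_pmf V d P)
    = map_pmf (\<lambda>f. {v\<in>V. f v}) (map_pmf (\<lambda>h. g \<circ> h) (Pi_pmf V d P))"
    by (simp add: map_pmf_comp)
  also have "map_pmf (\<lambda>h. g \<circ> h) (Pi_pmf V d P) = Pi_pmf V (g d) (\<lambda>v. map_pmf g (P v))"
    by (rule Pi_pmf_map[symmetric]) (use V in auto)
  \<comment> \<open>Off \<open>V\<close> the mapped family takes the value \<open>g d\<close>, not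
    \<open>False\<close>. The set only reads values on \<open>V\<close>, so the default can be
    swapped.\<close>
  also have "map_pmf (\<lambda>f. {v\<in>V. f v}) \<dots>
    = map_pmf (\<lambda>f. {v\<in>V. f v}) (map_pmf (\<lambda>f x. if x \<in> V then f x else False) (Pi_pmf V (g d) (\<lambda>v. map_pmf g (P v))))"
    by (simp add: map_pmf_comp cong: conj_cong)
  also have "\<dots> = rand_subset V q"
    unfolding Pi_pmf_default_swap[OF V] rand_subset_def using g
    by (intro arg_cong2[of _ _ _ _ map_pmf] Pi_pmf_cong) auto
  finally show ?thesis .
qed

text \<open>An odd number of samples excludes ties, so no vertex ever falls back on its own
  opinion.\<close>

lemma best_of_odd:
  "best_of (2*k+1) V s A = {v\<in>V. card {i. i < 2*k+1 \<and> s v i \<in> A} \<ge> k+1}"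
proof -
  have sum_eq: "card {i. i < 2*k+1 \<and> s v i \<in> A} + card {i. i < 2*k+1 \<and> s v i \<notin> A} = 2*k+1" for v
  proof -
    have "card ({i. i < 2*k+1 \<and> s v i \<in> A} \<union> {i. i < 2*k+1 \<and> s v i \<notin> A})
       = card {i. i < 2*k+1 \<and> s v i \<in> A} + card {i. i < 2*k+1 \<and> s v i \<notin> A}"
      by (rule card_Un_disjoint) auto
    moreover have "{i. i < 2*k+1 \<and> s v i \<in> A} \<union> {i. i < 2*k+1 \<and> s v i \<notin> A} = {..<2*k+1}" by auto
    ultimately show ?thesis by simp
  qed
  have "\<not> card {i. i < 2*k+1 \<and> s v i \<in> A} \<ge> k+1 \<longleftrightarrow> card {i. i < 2*k+1 \<and> s v i \<notin> A} \<ge> k+1" for v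
    using sum_eq[of v] by linarith
  then show ?thesis by (auto simp: best_of_def)
qed

section \<open>The degree measure and the exact law of one round on a fixed graph\<close>

locale no_isolated =
  fixes V :: "'a set" and E :: "'a set set"
  assumes finite_V: "finite V"
    and nbrs_subset: "v \<in> V \<Longrightarrow> nbrs E v \<subseteq> V"
    and nbrs_nonempty: "v \<in> V \<Longrightarrow> nbrs E v \<noteq> {}"
    and V_nonempty: "V \<noteq> {}"
begin

definition vol :: real where "vol = (\<Sum>v\<in>V. real (card (nbrs E v)))"

definition wt :: "'a \<Rightarrow> real" where "wt v = real (card (nbrs E v)) / vol"

definition mass :: "'a set \<Rightarrow> real" where "mass A = (\<Sum>v\<in>V. wt v * of_bool (v \<in> A))"

definition nfrac :: "'a set \<Rightarrow> 'a \<Rightarrow> real" where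
  "nfrac A v = real (card (nbrs E v \<inter> A)) / real (card (nbrs E v))"

lemma card_nbrs_pos: "v \<in> V \<Longrightarrow> card (nbrs E v) > 0"
  using nbrs_nonempty nbrs_subset finite_V by (meson card_gt_0_iff finite_subset)

lemma vol_pos: "vol > 0"
  unfolding vol_def using finite_V V_nonempty card_nbrs_pos by (intro sum_pos) auto

lemma wt_pos: "v \<in> V \<Longrightarrow> wt v > 0"
  using card_nbrs_pos vol_pos by (simp add: wt_def)

lemma sum_wt: "(\<Sum>v\<in>V. wt v) = 1"
  using vol_pos by (simp add: wt_def sum_divide_distrib[symmetric] vol_def[symmetric])

lemma nfrac_mem_unit: "v \<in> V \<Longrightarrow> nfrac A v \<in> {0..1}"
  using card_nbrs_pos[of v] card_mono[of "nbrs E v" "nbrs E v \<inter> A"] finite_subset[OF nbrs_subset finite_V, of v]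
  by (auto simp: nfrac_def divide_le_eq_1)

lemma mass_nonneg: "mass A \<ge> 0"
  unfolding mass_def using wt_pos by (intro sum_nonneg) (auto simp: less_imp_le)

lemma mass_complement: "mass (V - A) = 1 - mass A"
proof -
  have "mass (V - A) + mass A = (\<Sum>v\<in>V. wt v)"
    unfolding mass_def sum.distrib[symmetric] by (intro sum.cong) auto
  then show ?thesis by (simp add: sum_wt)
qed

lemma mass_mem_unit: "mass A \<in> {0..1}"
  using mass_nonneg[of A] mass_nonneg[of "V - A"] mass_complement[of A] by auto

lemma nfrac_complement: "v \<in> V \<Longrightarrow> nfrac (V - A) v = 1 - nfrac A v"
proof -
  assume v: "v \<in> V"
  have fin: "finite (nbrs E v)" using finite_subset[OF nbrs_subset[OF v] finite_V] .
  have "nbrs E v \<inter> (V - A) = nbrs E v - nbrs E v \<inter> A" using nbrs_subset[OF v] by auto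
  then have "card (nbrs E v \<inter> (V - A)) = card (nbrs E v) - card (nbrs E v \<inter> A)"
    using fin by (simp add: card_Diff_subset)
  moreover have "card (nbrs E v \<inter> A) \<le> card (nbrs E v)" using fin by (intro card_mono) auto
  ultimately show ?thesis using card_nbrs_pos[OF v] by (simp add: nfrac_def of_nat_diff field_simps)
qed

text \<open>Stationarity of the degree measure: both sides count, up to the factor
  \<open>vol\<close>, the ordered adjacent pairs whose second vertex is in \<open>A\<close>, and
  adjacency is symmetric.\<close>

lemma sum_wt_nfrac: "(\<Sum>v\<in>V. wt v * nfrac A v) = mass A"
proof -
  have card_eq: "real (card (nbrs E v \<inter> B)) = (\<Sum>w\<in>V. of_bool (w \<in> nbrs E v \<and> w \<in> B))" if "v \<in> V" for v B
  proof -
    have "(\<Sum>w\<in>V. of_bool (w \<in> nbrs E v \<and> w \<in> B)) = (real (card (V \<inter> {w. w \<in> nbrs E v \<and> w \<in> B})))"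
      using finite_V by (simp add: sum.inter_filter[symmetric] of_bool_def sum.If_cases Int_def)
    also have "V \<inter> {w. w \<in> nbrs E v \<and> w \<in> B} = nbrs E v \<inter> B" using nbrs_subset[OF that] by auto
    finally show ?thesis ..
  qed
  have "(\<Sum>v\<in>V. wt v * nfrac A v) = (\<Sum>v\<in>V. real (card (nbrs E v \<inter> A))) / vol"
    unfolding sum_divide_distrib wt_def nfrac_def using card_nbrs_pos by (intro sum.cong) auto
  also have "(\<Sum>v\<in>V. real (card (nbrs E v \<inter> A))) = (\<Sum>v\<in>V. \<Sum>w\<in>V. of_bool (w \<in> nbrs E v \<and> w \<in> A))"
    by (intro sum.cong card_eq) auto
  also have "\<dots> = (\<Sum>w\<in>V. \<Sum>v\<in>V. of_bool (v \<in> nbrs E w \<and> v \<in> UNIV) * of_bool (w \<in> A))"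
    by (subst sum.swap) (intro sum.cong refl, auto simp: nbrs_def insert_commute)
  also have "\<dots> = (\<Sum>w\<in>V. real (card (nbrs E w)) * of_bool (w \<in> A))"
    unfolding sum_distrib_right[symmetric] using card_eq[of _ UNIV] by (intro sum.cong) auto
  also have "\<dots> / vol = mass A"
    by (simp add: mass_def wt_def sum_divide_distrib del: sum_mult_of_bool_eq)
  finally show ?thesis .
qed

lemma map_best_of_samples:
  "map_pmf (\<lambda>s. best_of (2*k+1) V s A) (samples_pmf (2*k+1) V E) = rand_subset V (\<lambda>v. maj k (nfrac A v))"
  unfolding best_of_odd samples_pmf_def
proof (rule map_Pi_pmf_rand_subset[OF finite_V])
  fix v assume v: "v \<in> V"
  have "nbr_pmf E v = pmf_of_set (nbrs E v)" using nbrs_nonempty[OF v] by (simp add: nbr_pmf_def)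
  then show "map_pmf (\<lambda>r. card {i. i < 2*k+1 \<and> r i \<in> A} \<ge> k+1) (Pi_pmf {..<2*k+1} undefined (\<lambda>_. nbr_pmf E v))
      = bernoulli_pmf (maj k (nfrac A v))"
    unfolding nfrac_def
    using map_samples_majority[OF finite_subset[OF nbrs_subset[OF v] finite_V] nbrs_nonempty[OF v]] by simp
qed

abbreviation step :: "nat \<Rightarrow> 'a set \<Rightarrow> 'a set pmf" where
  "step k A \<equiv> rand_subset V (\<lambda>v. maj k (nfrac A v))"

lemma maj_nfrac: "v \<in> V \<Longrightarrow> maj k (nfrac A v) \<in> {0..1}"
  using nfrac_mem_unit maj_mem_unit by blast

lemma set_step: "S \<in> set_pmf (step k A) \<Longrightarrow> S \<subseteq> V"
  using set_rand_subset[of V] by blast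

definition drift :: "nat \<Rightarrow> 'a set \<Rightarrow> real" where
  "drift k A = (\<Sum>v\<in>V. wt v * maj k (nfrac A v))"

lemma drift_nonneg: "drift k A \<ge> 0"
  unfolding drift_def using maj_nfrac[of _ k A] wt_pos by (intro sum_nonneg mult_nonneg_nonneg) (auto simp: less_imp_le)

lemma drift_le_1: "drift k A \<le> 1"
proof -
  have "drift k A \<le> (\<Sum>v\<in>V. wt v * 1)"
    unfolding drift_def using maj_nfrac[of _ k A] wt_pos by (intro sum_mono mult_left_mono) (auto simp: less_imp_le)
  then show ?thesis by (simp add: sum_wt)
qed

lemma expectation_mass: "measure_pmf.expectation (step k A) mass = drift k A"
  unfolding mass_def[abs_def] drift_def
  by (rule expectation_sum_rand_subset[OF finite_V maj_nfrac])

lemma variance_mass_eq: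
  "measure_pmf.expectation (step k A) (\<lambda>S. (mass S - drift k A)\<^sup>2)
    = (\<Sum>v\<in>V. (wt v)\<^sup>2 * (maj k (nfrac A v) * (1 - maj k (nfrac A v))))"
  unfolding mass_def[abs_def] drift_def
  by (rule variance_sum_rand_subset[OF finite_V maj_nfrac])

text \<open>Of q(1-q) the factor q is kept. Near consensus the potential is linear in the minority
  mass, so the noise must be bounded in proportion to that mass too.\<close>

lemma variance_mass_le:
  assumes c: "\<And>v. v \<in> V \<Longrightarrow> wt v \<le> c"
  shows "measure_pmf.expectation (step k A) (\<lambda>S. (mass S - drift k A)\<^sup>2) \<le> c * drift k A"
  unfolding variance_mass_eq unfolding drift_def sum_distrib_left
proof (rule sum_mono)
  fix v assume v: "v \<in> V"
  let ?q = "maj k (nfrac A v)"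
  have "(wt v)\<^sup>2 * (?q * (1 - ?q)) \<le> (c * wt v) * (?q * 1)"
    unfolding power2_eq_square
    using v wt_pos[OF v] c[OF v] maj_nfrac[OF v, of k A] by (intro mult_mono) auto
  then show "(wt v)\<^sup>2 * (?q * (1 - ?q)) \<le> c * (wt v * ?q)" by simp
qed

text \<open>Exchanging the opinions commutes with a round because
  \<open>maj k x + maj k (1 - x) = 1\<close>; this reduces the contraction to mass at most
  1/2.\<close>

lemma step_complement:
  assumes "A \<subseteq> V"
  shows "map_pmf (\<lambda>S. V - S) (step k (V - A)) = step k A"
proof (rule pmf_eqI)
  fix S
  show "pmf (map_pmf (\<lambda>S. V - S) (step k (V - A))) S = pmf (step k A) S"
  proof (cases "S \<subseteq> V")
    case False
    then have "pmf (map_pmf (\<lambda>S. V - S) (step k (V - A))) S = 0" by (auto simp: pmf_eq_0_set_pmf)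
    moreover have "pmf (step k A) S = 0" using False set_step by (auto simp: pmf_eq_0_set_pmf)
    ultimately show ?thesis by simp
  next
    case True
    have q: "maj k (nfrac (V - A) v) = 1 - maj k (nfrac A v)" if "v \<in> V" for v
      using maj_add_complement[of k "nfrac A v"] nfrac_complement[OF that] by simp
    have "pmf (map_pmf (\<lambda>S. V - S) (step k (V - A))) S = measure_pmf.prob (step k (V - A)) ((\<lambda>S. V - S) -` {S})"
      by (simp add: pmf_map)
    also have "\<dots> = measure_pmf.prob (step k (V - A)) {V - S}"
    proof (rule measure_prob_cong_0)
      fix T assume T: "T \<in> (\<lambda>S. V - S) -` {S} - {V - S}"
      then have "\<not> T \<subseteq> V" by auto
      then show "pmf (step k (V - A)) T = 0" using set_step by (auto simp: pmf_eq_0_set_pmf)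
    qed (use True in auto)
    also have "\<dots> = pmf (step k (V - A)) (V - S)" by (simp add: measure_pmf_single)
    also have "\<dots> = (\<Prod>v\<in>V - S. maj k (nfrac (V - A) v)) * (\<Prod>v\<in>V - (V - S). 1 - maj k (nfrac (V - A) v))"
      by (rule pmf_rand_subset[OF finite_V maj_nfrac]) auto
    also have "V - (V - S) = S" using True by auto
    also have "(\<Prod>v\<in>V - S. maj k (nfrac (V - A) v)) = (\<Prod>v\<in>V - S. 1 - maj k (nfrac A v))"
      using q by (intro prod.cong) auto
    also have "(\<Prod>v\<in>S. 1 - maj k (nfrac (V - A) v)) = (\<Prod>v\<in>S. maj k (nfrac A v))"
      using q True by (intro prod.cong) auto
    also have "(\<Prod>v\<in>V - S. 1 - maj k (nfrac A v)) * (\<Prod>v\<in>S. maj k (nfrac A v)) = pmf (step k A) S"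
      by (subst pmf_rand_subset[OF finite_V maj_nfrac True]) auto
    finally show ?thesis .
  qed
qed

end

section \<open>Contraction of the potential\<close>

text \<open>\<open>a\<close> is the mass of opinion 0, \<open>s\<close> is \<open>sqrt n\<close> and \<open>\<kappa>\<close> is the fourth root of \<open>k\<close>. Near \<open>1/2\<close> the potential
  is the inverse of the bias in units of \<open>1/s\<close>, cut off at \<open>1/\<kappa>\<close> units, where the noise of one round takes
  over.\<close>

definition pot :: "real \<Rightarrow> real \<Rightarrow> real \<Rightarrow> real" where
  "pot s \<kappa> a =
    (if 1/8 \<le> \<bar>a - 1/2\<bar> then min a (1 - a) / s
     else if 1 / (4 * \<kappa>\<^sup>2) \<le> \<bar>a - 1/2\<bar> then \<kappa> / s
     else 1 / max (s * \<bar>a - 1/2\<bar>) (1 / \<kappa>))"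

lemma pot_complement: "pot s \<kappa> (1 - a) = pot s \<kappa> a"
proof -
  have "\<bar>1 - a - 1/2\<bar> = \<bar>a - 1/2\<bar>" by linarith
  then show ?thesis by (simp add: pot_def min.commute)
qed

lemma pot_nonneg: "s > 0 \<Longrightarrow> \<kappa> \<ge> 1 \<Longrightarrow> a \<in> {0..1} \<Longrightarrow> pot s \<kappa> a \<ge> 0"
  by (auto simp: pot_def intro!: divide_nonneg_nonneg simp: le_max_iff_disj)

lemma pot_le: 
  assumes s: "s \<ge> 1" and \<kappa>: "\<kappa> \<ge> 1" and a: "a \<in> {0..1}"
  shows "pot s \<kappa> a \<le> \<kappa>"
proof -
  have "min a (1 - a) / s \<le> \<kappa>"
  proof -
    have "min a (1 - a) / s \<le> 1 / 1" using s a by (intro frac_le) auto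
    then show ?thesis using \<kappa> by simp
  qed
  moreover have "\<kappa> / s \<le> \<kappa> / 1" using s \<kappa> by (intro divide_left_mono) auto
  moreover have "1 / max (s * \<bar>a - 1/2\<bar>) (1 / \<kappa>) \<le> 1 / (1 / \<kappa>)"
    using \<kappa> by (intro divide_left_mono mult_pos_pos) (auto simp: less_max_iff_disj)
  ultimately show ?thesis by (simp add: pot_def)
qed

text \<open>Applied with \<open>l\<close> = 1/(2n), a lower bound on the mass of a nonempty set:
  without consensus the potential is at least inverse polynomial in n, as Markov's inequality
  requires.\<close>

lemma pot_ge:
  assumes s: "s \<ge> 1" and \<kappa>: "\<kappa> \<ge> 1" and l: "l \<le> 1" "l \<le> a" "l \<le> 1 - a"
  shows "l / s \<le> pot s \<kappa> a"
proof -
  have "l / s \<le> min a (1 - a) / s" using s l by (intro divide_right_mono) auto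
  moreover have "l / s \<le> \<kappa> / s" using s \<kappa> l by (intro divide_right_mono) auto
  moreover have "l / s \<le> 1 / max (s * \<bar>a - 1/2\<bar>) (1 / \<kappa>)" if "\<bar>a - 1/2\<bar> < 1/8"
  proof -
    have "s * \<bar>a - 1/2\<bar> \<le> s * 1" using that s by (intro mult_left_mono) auto
    moreover have "1 / \<kappa> \<le> 1" using \<kappa> by simp
    ultimately have "max (s * \<bar>a - 1/2\<bar>) (1 / \<kappa>) \<le> s" using s by simp
    then have "1 / s \<le> 1 / max (s * \<bar>a - 1/2\<bar>) (1 / \<kappa>)"
      using s \<kappa> by (intro divide_left_mono mult_pos_pos) (auto simp: less_max_iff_disj)
    moreover have "l / s \<le> 1 / s" using s l by (intro divide_right_mono) auto
    ultimately show ?thesis by simp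
  qed
  ultimately show ?thesis by (auto simp: pot_def)
qed

text \<open>Chebyshev's inequality in pointwise form.\<close>

lemma le_add_sq_deviation:
  fixes x \<mu> d W w b :: real
  assumes d: "d > 0" and W: "w \<le> W" "0 \<le> W" and b: "0 \<le> b" and good: "\<bar>x - \<mu>\<bar> \<le> d \<Longrightarrow> w \<le> b"
  shows "w \<le> b + W / d\<^sup>2 * (x - \<mu>)\<^sup>2"
proof (cases "\<bar>x - \<mu>\<bar> \<le> d")
  case True
  then show ?thesis using good W by (simp add: add_increasing2)
next
  case False
  then have "d\<^sup>2 \<le> \<bar>x - \<mu>\<bar>\<^sup>2" using d by (intro power_mono) auto
  then have "W * 1 \<le> W * ((x - \<mu>)\<^sup>2 / d\<^sup>2)" using d W by (intro mult_left_mono) auto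
  then show ?thesis using W b by simp
qed

text \<open>\<open>spread\<close> bounds the stationary variance of the neighbourhood fractions,
  whose natural order is 1/(n p). \<open>small\<close> says that few vertices see much of a clear
  minority. \<open>kappa_Q\<close> lets the amplified bias beat the error of the mean, and
  \<open>kappa_n\<close> makes the Chebyshev terms of lower order.\<close>

locale good_graph = no_isolated V E for V :: "'a set" and E +
  fixes k :: nat and n Q \<kappa> :: real
  assumes n_pos: "n \<ge> 1" and kappa_pow: "\<kappa> ^ 4 = real k" and kappa_ge: "\<kappa> \<ge> 4"
    and kappa_Q: "32 * Q \<le> \<kappa>" and Q_nonneg: "Q \<ge> 0" and kappa_n: "2048 * \<kappa> \<le> sqrt n"
    and wt_le: "v \<in> V \<Longrightarrow> wt v \<le> 2 / n" and wt_ge: "v \<in> V \<Longrightarrow> 1 / (2 * n) \<le> wt v"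
    and spread: "A \<subseteq> V \<Longrightarrow> (\<Sum>v\<in>V. wt v * (nfrac A v - mass A)\<^sup>2) \<le> Q / (real k * sqrt n)"
    and small: "B \<subseteq> V \<Longrightarrow> mass B \<le> 3/8 \<Longrightarrow> mass {v\<in>V. nfrac B v > 7/16} \<le> 4 * mass B / real k"
begin

text \<open>The hypotheses give 256; the value 204 = 3 * 68 is what brings the bound of
  \<open>drift_small\<close> from mass 3/8 down to 1/8.\<close>

lemma k_ge: "k \<ge> 204"
proof -
  have "(4::real) ^ 4 \<le> \<kappa> ^ 4" using kappa_ge by (intro power_mono) auto
  then show ?thesis using kappa_pow by simp
qed

lemma sqrt_k: "sqrt (real k) = \<kappa>\<^sup>2"
proof -
  have "real k = (\<kappa>\<^sup>2)\<^sup>2" using kappa_pow by simp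
  then show ?thesis by (simp only: real_sqrt_abs abs_power2)
qed

lemma sqrt_n_ge: "sqrt n \<ge> 8192"
  using kappa_n kappa_ge by linarith

lemma sqrt_n_sq: "sqrt n * sqrt n = n" "sqrt n ^ 2 = n"
  using n_pos by (simp_all add: power2_eq_square)

abbreviation "P \<equiv> pot (sqrt n) \<kappa>"

lemma drift_error:
  assumes A: "A \<subseteq> V"
  shows "\<bar>drift k A - maj k (mass A)\<bar> \<le> 8 * Q / sqrt n"
proof -
  have "drift k A - maj k (mass A) = (\<Sum>v\<in>V. wt v * (maj k (nfrac A v) - maj k (mass A)))"
    by (simp add: drift_def right_diff_distrib sum_subtractf sum_distrib_right[symmetric] sum_wt)
  also have "\<dots> = (\<Sum>v\<in>V. wt v * (maj k (nfrac A v) - maj k (mass A) - maj' k (mass A) * (nfrac A v - mass A)))"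
  proof -
    have "(\<Sum>v\<in>V. wt v * (maj' k (mass A) * (nfrac A v - mass A)))
      = maj' k (mass A) * ((\<Sum>v\<in>V. wt v * nfrac A v) - (\<Sum>v\<in>V. wt v) * mass A)"
      by (simp add: right_diff_distrib sum_subtractf sum_distrib_left sum_distrib_right mult_ac)
    then have "(\<Sum>v\<in>V. wt v * (maj' k (mass A) * (nfrac A v - mass A))) = 0"
      by (simp add: sum_wt sum_wt_nfrac)
    then show ?thesis by (simp only: right_diff_distrib[of "wt _" "_ - _"] sum_subtractf diff_zero)
  qed
  finally have eq: "drift k A - maj k (mass A)
     = (\<Sum>v\<in>V. wt v * (maj k (nfrac A v) - maj k (mass A) - maj' k (mass A) * (nfrac A v - mass A)))" .
  have "\<bar>drift k A - maj k (mass A)\<bar>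
     \<le> (\<Sum>v\<in>V. \<bar>wt v * (maj k (nfrac A v) - maj k (mass A) - maj' k (mass A) * (nfrac A v - mass A))\<bar>)"
    unfolding eq by (rule sum_abs)
  also have "\<dots> \<le> (\<Sum>v\<in>V. wt v * (8 * real k * (nfrac A v - mass A)\<^sup>2))"
  proof (rule sum_mono)
    fix v assume v: "v \<in> V"
    have "\<bar>maj k (nfrac A v) - maj k (mass A) - maj' k (mass A) * (nfrac A v - mass A)\<bar>
      \<le> 8 * real k * (nfrac A v - mass A)\<^sup>2"
      using k_ge by (intro maj_Taylor nfrac_mem_unit[OF v] mass_mem_unit) auto
    then show "\<bar>wt v * (maj k (nfrac A v) - maj k (mass A) - maj' k (mass A) * (nfrac A v - mass A))\<bar>
      \<le> wt v * (8 * real k * (nfrac A v - mass A)\<^sup>2)"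
      using wt_pos[OF v] unfolding abs_mult by (intro mult_mono) auto
  qed
  also have "\<dots> = 8 * real k * (\<Sum>v\<in>V. wt v * (nfrac A v - mass A)\<^sup>2)"
    by (simp add: sum_distrib_left mult_ac)
  also have "\<dots> \<le> 8 * real k * (Q / (real k * sqrt n))"
    by (intro mult_left_mono spread A) auto
  also have "\<dots> = 8 * Q / sqrt n" using k_ge by simp
  finally show ?thesis .
qed

lemma variance_le: "measure_pmf.expectation (step k A) (\<lambda>S. (mass S - drift k A)\<^sup>2) \<le> 2 / n * drift k A"
  by (rule variance_mass_le) (rule wt_le)

text \<open>Common frame of three regimes: \<open>le_add_sq_deviation\<close> supplies the pointwise
  bound, whose expectation involves only mean and variance of the mass.\<close>

lemma expectation_pot_le:
  assumes c: "c \<ge> 0" and le: "\<And>S. S \<subseteq> V \<Longrightarrow> P (mass S) \<le> b + e * mass S + c * (mass S - drift k A)\<^sup>2"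
  shows "measure_pmf.expectation (step k A) (\<lambda>S. P (mass S)) \<le> b + e * drift k A + c * (2 / n * drift k A)"
proof -
  have "measure_pmf.expectation (step k A) (\<lambda>S. P (mass S))
    \<le> measure_pmf.expectation (step k A) (\<lambda>S. b + e * mass S + c * (mass S - drift k A)\<^sup>2)"
    using finite_V le set_step by (intro integral_mono_AE) (auto intro!: AE_pmfI)
  also have "\<dots> = b + e * drift k A + c * measure_pmf.expectation (step k A) (\<lambda>S. (mass S - drift k A)\<^sup>2)"
    using finite_V by (simp add: expectation_mass)
  also have "\<dots> \<le> b + e * drift k A + c * (2 / n * drift k A)"
    by (intro add_left_mono mult_left_mono variance_le c)
  finally show ?thesis .
qed

lemma pot_P_le: "P (mass S) \<le> \<kappa>"
  using pot_le[of "sqrt n" \<kappa> "mass S"] sqrt_n_ge kappa_ge n_pos mass_mem_unit by simp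

text \<open>Vertices with more than 7/16 of their neighbours in \<open>A\<close> are assumed to
  adopt opinion 0; by \<open>small\<close> they contribute 4/k times the mass. For all others the
  majority rule multiplies the fraction by at most 64/k, and 68 = 64 + 4.\<close>

lemma drift_small:
  assumes A: "A \<subseteq> V" and a: "mass A \<le> 3/8"
  shows "drift k A \<le> 68 / real k * mass A"
proof -
  let ?H = "{v\<in>V. nfrac A v > 7/16}"
  have "wt v * maj k (nfrac A v) \<le> wt v * of_bool (v \<in> ?H) + 64 / real k * (wt v * nfrac A v)" if v: "v \<in> V" for v
  proof (cases "nfrac A v > 7/16")
    case True
    have "wt v * maj k (nfrac A v) \<le> wt v * 1"
      using maj_nfrac[OF v, of k A] wt_pos[OF v] by (intro mult_left_mono) auto
    moreover have "0 \<le> 64 / real k * (wt v * nfrac A v)"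
      using wt_pos[OF v] nfrac_mem_unit[OF v, of A] by (intro mult_nonneg_nonneg) auto
    ultimately show ?thesis using True v by simp
  next
    case False
    let ?b = "nfrac A v"
    have b: "0 \<le> ?b" "?b \<le> 7/16" using False nfrac_mem_unit[OF v, of A] by auto
    have "4 * ?b * (1 - ?b) \<le> 63/64"
    proof -
      have "0 \<le> (7/16 - ?b) * (9/16 - ?b)" using b by (intro mult_nonneg_nonneg) auto
      then show ?thesis by (simp add: algebra_simps)
    qed
    then have "(4 * ?b * (1 - ?b)) ^ k \<le> (63/64) ^ k" using b by (intro power_mono) auto
    also have "\<dots> \<le> 64 / real k" using k_ge by (intro power_63_64_le) auto
    finally have "?b * (4 * ?b * (1 - ?b)) ^ k \<le> ?b * (64 / real k)" using b by (intro mult_left_mono)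
    moreover have "maj k ?b \<le> ?b * (4 * ?b * (1 - ?b)) ^ k" using b by (intro maj_le_of_le_half) auto
    ultimately have "wt v * maj k ?b \<le> wt v * (?b * (64 / real k))"
      using wt_pos[OF v] by (intro mult_left_mono) auto
    then show ?thesis using wt_pos[OF v] by (simp add: mult_ac add_increasing)
  qed
  then have "drift k A \<le> mass ?H + 64 / real k * (\<Sum>v\<in>V. wt v * nfrac A v)"
    unfolding drift_def mass_def[of ?H] sum_distrib_left sum.distrib[symmetric] by (intro sum_mono) auto
  also have "\<dots> \<le> 4 * mass A / real k + 64 / real k * mass A"
    using small[OF A a] by (simp add: sum_wt_nfrac)
  finally show ?thesis by (simp add: field_simps)
qed

lemma contract_small:
  assumes A: "A \<subseteq> V" and a: "mass A \<le> 3/8"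
  shows "measure_pmf.expectation (step k A) (\<lambda>S. P (mass S)) \<le> 136 / \<kappa> * P (mass A)"
proof -
  have Pa: "P (mass A) = mass A / sqrt n" using a by (simp add: pot_def)
  have ma: "0 \<le> mass A" by (rule mass_nonneg)
  have "68 / real k * mass A \<le> 68 / 204 * (3/8)" using k_ge a ma by (intro mult_mono frac_le) auto
  then have d: "drift k A \<le> 1/8" using drift_small[OF A a] by linarith
  have "measure_pmf.expectation (step k A) (\<lambda>S. P (mass S))
    \<le> 0 + 1 / sqrt n * drift k A + (16 * \<kappa>) * (2 / n * drift k A)"
  proof (rule expectation_pot_le)
    fix S assume "S \<subseteq> V"
    \<comment> \<open>A mean of at most 1/8 and a deviation of at most 1/4 leave the mass at most
      3/8, where the potential is linear. Larger deviations are charged the maximal potential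
      \<kappa>.\<close>
    have "P (mass S) \<le> mass S / sqrt n + \<kappa> / (1/4)\<^sup>2 * (mass S - drift k A)\<^sup>2"
    proof (rule le_add_sq_deviation)
      assume "\<bar>mass S - drift k A\<bar> \<le> 1/4"
      then have "mass S \<le> 3/8" using d by linarith
      then show "P (mass S) \<le> mass S / sqrt n" by (simp add: pot_def)
    qed (use pot_P_le kappa_ge mass_nonneg n_pos in auto)
    then show "P (mass S) \<le> 0 + 1 / sqrt n * mass S + (16 * \<kappa>) * (mass S - drift k A)\<^sup>2"
      by (simp add: power2_eq_square)
  qed (use kappa_ge in auto)
  \<comment> \<open>The Chebyshev term is also proportional to the mean, but with the additional
    factor \<kappa>/sqrt n; \<open>kappa_n\<close> absorbs it.\<close>
  also have "\<dots> = (1 + 32 * \<kappa> / sqrt n) * (drift k A / sqrt n)"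
  proof -
    have "2 / (N * N) * D = 2 / N * (D / N)" for N D :: real by simp
    from this[of "sqrt n" "drift k A"] have "2 / n * drift k A = 2 / sqrt n * (drift k A / sqrt n)"
      by (simp only: sqrt_n_sq)
    then show ?thesis by (simp add: algebra_simps)
  qed
  also have "\<dots> \<le> 2 * (drift k A / sqrt n)"
    using kappa_n sqrt_n_ge drift_nonneg n_pos kappa_ge by (intro mult_right_mono) (auto simp: divide_le_eq)
  also have "\<dots> \<le> 2 * (68 / real k * mass A / sqrt n)"
    using drift_small[OF A a] n_pos by (intro mult_left_mono divide_right_mono) auto
  also have "\<dots> = 136 / real k * P (mass A)" by (simp add: Pa)
  also have "\<dots> \<le> 136 / \<kappa> * P (mass A)"
  proof -
    have "\<kappa> ^ 1 \<le> \<kappa> ^ 4" using kappa_ge by (intro power_increasing) auto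
    then have "\<kappa> \<le> real k" using kappa_pow by simp
    then show ?thesis using kappa_ge ma n_pos unfolding Pa
      by (intro mult_right_mono divide_left_mono) auto
  qed
  finally show ?thesis .
qed

text \<open>The bias 1/(4 \<open>\<kappa>\<^sup>2\<close>) is the end of the range of
  \<open>maj_drift\<close>; there the amplification already sends the mass to 5/16. With 1/32
  conceded to the error of the mean and 1/32 to the noise it stays below 3/8, so the potential falls
  from \<kappa>/sqrt n to at most 1/sqrt n in a single round.\<close>

lemma contract_middle:
  assumes A: "A \<subseteq> V" and a: "3/8 < mass A" "mass A \<le> 1/2 - 1 / (4 * \<kappa>\<^sup>2)"
  shows "measure_pmf.expectation (step k A) (\<lambda>S. P (mass S)) \<le> 2 / \<kappa> * P (mass A)"
proof -
  let ?x = "1 / (4 * \<kappa>\<^sup>2)"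
  have "?x > 0" using kappa_ge by simp
  then have "\<bar>mass A - 1/2\<bar> = 1/2 - mass A" using a by linarith
  then have Pa: "P (mass A) = \<kappa> / sqrt n" using a by (simp add: pot_def)
  have "maj k (mass A) \<le> maj k (1/2 - ?x)" 
  proof (rule maj_mono)
    show "1/2 - ?x \<le> 1" using \<open>?x > 0\<close> by linarith
  qed (use a mass_nonneg in auto)
  also have "\<dots> \<le> 1/2 - 3/4 * sqrt (real k) * ?x"
    using k_ge kappa_ge by (intro maj_drift) (auto simp: sqrt_k)
  also have "\<dots> = 5/16" using kappa_ge by (simp add: sqrt_k)
  finally have "maj k (mass A) \<le> 5/16" .
  moreover have "8 * Q / sqrt n \<le> 1/32"
  proof -
    have "256 * Q \<le> sqrt n" using kappa_Q kappa_n kappa_ge by linarith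
    then show ?thesis using n_pos by (simp add: divide_le_eq)
  qed
  ultimately have d: "drift k A \<le> 3/8 - 1/32" using drift_error[OF A] by linarith
  have "measure_pmf.expectation (step k A) (\<lambda>S. P (mass S))
    \<le> 1 / sqrt n + 0 * drift k A + (1024 * \<kappa>) * (2 / n * drift k A)"
  proof (rule expectation_pot_le)
    fix S assume "S \<subseteq> V"
    have "P (mass S) \<le> 1 / sqrt n + \<kappa> / (1/32)\<^sup>2 * (mass S - drift k A)\<^sup>2"
    proof (rule le_add_sq_deviation)
      assume "\<bar>mass S - drift k A\<bar> \<le> 1/32"
      then have "mass S \<le> 3/8" using d by linarith
      then show "P (mass S) \<le> 1 / sqrt n" using n_pos by (auto simp: pot_def intro!: divide_right_mono)
    qed (use pot_P_le kappa_ge n_pos in auto)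
    then show "P (mass S) \<le> 1 / sqrt n + 0 * mass S + (1024 * \<kappa>) * (mass S - drift k A)\<^sup>2"
      by (simp add: power2_eq_square)
  qed (use kappa_ge in auto)
  also have "\<dots> \<le> 1 / sqrt n + (1024 * \<kappa>) * (2 / n * 1)"
    using drift_le_1 kappa_ge n_pos by (intro add_mono mult_left_mono) auto
  also have "\<dots> = 1 / sqrt n + (2048 * \<kappa> / sqrt n) * (1 / sqrt n)"
    using sqrt_n_sq by simp
  also have "\<dots> \<le> 1 / sqrt n + 1 * (1 / sqrt n)"
    using kappa_n sqrt_n_ge n_pos by (intro add_left_mono mult_right_mono) (auto simp: divide_le_eq)
  also have "\<dots> = 2 / \<kappa> * P (mass A)" using kappa_ge by (simp add: Pa)
  finally show ?thesis .
qed

text \<open>Of the amplified bias 3/4 \<open>\<kappa>\<^sup>2 * x\<close>, one quarter of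
  \<open>\<kappa>\<^sup>2 * x\<close> is conceded to the error of the mean and one to the noise; one
  quarter is left. Larger noise is charged the maximal potential \<kappa> and accounts for 32 of the
  36.\<close>

lemma contract_drift:
  assumes A: "A \<subseteq> V" and x: "x = 1/2 - mass A" "1 / (\<kappa> * sqrt n) \<le> x" "x < 1 / (4 * \<kappa>\<^sup>2)"
  shows "measure_pmf.expectation (step k A) (\<lambda>S. P (mass S)) \<le> 36 / \<kappa> * P (mass A)"
proof -
  have s: "sqrt n > 0" using n_pos by simp
  have xpos: "x > 0" using x(2) kappa_ge s by (smt (verit) divide_pos_pos mult_pos_pos)
  have "1 \<le> 4 * \<kappa>\<^sup>2" "4 * \<kappa>\<^sup>2 \<ge> 64" using kappa_ge power_mono[of 4 \<kappa> 2] by auto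
  then have "1 / (4 * \<kappa>\<^sup>2) \<le> 1 / 64" by (intro divide_left_mono) auto
  then have x8: "x < 1/8" using x(3) by linarith
  have ax: "\<bar>mass A - 1/2\<bar> = x" using x(1) xpos by linarith
  have sx: "1 / \<kappa> \<le> sqrt n * x" using x(2) kappa_ge s by (simp add: field_simps)
  have Pa: "P (mass A) = 1 / (sqrt n * x)" using x8 x(3) sx by (simp add: pot_def ax)
  have "maj k (mass A) \<le> 1/2 - 3/4 * sqrt (real k) * x"
    using maj_drift[of k x] k_ge xpos x(1,3) by (simp add: sqrt_k)
  \<comment> \<open>The lower bound on \<open>x\<close> gives an amplified bias of at least
    \<kappa>/sqrt n, and \<kappa> exceeds 32 Q.\<close>
  moreover have "8 * Q / sqrt n \<le> \<kappa>\<^sup>2 * x / 4"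
  proof -
    have "8 * Q \<le> \<kappa> / 4" using kappa_Q by simp
    also have "\<dots> = \<kappa>\<^sup>2 * (1 / \<kappa>) / 4" using kappa_ge by (simp add: power2_eq_square)
    also have "\<dots> \<le> \<kappa>\<^sup>2 * (sqrt n * x) / 4" using sx by (intro divide_right_mono mult_left_mono) auto
    finally show ?thesis using s by (simp add: divide_le_eq mult_ac)
  qed
  ultimately have d: "drift k A \<le> 1/2 - \<kappa>\<^sup>2 * x / 2" using drift_error[OF A] by (simp add: sqrt_k)
  have pos: "\<kappa>\<^sup>2 * x > 0" using kappa_ge xpos by simp
  \<comment> \<open>The next mass may fall in the middle range, where the potential is constant;
    this too is a gain, by a factor 4\<kappa>.\<close>
  have big: "4 * \<kappa> * (\<kappa> / sqrt n) \<le> P (mass A)"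
  proof -
    have "4 * \<kappa>\<^sup>2 * x \<le> 1" using x(3) kappa_ge by (simp add: field_simps)
    then show ?thesis using s xpos unfolding Pa by (simp add: field_simps power2_eq_square)
  qed
  have "measure_pmf.expectation (step k A) (\<lambda>S. P (mass S))
    \<le> 4 / \<kappa> * P (mass A) + 0 * drift k A + (\<kappa> / (\<kappa>\<^sup>2 * x / 4)\<^sup>2) * (2 / n * drift k A)"
  proof (rule expectation_pot_le)
    fix S assume "S \<subseteq> V"
    have "P (mass S) \<le> 4 / \<kappa> * P (mass A) + \<kappa> / (\<kappa>\<^sup>2 * x / 4)\<^sup>2 * (mass S - drift k A)\<^sup>2"
    proof (rule le_add_sq_deviation)
      assume "\<bar>mass S - drift k A\<bar> \<le> \<kappa>\<^sup>2 * x / 4"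
      then have "mass S \<le> 1/2 - \<kappa>\<^sup>2 * x / 4" using d by linarith
      then have dev: "\<kappa>\<^sup>2 * x / 4 \<le> \<bar>mass S - 1/2\<bar>" using pos by linarith
      have "1 / max (sqrt n * \<bar>mass S - 1/2\<bar>) (1 / \<kappa>) \<le> 1 / (sqrt n * (\<kappa>\<^sup>2 * x / 4))"
        using dev s pos kappa_ge by (intro divide_left_mono mult_pos_pos) (auto simp: le_max_iff_disj less_max_iff_disj intro!: mult_left_mono)
      also have "\<dots> = 4 / \<kappa> * P (mass A) / \<kappa>" unfolding Pa by (simp add: power2_eq_square)
      also have "\<dots> \<le> 4 / \<kappa> * P (mass A) / 1"
        using kappa_ge s xpos unfolding Pa by (intro divide_left_mono) auto
      finally have 1: "1 / max (sqrt n * \<bar>mass S - 1/2\<bar>) (1 / \<kappa>) \<le> 4 / \<kappa> * P (mass A)" by simp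
      have "\<kappa> / sqrt n = 1 / (4 * \<kappa>) * (4 * \<kappa> * (\<kappa> / sqrt n))" using kappa_ge by simp
      also have "\<dots> \<le> 1 / (4 * \<kappa>) * P (mass A)" using big kappa_ge by (intro mult_left_mono) auto
      also have "\<dots> \<le> 4 / \<kappa> * P (mass A)"
        using kappa_ge s xpos unfolding Pa by (intro mult_right_mono) (auto simp: field_simps)
      finally have 2: "\<kappa> / sqrt n \<le> 4 / \<kappa> * P (mass A)" .
      have "min (mass S) (1 - mass S) / sqrt n \<le> \<kappa> / sqrt n"
        using kappa_ge s mass_mem_unit[of S] by (intro divide_right_mono) auto
      then show "P (mass S) \<le> 4 / \<kappa> * P (mass A)" using 1 2 by (auto simp: pot_def)
    qed (use pot_P_le kappa_ge pos s xpos in \<open>auto simp: Pa\<close>)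
    then show "P (mass S) \<le> 4 / \<kappa> * P (mass A) + 0 * mass S + \<kappa> / (\<kappa>\<^sup>2 * x / 4)\<^sup>2 * (mass S - drift k A)\<^sup>2"
      by simp
  qed (use kappa_ge in auto)
  also have "\<dots> \<le> 4 / \<kappa> * P (mass A) + (\<kappa> / (\<kappa>\<^sup>2 * x / 4)\<^sup>2) * (2 / n * 1)"
  proof -
    have "(\<kappa> / (\<kappa>\<^sup>2 * x / 4)\<^sup>2) * (2 / n * drift k A) \<le> (\<kappa> / (\<kappa>\<^sup>2 * x / 4)\<^sup>2) * (2 / n * 1)"
      using drift_le_1 kappa_ge n_pos by (intro mult_left_mono) auto
    then show ?thesis by simp
  qed
  \<comment> \<open>The Chebyshev term is quadratic in the potential, as both it and
    \<open>P (mass A)\<close> involve only the product of sqrt n and \<open>x\<close>. One factor is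
    then bounded by \<kappa>.\<close>
  also have "(\<kappa> / (\<kappa>\<^sup>2 * x / 4)\<^sup>2) * (2 / n * 1) = 32 / \<kappa> ^ 3 * (P (mass A))\<^sup>2"
  proof -
    have "\<kappa> / (\<kappa>\<^sup>2 * x / 4)\<^sup>2 * (2 / N\<^sup>2 * 1) = 32 / \<kappa> ^ 3 * (1 / (N * x))\<^sup>2" if "N > 0" for N
      using that kappa_ge xpos by (simp add: field_simps power2_eq_square power3_eq_cube)
    from this[OF s] show ?thesis unfolding Pa by (simp add: sqrt_n_sq)
  qed
  also have "\<dots> \<le> 32 / \<kappa> * P (mass A)"
  proof -
    have P0: "0 \<le> P (mass A)" using s xpos by (simp add: Pa)
    have "(P (mass A))\<^sup>2 \<le> \<kappa> * P (mass A)"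
      unfolding power2_eq_square using P0 pot_P_le by (intro mult_right_mono) auto
    also have "\<dots> \<le> \<kappa>\<^sup>2 * P (mass A)" using P0 kappa_ge by (intro mult_right_mono) (auto simp: power2_eq_square)
    finally have "32 / \<kappa> ^ 3 * (P (mass A))\<^sup>2 \<le> 32 / \<kappa> ^ 3 * (\<kappa>\<^sup>2 * P (mass A))"
      using kappa_ge by (intro mult_left_mono) auto
    then show ?thesis using kappa_ge by (simp add: power3_eq_cube power2_eq_square)
  qed
  finally show ?thesis by (simp add: algebra_simps)
qed

text \<open>Near a tie most vertices toss an almost fair coin: by the Lipschitz bound, q deviates
  from 1/2 by O(sqrt k) times the deviation of the neighbourhood fraction, whose mean square is
  controlled by \<open>spread\<close>. This leaves at least 1/4 - 1/8 of weighted variance, and a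
  second weight of at least 1/(2n).\<close>

lemma variance_lower:
  assumes A: "A \<subseteq> V" and x: "\<bar>mass A - 1/2\<bar> < 1 / (\<kappa> * sqrt n)"
  shows "1 / (16 * n) \<le> (\<Sum>v\<in>V. (wt v)\<^sup>2 * (maj k (nfrac A v) * (1 - maj k (nfrac A v))))"
proof -
  let ?q = "\<lambda>v. maj k (nfrac A v)"
  have s: "sqrt n > 0" using n_pos by simp
  have "(\<Sum>v\<in>V. wt v * (?q v - 1/2)\<^sup>2) \<le> (\<Sum>v\<in>V. wt v * (4 * real k * (nfrac A v - 1/2)\<^sup>2))"
  proof (intro sum_mono mult_left_mono)
    fix v assume v: "v \<in> V"
    have "\<bar>?q v - 1/2\<bar> \<le> 2 * sqrt (real k) * \<bar>nfrac A v - 1/2\<bar>"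
      using maj_Lipschitz[of k "nfrac A v" "1/2"] k_ge nfrac_mem_unit[OF v, of A] by (simp add: maj_half)
    then have "\<bar>?q v - 1/2\<bar>\<^sup>2 \<le> (2 * sqrt (real k) * \<bar>nfrac A v - 1/2\<bar>)\<^sup>2" by (intro power_mono) auto
    then show "(?q v - 1/2)\<^sup>2 \<le> 4 * real k * (nfrac A v - 1/2)\<^sup>2" by (simp add: power_mult_distrib)
  qed (use wt_pos in \<open>auto simp: less_imp_le\<close>)
  also have "\<dots> = 4 * real k * (\<Sum>v\<in>V. wt v * (nfrac A v - 1/2)\<^sup>2)"
    by (simp add: sum_distrib_left mult_ac)
  \<comment> \<open>Second moment about 1/2 = variance + squared bias, since \<open>mass A\<close>
    is the weighted mean of the fractions.\<close>
  also have "(\<Sum>v\<in>V. wt v * (nfrac A v - 1/2)\<^sup>2) = (\<Sum>v\<in>V. wt v * (nfrac A v - mass A)\<^sup>2) + (mass A - 1/2)\<^sup>2"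
  proof -
    have "wt v * (nfrac A v - 1/2)\<^sup>2 = wt v * (nfrac A v - mass A)\<^sup>2
       + (2 * (mass A - 1/2) * (wt v * nfrac A v) - 2 * (mass A - 1/2) * mass A * wt v) + (mass A - 1/2)\<^sup>2 * wt v" for v
      by (simp add: power2_eq_square algebra_simps)
    then have "(\<Sum>v\<in>V. wt v * (nfrac A v - 1/2)\<^sup>2) = (\<Sum>v\<in>V. wt v * (nfrac A v - mass A)\<^sup>2)
      + (2 * (mass A - 1/2) * (\<Sum>v\<in>V. wt v * nfrac A v) - 2 * (mass A - 1/2) * mass A * (\<Sum>v\<in>V. wt v))
      + (mass A - 1/2)\<^sup>2 * (\<Sum>v\<in>V. wt v)"
      by (simp add: sum.distrib sum_subtractf sum_distrib_left)
    then show ?thesis by (simp add: sum_wt sum_wt_nfrac)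
  qed
  also have "4 * real k * \<dots> \<le> 4 * real k * (Q / (real k * sqrt n) + (1 / (\<kappa> * sqrt n))\<^sup>2)"
  proof -
    have "(mass A - 1/2)\<^sup>2 \<le> (1 / (\<kappa> * sqrt n))\<^sup>2"
      using x power_mono[of "\<bar>mass A - 1/2\<bar>" "1 / (\<kappa> * sqrt n)" 2] by simp
    then show ?thesis by (intro mult_left_mono add_mono spread A) auto
  qed
  also have "\<dots> = 4 * Q / sqrt n + 4 * (\<kappa> / sqrt n)\<^sup>2"
    using k_ge kappa_ge s unfolding kappa_pow[symmetric]
    by (simp add: field_simps power2_eq_square power4_eq_xxxx)
  also have "\<dots> \<le> 1/16 + 4 * (1/8)\<^sup>2"
  proof -
    have "64 * Q \<le> sqrt n" using kappa_Q kappa_n kappa_ge by linarith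
    then have "4 * Q / sqrt n \<le> 1/16" using s by (simp add: divide_le_eq)
    moreover have "\<kappa> / sqrt n \<le> 1/8" using kappa_n kappa_ge s by (simp add: divide_le_eq)
    then have "(\<kappa> / sqrt n)\<^sup>2 \<le> (1/8)\<^sup>2" using kappa_ge s by (intro power_mono) auto
    ultimately show ?thesis by simp
  qed
  finally have dev: "(\<Sum>v\<in>V. wt v * (?q v - 1/2)\<^sup>2) \<le> 1/8" by (simp add: power2_eq_square)
  have "wt v * (?q v * (1 - ?q v)) = 1/4 * wt v - wt v * (?q v - 1/2)\<^sup>2" for v
    by (simp add: power2_eq_square algebra_simps)
  then have "(\<Sum>v\<in>V. wt v * (?q v * (1 - ?q v))) = 1/4 * (\<Sum>v\<in>V. wt v) - (\<Sum>v\<in>V. wt v * (?q v - 1/2)\<^sup>2)"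
    by (simp add: sum_subtractf sum_distrib_left)
  then have "1/8 \<le> (\<Sum>v\<in>V. wt v * (?q v * (1 - ?q v)))" using dev by (simp add: sum_wt)
  then have "1 / (2 * n) * (1/8) \<le> 1 / (2 * n) * (\<Sum>v\<in>V. wt v * (?q v * (1 - ?q v)))"
    using n_pos by (intro mult_left_mono) auto
  also have "\<dots> \<le> (\<Sum>v\<in>V. (wt v)\<^sup>2 * (?q v * (1 - ?q v)))"
    unfolding sum_distrib_left power2_eq_square mult.assoc
    using wt_ge wt_pos maj_nfrac[of _ k A] by (intro sum_mono mult_right_mono) (auto simp: less_imp_le)
  finally show ?thesis by simp
qed

text \<open>Potential \<kappa> before the round. Afterwards it is still at most \<kappa> inside a
  small window around 1/2, which has probability at most 520/\<delta>. Outside it is at most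
  \<open>\<delta>\<^sup>2\<close> + \<kappa>/sqrt n, and each of these two terms is at most
  \<kappa>/\<delta>, whence 522.\<close>

lemma contract_balanced:
  assumes A: "A \<subseteq> V" and x: "\<bar>mass A - 1/2\<bar> < 1 / (\<kappa> * sqrt n)" and \<delta>: "\<delta> ^ 4 = \<kappa>" "\<delta> \<ge> 1"
  shows "measure_pmf.expectation (step k A) (\<lambda>S. P (mass S)) \<le> 522 / \<delta> * P (mass A)"
proof -
  have s: "sqrt n > 0" using n_pos by simp
  \<comment> \<open>The Fejer kernel needs an integer number of terms; this one lies between
    \<delta>/2 and \<delta>.\<close>
  define M where "M = nat \<lfloor>\<delta>\<rfloor>"
  have M1: "M \<ge> 1" using \<delta> by (simp add: M_def le_nat_iff)
  have "real M = of_int \<lfloor>\<delta>\<rfloor>" using \<delta> by (simp add: M_def)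
  moreover have "(1::real) \<le> of_int \<lfloor>\<delta>\<rfloor>" using \<delta> by simp
  ultimately have M: "real M \<le> \<delta>" "\<delta> / 2 \<le> real M"
    using floor_correct[of \<delta>] by linarith+
  have M2: "(real M)\<^sup>2 \<le> \<delta>\<^sup>2" using M by (intro power_mono) auto
  have d4: "\<kappa> = \<delta>\<^sup>2 * \<delta>\<^sup>2" using \<delta>(1) by (simp add: power2_eq_square power4_eq_xxxx)
  have d2: "1 \<le> \<delta>\<^sup>2" "\<delta> \<le> \<delta>\<^sup>2" 
    using \<delta>(2) one_le_power[of \<delta> 2] mult_left_mono[of 1 \<delta> \<delta>] by (auto simp: power2_eq_square)
  have d2k: "\<delta>\<^sup>2 \<le> \<kappa>" using mult_left_mono[OF d2(1), of "\<delta>\<^sup>2"] unfolding d4 by simp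
  \<comment> \<open>With standard deviation of order 1/sqrt n, this frequency makes the
    characteristic function at most exp(-M^2/64), while the window still has half-width 1/(M^2 sqrt
    n).\<close>
  define t where "t = real M * sqrt n"
  define B where "B = {S. \<bar>mass S - 1/2\<bar> \<le> 1 / (real M * t)}"
  have Pa: "P (mass A) = \<kappa>"
  proof -
    have "16 \<le> \<kappa>\<^sup>2" using kappa_ge power_mono[of 4 \<kappa> 2] by auto
    have "1 / (\<kappa> * sqrt n) \<le> 1 / (\<kappa> * (2048 * \<kappa>))" using kappa_ge kappa_n s by (intro divide_left_mono mult_left_mono) auto
    also have "\<dots> \<le> 1 / (4 * \<kappa>\<^sup>2)" using kappa_ge by (intro divide_left_mono) (auto simp: power2_eq_square)
    finally have small: "\<bar>mass A - 1/2\<bar> < 1 / (4 * \<kappa>\<^sup>2)" using x by linarith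
    moreover have "1 / (4 * \<kappa>\<^sup>2) \<le> 1 / 64" using \<open>16 \<le> \<kappa>\<^sup>2\<close> by (intro divide_left_mono) auto
    then have "\<not> 1/8 \<le> \<bar>mass A - 1/2\<bar>" using small by linarith
    moreover have "sqrt n * \<bar>mass A - 1/2\<bar> \<le> 1 / \<kappa>" using x kappa_ge s by (simp add: field_simps)
    ultimately show ?thesis using kappa_ge by (simp add: pot_def max_absorb2)
  qed
  have "measure_pmf.prob (step k A) {S. \<bar>(\<Sum>v\<in>V. wt v * of_bool (v \<in> S)) - 1/2\<bar> \<le> 1 / (real M * t)}
    \<le> 4 / real M + 4 * exp (- (t\<^sup>2 * (\<Sum>v\<in>V. (wt v)\<^sup>2 * (maj k (nfrac A v) * (1 - maj k (nfrac A v)))) / 4))"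
  proof (rule anticoncentration_rand_subset[OF finite_V maj_nfrac M1])
    show "t > 0" using s M1 by (simp add: t_def)
    fix v assume v: "v \<in> V"
    have "real M * t * \<bar>wt v\<bar> \<le> real M * t * (2 / n)"
      using wt_le[OF v] wt_pos[OF v] s by (intro mult_left_mono) (auto simp: t_def)
    also have "\<dots> = 2 * (real M)\<^sup>2 / sqrt n"
    proof -
      have "real M * (real M * N) * (2 / (N * N)) = 2 * (real M)\<^sup>2 / N" if "N > 0" for N
        using that by (simp add: power2_eq_square)
      from this[OF s] show ?thesis unfolding t_def sqrt_n_sq by simp
    qed
    also have "\<dots> \<le> 2 * \<kappa> / sqrt n" using M2 d2k s by (intro divide_right_mono) auto
    also have "\<dots> \<le> 1" using kappa_n kappa_ge s by (simp add: divide_le_eq)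
    finally show "real M * t * \<bar>wt v\<bar> \<le> 1" .
  qed
  also have "\<dots> \<le> 4 / real M + 4 * (64 / real M)"
  proof -
    let ?\<sigma> = "\<Sum>v\<in>V. (wt v)\<^sup>2 * (maj k (nfrac A v) * (1 - maj k (nfrac A v)))"
    have "t\<^sup>2 = (real M)\<^sup>2 * n" using n_pos by (simp add: t_def power_mult_distrib)
    have "(real M)\<^sup>2 / 64 = t\<^sup>2 * (1 / (16 * n)) / 4" unfolding \<open>t\<^sup>2 = _\<close> using n_pos by simp
    also have "\<dots> \<le> t\<^sup>2 * ?\<sigma> / 4" by (intro divide_right_mono mult_left_mono variance_lower A x) auto
    finally have "(real M)\<^sup>2 / 64 \<le> t\<^sup>2 * ?\<sigma> / 4" .
    moreover have "real M / 64 \<le> (real M)\<^sup>2 / 64" using M1 by (simp add: power2_eq_square)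
    ultimately have "real M / 64 \<le> t\<^sup>2 * ?\<sigma> / 4" by linarith
    then have "exp (- (t\<^sup>2 * ?\<sigma> / 4)) \<le> exp (- (real M / 64))" by simp
    also have "\<dots> = 1 / exp (real M / 64)" by (simp add: exp_minus field_simps)
    also have "\<dots> \<le> 1 / (real M / 64)"
    proof (rule divide_left_mono)
      show "real M / 64 \<le> exp (real M / 64)" using exp_ge_add_one_self[of "real M / 64"] by linarith
    qed (use M1 in auto)
    finally show ?thesis by simp
  qed
  also have "\<dots> = 260 / real M" by simp
  also have "\<dots> \<le> 260 / (\<delta> / 2)" using M \<delta> by (intro divide_left_mono) (auto intro!: mult_pos_pos)
  finally have prob: "measure_pmf.prob (step k A) B \<le> 520 / \<delta>" unfolding B_def mass_def by simp
  have "measure_pmf.expectation (step k A) (\<lambda>S. P (mass S))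
     \<le> measure_pmf.expectation (step k A) (\<lambda>S. \<kappa> * indicator B S + (\<delta>\<^sup>2 + \<kappa> / sqrt n))"
  proof (rule integral_mono)
    fix S
    show "P (mass S) \<le> \<kappa> * indicator B S + (\<delta>\<^sup>2 + \<kappa> / sqrt n)"
    proof (cases "S \<in> B")
      case True
      then show ?thesis using pot_P_le[of S] kappa_ge s by (simp add: add_increasing2)
    next
      case False
      then have "1 / (real M * t) < \<bar>mass S - 1/2\<bar>" by (simp add: B_def)
      moreover have "1 / (real M * t) = 1 / ((real M)\<^sup>2 * sqrt n)" by (simp add: t_def power2_eq_square mult_ac)
      ultimately have lt: "1 / ((real M)\<^sup>2 * sqrt n) < \<bar>mass S - 1/2\<bar>" by simp
      have "1 / (real M)\<^sup>2 = sqrt n * (1 / ((real M)\<^sup>2 * sqrt n))" using s by simp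
      also have "\<dots> \<le> sqrt n * \<bar>mass S - 1/2\<bar>" using lt s by (intro mult_left_mono) auto
      finally have "1 / (real M)\<^sup>2 \<le> sqrt n * \<bar>mass S - 1/2\<bar>" .
      then have "1 / max (sqrt n * \<bar>mass S - 1/2\<bar>) (1 / \<kappa>) \<le> 1 / (1 / (real M)\<^sup>2)"
        using M1 kappa_ge by (intro divide_left_mono mult_pos_pos) (auto simp: le_max_iff_disj less_max_iff_disj)
      then have 1: "1 / max (sqrt n * \<bar>mass S - 1/2\<bar>) (1 / \<kappa>) \<le> \<delta>\<^sup>2" using M2 by simp
      have "min (mass S) (1 - mass S) / sqrt n \<le> \<kappa> / sqrt n"
        using kappa_ge s mass_mem_unit[of S] by (intro divide_right_mono) auto
      moreover have "0 \<le> \<kappa> / sqrt n" using kappa_ge s by simp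
      ultimately show ?thesis using 1 False d2 by (auto simp: pot_def)
    qed
  qed (use finite_V in auto)
  also have "\<dots> = \<kappa> * measure_pmf.prob (step k A) B + (\<delta>\<^sup>2 + \<kappa> / sqrt n)"
    using finite_V by simp
  also have "\<dots> \<le> \<kappa> * (520 / \<delta>) + (\<kappa> * (1 / \<delta>) + \<kappa> * (1 / \<delta>))"
  proof (intro add_mono mult_left_mono prob)
    have "\<delta>\<^sup>2 * \<delta> \<le> \<delta>\<^sup>2 * \<delta>\<^sup>2" using d2 by (intro mult_left_mono) auto
    then show "\<delta>\<^sup>2 \<le> \<kappa> * (1 / \<delta>)" unfolding d4 using \<delta>(2) by (simp add: le_divide_eq)
    have "\<delta> \<le> sqrt n" using d2 d2k kappa_n kappa_ge by linarith
    then have "1 / sqrt n \<le> 1 / \<delta>" using \<delta>(2) s by (intro divide_left_mono mult_pos_pos) auto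
    then show "\<kappa> / sqrt n \<le> \<kappa> * (1 / \<delta>)" using kappa_ge mult_left_mono[of "1 / sqrt n" "1 / \<delta>" \<kappa>] by simp
  qed (use kappa_ge in auto)
  also have "\<dots> = 522 / \<delta> * P (mass A)" by (simp add: Pa field_simps)
  finally show ?thesis .
qed

lemma expectation_pot_complement:
  assumes "A \<subseteq> V"
  shows "measure_pmf.expectation (step k (V - A)) (\<lambda>S. P (mass S)) = measure_pmf.expectation (step k A) (\<lambda>S. P (mass S))"
  unfolding step_complement[OF assms, symmetric] by (simp add: mass_complement pot_complement)

lemma contract:
  assumes A: "A \<subseteq> V" and \<delta>: "\<delta> ^ 4 = \<kappa>" "\<delta> \<ge> 1"
  shows "measure_pmf.expectation (step k A) (\<lambda>S. P (mass S)) \<le> 522 / \<delta> * P (mass A)"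
proof -
  have dk: "\<delta> \<le> \<kappa>" using \<delta> power_increasing[of 1 4 \<delta>] by simp
  have main: "measure_pmf.expectation (step k A) (\<lambda>S. P (mass S)) \<le> 522 / \<delta> * P (mass A)"
    if A: "A \<subseteq> V" and a: "mass A \<le> 1/2" for A
  proof -
    have P0: "0 \<le> P (mass A)" using mass_mem_unit n_pos kappa_ge by (intro pot_nonneg) auto
    have le: "measure_pmf.expectation (step k A) (\<lambda>S. P (mass S)) \<le> 522 / \<delta> * P (mass A)"
      if "measure_pmf.expectation (step k A) (\<lambda>S. P (mass S)) \<le> c / \<kappa> * P (mass A)" "0 \<le> c" "c \<le> 522" for c
    proof -
      have "c / \<kappa> * P (mass A) \<le> 522 / \<delta> * P (mass A)"
        using that \<delta> dk P0 by (intro mult_right_mono frac_le) auto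
      then show ?thesis using that by simp
    qed
    consider "mass A \<le> 3/8" | "3/8 < mass A" "mass A \<le> 1/2 - 1 / (4 * \<kappa>\<^sup>2)"
      | "1 / (\<kappa> * sqrt n) \<le> 1/2 - mass A" "1/2 - mass A < 1 / (4 * \<kappa>\<^sup>2)"
      | "\<bar>mass A - 1/2\<bar> < 1 / (\<kappa> * sqrt n)"
      using a by fastforce
    then show ?thesis
    proof cases
      case 1 then show ?thesis using contract_small[OF A] by (intro le) auto
    next
      case 2 then show ?thesis using contract_middle[OF A] by (intro le) auto
    next
      case 3 then show ?thesis using contract_drift[OF A refl] by (intro le) auto
    next
      case 4 then show ?thesis using contract_balanced[OF A _ \<delta>] by auto
    qed
  qed
  show ?thesis
  proof (cases "mass A \<le> 1/2")
    case False
    then have "mass (V - A) \<le> 1/2" by (simp add: mass_complement)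
    from main[OF _ this] show ?thesis
      unfolding expectation_pot_complement[OF A] by (simp add: mass_complement pot_complement)
  qed (use main A in auto)
qed

end

section \<open>The process in time\<close>

text \<open>The recursion of \<open>opinion0\<close> adds rounds at the end; integration over
  streams splits off the first one.\<close>

lemma opinion0_SCons:
  "opinion0 m V A (s ## \<omega>) (Suc t) = opinion0 m V (best_of m V s A) \<omega> t"
  by (induction t) simp_all

lemma best_of_subset: "best_of m V s A \<subseteq> V"
  by (auto simp: best_of_def)

lemma opinion0_subset: "A \<subseteq> V \<Longrightarrow> opinion0 m V A \<omega> t \<subseteq> V"
  by (cases t) (auto simp: best_of_def)

lemma space_voting_space [simp]: "space (voting_space m V E) = UNIV"
  by (simp add: voting_space_def space_stream_space)

lemma prob_space_voting_space: "prob_space (voting_space m V E)"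
  unfolding voting_space_def by (intro prob_space.prob_space_stream_space measure_pmf.prob_space_axioms)

lemma measurable_opinion0:
  assumes V: "finite V" and A: "A \<subseteq> V"
  shows "(\<lambda>\<omega>. opinion0 m V A \<omega> t) \<in> measurable (voting_space m V E) (count_space (Pow V))"
proof (induction t)
  case 0
  then show ?case using A by simp
next
  case (Suc t)
  \<comment> \<open>The current set takes finitely many values, so it is enough to treat the update
    of each fixed set.\<close>
  have "(\<lambda>\<omega>. best_of m V (\<omega> !! t) B) \<in> measurable (voting_space m V E) (count_space (Pow V))" for B
  proof (rule measurable_compose[where f = "\<lambda>\<omega>. \<omega> !! t" and g = "\<lambda>s. best_of m V s B"])
    show "(\<lambda>\<omega>. \<omega> !! t) \<in> measurable (voting_space m V E) (measure_pmf (samples_pmf m V E))"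
      unfolding voting_space_def by (rule measurable_snth)
    show "(\<lambda>s. best_of m V s B) \<in> measurable (measure_pmf (samples_pmf m V E)) (count_space (Pow V))"
      by (simp add: best_of_subset)
  qed
  from measurable_compose_countable'[OF this Suc countable_finite] V
  show ?case by simp
qed

text \<open>Markov property: the first sample is split off the stream and the induction hypothesis
  is applied from the resulting set, hence the induction is over all starting sets.\<close>

lemma nn_integral_opinion0_le:
  fixes f :: "'a set \<Rightarrow> ennreal"
  assumes V: "finite V"
    and contract: "\<And>A. A \<subseteq> V \<Longrightarrow> (\<integral>\<^sup>+s. f (best_of m V s A) \<partial>samples_pmf m V E) \<le> r * f A"
    and A: "A \<subseteq> V"
  shows "(\<integral>\<^sup>+\<omega>. f (opinion0 m V A \<omega> t) \<partial>voting_space m V E) \<le> r ^ t * f A"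
  using A
proof (induction t arbitrary: A)
  case 0
  then show ?case
    by (simp add: prob_space.emeasure_space_1[OF prob_space_voting_space, simplified])
next
  case (Suc t)
  have "(\<lambda>\<omega>. f (opinion0 m V A \<omega> (Suc t))) \<in> borel_measurable (stream_space (measure_pmf (samples_pmf m V E)))"
    using measurable_compose[OF measurable_opinion0[OF V Suc.prems, of m "Suc t" E], of f borel]
    unfolding voting_space_def by simp
  then have "(\<integral>\<^sup>+\<omega>. f (opinion0 m V A \<omega> (Suc t)) \<partial>voting_space m V E)
    = (\<integral>\<^sup>+s. (\<integral>\<^sup>+\<omega>. f (opinion0 m V A (s ## \<omega>) (Suc t)) \<partial>voting_space m V E) \<partial>samples_pmf m V E)"
    unfolding voting_space_def by (rule prob_space.nn_integral_stream_space[OF measure_pmf.prob_space_axioms])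
  also have "\<dots> = (\<integral>\<^sup>+s. (\<integral>\<^sup>+\<omega>. f (opinion0 m V (best_of m V s A) \<omega> t) \<partial>voting_space m V E) \<partial>samples_pmf m V E)"
    by (simp only: opinion0_SCons)
  also have "\<dots> \<le> (\<integral>\<^sup>+s. r ^ t * f (best_of m V s A) \<partial>samples_pmf m V E)"
    by (intro nn_integral_mono Suc.IH best_of_subset)
  also have "\<dots> = r ^ t * (\<integral>\<^sup>+s. f (best_of m V s A) \<partial>samples_pmf m V E)"
    by (rule nn_integral_cmult) simp
  also have "\<dots> \<le> r ^ t * (r * f A)"
    by (intro mult_left_mono contract Suc.prems) auto
  finally show ?case by (simp add: mult_ac)
qed

text \<open>In \<open>enat\<close> the infimum of a nonempty set of times is attained, and that of
  the empty set is infinite, which no real bound admits.\<close>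

lemma T_cons_le_iff:
  "ereal_of_enat (T_cons m V A \<omega>) \<le> ereal c \<longleftrightarrow> (\<exists>t. real t \<le> c \<and> opinion0 m V A \<omega> t \<in> {{}, V})"
proof -
  define S where "S = {t. opinion0 m V A \<omega> t \<in> {{}, V}}"
  have T: "T_cons m V A \<omega> = (INF t\<in>S. enat t)" by (simp add: T_cons_def S_def)
  have "ereal_of_enat (INF t\<in>S. enat t) \<le> ereal c \<longleftrightarrow> (\<exists>t\<in>S. real t \<le> c)"
  proof
    assume le: "ereal_of_enat (INF t\<in>S. enat t) \<le> ereal c"
    show "\<exists>t\<in>S. real t \<le> c"
    proof (cases "S = {}")
      case True
      then show ?thesis using le by (simp add: top_enat_def)
    next
      case False
      then have "(INF t\<in>S. enat t) \<in> enat ` S"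
        unfolding Inf_enat_def by (auto intro: LeastI)
      then show ?thesis using le by auto
    qed
  next
    assume "\<exists>t\<in>S. real t \<le> c"
    then obtain t where t: "t \<in> S" "real t \<le> c" by auto
    then have "ereal_of_enat (INF t\<in>S. enat t) \<le> ereal_of_enat (enat t)"
      by (subst ereal_of_enat_le_iff) (rule INF_lower)
    also have "\<dots> \<le> ereal c" using t by simp
    finally show "ereal_of_enat (INF t\<in>S. enat t) \<le> ereal c" .
  qed
  then show ?thesis by (auto simp: T S_def)
qed

lemma prob_T_cons_ge:
  assumes V: "finite V" and A: "A \<subseteq> V" and t: "real t \<le> c"
  shows "\<P>(\<omega> in voting_space m V E. opinion0 m V A \<omega> t \<in> {{}, V})
    \<le> \<P>(\<omega> in voting_space m V E. ereal_of_enat (T_cons m V A \<omega>) \<le> ereal c)"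
proof (rule finite_measure.finite_measure_mono)
  show "finite_measure (voting_space m V E)"
    using prob_space_voting_space by (rule prob_space.finite_measure)
  show "{\<omega> \<in> space (voting_space m V E). opinion0 m V A \<omega> t \<in> {{}, V}}
     \<subseteq> {\<omega> \<in> space (voting_space m V E). ereal_of_enat (T_cons m V A \<omega>) \<le> ereal c}"
    using t by (auto simp: T_cons_le_iff)
  have sets: "{\<omega> \<in> space (voting_space m V E). opinion0 m V A \<omega> t \<in> {{}, V}} \<in> sets (voting_space m V E)" for t
  proof -
    have "(\<lambda>\<omega>. opinion0 m V A \<omega> t) -` {{}, V} \<inter> space (voting_space m V E) \<in> sets (voting_space m V E)"
      by (rule measurable_sets[OF measurable_opinion0[OF V A]]) auto
    then show ?thesis by (simp add: vimage_def Int_def)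
  qed
  have "{\<omega> \<in> space (voting_space m V E). ereal_of_enat (T_cons m V A \<omega>) \<le> ereal c}
    = (\<Union>t\<in>{t. real t \<le> c}. {\<omega> \<in> space (voting_space m V E). opinion0 m V A \<omega> t \<in> {{}, V}})"
    by (auto simp: T_cons_le_iff)
  also have "\<dots> \<in> sets (voting_space m V E)"
    using sets by (intro sets.countable_UN') auto
  finally show "{\<omega> \<in> space (voting_space m V E). ereal_of_enat (T_cons m V A \<omega>) \<le> ereal c}
     \<in> sets (voting_space m V E)" .
qed

context good_graph
begin

lemma mass_ge:
  assumes "A \<subseteq> V" "A \<noteq> {}"
  shows "1 / (2 * n) \<le> mass A"
proof -
  obtain v where v: "v \<in> A" "v \<in> V" using assms by auto
  have "1 / (2 * n) \<le> wt v * of_bool (v \<in> A)" using wt_ge[OF v(2)] v by simp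
  also have "\<dots> \<le> mass A"
    unfolding mass_def using v finite_V wt_pos by (intro member_le_sum) (auto simp: less_imp_le)
  finally show ?thesis .
qed

text \<open>Markov's inequality: the initial potential is at most \<kappa>, every round multiplies
  its mean by at most 522/\<delta>, and without consensus it is at least 1/(2 n sqrt n).\<close>

lemma prob_consensus_ge:
  assumes A: "A \<subseteq> V" and \<delta>: "\<delta> ^ 4 = \<kappa>" "\<delta> \<ge> 1"
  shows "\<P>(\<omega> in voting_space (2*k+1) V E. opinion0 (2*k+1) V A \<omega> t \<in> {{}, V})
    \<ge> 1 - 2 * n * sqrt n * \<kappa> * (522 / \<delta>) ^ t"
proof -
  let ?M = "voting_space (2*k+1) V E"
  interpret prob_space ?M by (rule prob_space_voting_space)
  let ?f = "\<lambda>S. ennreal (P (mass S))"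
  define D where "D = {\<omega> \<in> space ?M. opinion0 (2*k+1) V A \<omega> t \<notin> {{}, V}}"
  have P0: "0 \<le> P (mass S)" for S using mass_mem_unit n_pos kappa_ge by (intro pot_nonneg) auto
  have D: "D \<in> sets ?M"
  proof -
    have "(\<lambda>\<omega>. opinion0 (2*k+1) V A \<omega> t) -` (Pow V - {{}, V}) \<inter> space ?M \<in> sets ?M"
      by (rule measurable_sets[OF measurable_opinion0[OF finite_V A]]) auto
    moreover have "(\<lambda>\<omega>. opinion0 (2*k+1) V A \<omega> t) -` (Pow V - {{}, V}) \<inter> space ?M = D"
      using opinion0_subset[OF A] by (auto simp: D_def)
    ultimately show ?thesis by simp
  qed
  have contract': "(\<integral>\<^sup>+s. ?f (best_of (2*k+1) V s B) \<partial>samples_pmf (2*k+1) V E) \<le> ennreal (522 / \<delta>) * ?f B"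
    if B: "B \<subseteq> V" for B
  proof -
    have "(\<integral>\<^sup>+s. ?f (best_of (2*k+1) V s B) \<partial>samples_pmf (2*k+1) V E) = (\<integral>\<^sup>+S. ?f S \<partial>step k B)"
      unfolding map_best_of_samples[symmetric] by simp
    also have "\<dots> = ennreal (measure_pmf.expectation (step k B) (\<lambda>S. P (mass S)))"
      using finite_V P0 by (intro nn_integral_eq_integral) auto
    also have "\<dots> \<le> ennreal (522 / \<delta> * P (mass B))" by (intro ennreal_leI contract B \<delta>)
    also have "\<dots> = ennreal (522 / \<delta>) * ?f B" using \<delta> P0 by (intro ennreal_mult) auto
    finally show ?thesis .
  qed
  have l: "1 / (2 * n) / sqrt n \<le> P (mass S)" if "S \<subseteq> V" "S \<noteq> {}" "S \<noteq> V" for S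
  proof (rule pot_ge)
    show "1 / (2 * n) \<le> mass S" using that by (intro mass_ge)
    have "1 / (2 * n) \<le> mass (V - S)" using that by (intro mass_ge) auto
    then show "1 / (2 * n) \<le> 1 - mass S" by (simp add: mass_complement)
  qed (use n_pos kappa_ge in auto)
  have "ennreal (1 / (2 * n) / sqrt n) * emeasure ?M D = (\<integral>\<^sup>+\<omega>. ennreal (1 / (2 * n) / sqrt n) * indicator D \<omega> \<partial>?M)"
    by (rule nn_integral_cmult_indicator[OF D, symmetric])
  also have "\<dots> \<le> (\<integral>\<^sup>+\<omega>. ?f (opinion0 (2*k+1) V A \<omega> t) \<partial>?M)"
  proof (rule nn_integral_mono)
    fix \<omega>
    show "ennreal (1 / (2 * n) / sqrt n) * indicator D \<omega> \<le> ?f (opinion0 (2*k+1) V A \<omega> t)"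
      using l[OF opinion0_subset[OF A]] by (auto simp: D_def indicator_def intro!: ennreal_leI)
  qed
  also have "\<dots> \<le> ennreal (522 / \<delta>) ^ t * ?f A"
    by (rule nn_integral_opinion0_le[OF finite_V contract' A])
  also have "\<dots> = ennreal ((522 / \<delta>) ^ t * P (mass A))"
    using \<delta> P0 by (simp add: ennreal_power ennreal_mult)
  finally have "ennreal (1 / (2 * n) / sqrt n * measure ?M D) \<le> ennreal ((522 / \<delta>) ^ t * P (mass A))"
    unfolding emeasure_eq_measure using n_pos by (subst ennreal_mult) auto
  then have "1 / (2 * n) / sqrt n * measure ?M D \<le> (522 / \<delta>) ^ t * P (mass A)"
    using \<delta> P0 by (subst (asm) ennreal_le_iff) auto
  also have "\<dots> \<le> (522 / \<delta>) ^ t * \<kappa>" using pot_P_le \<delta> by (intro mult_left_mono) auto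
  finally have "measure ?M D \<le> 2 * n * sqrt n * \<kappa> * (522 / \<delta>) ^ t"
    using n_pos by (simp add: divide_le_eq mult_ac)
  moreover have "measure ?M {\<omega> \<in> space ?M. opinion0 (2*k+1) V A \<omega> t \<in> {{}, V}} = 1 - measure ?M D"
  proof -
    have "{\<omega> \<in> space ?M. opinion0 (2*k+1) V A \<omega> t \<in> {{}, V}} = space ?M - D" by (auto simp: D_def)
    then show ?thesis using prob_compl[OF D] by simp
  qed
  ultimately show ?thesis by simp
qed

end

section \<open>Deviations in the random graph\<close>

definition pairs :: "nat \<Rightarrow> nat set set" where
  "pairs n = {e. e \<subseteq> {..<n} \<and> card e = 2}"

lemma finite_pairs: "finite (pairs n)"
  by (rule finite_subset[of _ "Pow {..<n}"]) (auto simp: pairs_def)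

lemma gnp_eq: "gnp n p = rand_subset (pairs n) (\<lambda>_. p)"
proof -
  let ?P = "Pi_pmf (pairs n) False (\<lambda>_. bernoulli_pmf p)"
  have "{e. f e} = {e\<in>pairs n. f e}" if "f \<in> set_pmf ?P" for f
    using that set_Pi_pmf_subset[OF finite_pairs, of n False "\<lambda>_. bernoulli_pmf p"] by blast
  then show ?thesis
    unfolding gnp_def rand_subset_def pairs_def[symmetric] by (intro map_pmf_cong) auto
qed

lemma sum_pairs:
  "(\<Sum>e\<in>pairs n. \<Sum>v\<in>e. g v e) = (\<Sum>v<n. \<Sum>w\<in>{..<n} - {v}. g v {v, w})"
proof -
  have "(\<Sum>e\<in>pairs n. \<Sum>v\<in>e. g v e) = (\<Sum>e\<in>pairs n. \<Sum>v | v \<in> {..<n} \<and> v \<in> e. g v e)"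
    by (intro sum.cong) (auto simp: pairs_def)
  also have "\<dots> = (\<Sum>v<n. \<Sum>e | e \<in> pairs n \<and> v \<in> e. g v e)"
    by (rule sum.swap_restrict) (auto simp: finite_pairs)
  also have "\<dots> = (\<Sum>v<n. \<Sum>w\<in>{..<n} - {v}. g v {v, w})"
  proof (rule sum.cong)
    fix v assume v: "v \<in> {..<n}"
    have "e \<in> (\<lambda>w. {v, w}) ` ({..<n} - {v})" if e: "e \<in> pairs n" "v \<in> e" for e
    proof -
      obtain x y where "e = {x, y}" "x \<noteq> y" using e by (auto simp: pairs_def card_2_iff)
      then obtain w where "e = {v, w}" "w \<noteq> v" using e(2) by auto
      then show ?thesis using e by (auto simp: pairs_def)
    qed
    then have "{e. e \<in> pairs n \<and> v \<in> e} = (\<lambda>w. {v, w}) ` ({..<n} - {v})"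
      using v by (auto simp: pairs_def)
    moreover have "inj_on (\<lambda>w. {v, w}) ({..<n} - {v})" by (auto simp: inj_on_def doubleton_eq_iff)
    ultimately show "(\<Sum>e | e \<in> pairs n \<and> v \<in> e. g v e) = (\<Sum>w\<in>{..<n} - {v}. g v {v, w})"
      by (simp add: sum.reindex)
  qed simp
  finally show ?thesis .
qed

text \<open>A vertex is never its own neighbour; subtracting \<open>v\<close> from the set makes the
  deviation exactly centred under \<open>gnp\<close>.\<close>

definition dev :: "real \<Rightarrow> nat set set \<Rightarrow> nat set \<Rightarrow> nat \<Rightarrow> real" where
  "dev p E A v = real (card (nbrs E v \<inter> A)) - p * real (card (A - {v}))"

lemma dev_eq_sum:
  assumes "A \<subseteq> {..<n}"
  shows "dev p E A v = (\<Sum>w\<in>{..<n} - {v}. of_bool (w \<in> A) * (of_bool ({v, w} \<in> E) - p))"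
proof -
  have fin: "finite A" using assms finite_subset by blast
  have "(\<Sum>w\<in>{..<n} - {v}. of_bool (w \<in> A) * (of_bool ({v, w} \<in> E) - p))
     = (\<Sum>w\<in>A - {v}. of_bool ({v, w} \<in> E) - p)"
    using assms by (intro sum.mono_neutral_cong_right) auto
  also have "\<dots> = real (card {w\<in>A - {v}. {v, w} \<in> E}) - p * real (card (A - {v}))"
    using fin by (simp add: sum_subtractf sum.If_cases of_bool_def Int_def)
  also have "{w\<in>A - {v}. {v, w} \<in> E} = nbrs E v \<inter> A" by (auto simp: nbrs_def)
  finally show ?thesis by (simp add: dev_def)
qed

text \<open>The degrees into \<open>A\<close> are dependent, as an edge inside \<open>A\<close>
  counts at both ends. Regrouping by edges restores independence: an edge has a coefficient of at
  most 2K, and (a+b)^2 \<le> 2a^2 + 2b^2 bounds the sum of squared coefficients.\<close>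

lemma Chernoff_gnp:
  assumes p: "p \<in> {0..1}" and A: "A \<subseteq> {..<n}" and u: "u \<ge> 0" "2 * u * K \<le> 1"
    and y: "\<And>v. v < n \<Longrightarrow> \<bar>y v\<bar> \<le> K"
  shows "measure_pmf.prob (gnp n p) {E. (\<Sum>v<n. y v * dev p E A v) \<ge> \<tau>}
    \<le> exp (- u * \<tau> + 2 * p * u\<^sup>2 * real (card A) * (\<Sum>v<n. (y v)\<^sup>2))"
proof -
  \<comment> \<open>For a pair \<open>e\<close> containing \<open>v\<close>, the condition
    \<open>e - {v} \<subseteq> A\<close> says that the other endpoint is in \<open>A\<close>; no
    orientation of the pair is needed.\<close>
  define c where "c e = (\<Sum>v\<in>e. y v * of_bool (e - {v} \<subseteq> A))" for e
  have of_bool_sq: "(of_bool b :: real)\<^sup>2 = of_bool b" for b by (cases b) auto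
  have doubleton_diff: "{v, w} - {v} \<subseteq> A \<longleftrightarrow> w \<in> A" if "w \<in> {..<n} - {v}" for v w using that by auto
  have "(\<Sum>v<n. y v * dev p E A v) = (\<Sum>e\<in>pairs n. c e * (of_bool (e \<in> E) - p))" for E
    unfolding c_def sum_distrib_right sum_pairs dev_eq_sum[OF A] sum_distrib_left
    by (intro sum.cong refl) (simp add: doubleton_diff)
  moreover have "measure_pmf.prob (gnp n p) {E. (\<Sum>e\<in>pairs n. c e * (of_bool (e \<in> E) - p)) \<ge> \<tau>}
    \<le> exp (- u * \<tau> + p * u\<^sup>2 * (\<Sum>e\<in>pairs n. (c e)\<^sup>2))"
    unfolding gnp_eq
  proof (rule Chernoff_rand_subset[OF finite_pairs p u(1)])
    fix e assume e: "e \<in> pairs n"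
    have "\<bar>c e\<bar> \<le> (\<Sum>v\<in>e. \<bar>y v * of_bool (e - {v} \<subseteq> A)\<bar>)" unfolding c_def by (rule sum_abs)
    also have "\<dots> \<le> (\<Sum>v\<in>e. K)"
    proof (rule sum_mono)
      fix v assume "v \<in> e"
      then have "v < n" using e by (auto simp: pairs_def)
      from y[OF this] show "\<bar>y v * of_bool (e - {v} \<subseteq> A)\<bar> \<le> K" by (auto simp: abs_mult of_bool_def)
    qed
    also have "\<dots> = 2 * K" using e by (simp add: pairs_def)
    finally have "u * \<bar>c e\<bar> \<le> u * (2 * K)" using u by (intro mult_left_mono)
    then show "u * \<bar>c e\<bar> \<le> 1" using u by (simp add: mult_ac)
  qed
  moreover have "(\<Sum>e\<in>pairs n. (c e)\<^sup>2) \<le> 2 * real (card A) * (\<Sum>v<n. (y v)\<^sup>2)"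
  proof -
    have "(\<Sum>e\<in>pairs n. (c e)\<^sup>2) \<le> (\<Sum>e\<in>pairs n. \<Sum>v\<in>e. 2 * ((y v)\<^sup>2 * of_bool (e - {v} \<subseteq> A)))"
    proof (rule sum_mono)
      fix e assume "e \<in> pairs n"
      then obtain v w where e: "e = {v, w}" "v \<noteq> w" by (auto simp: pairs_def card_2_iff)
      have "(a + b)\<^sup>2 \<le> 2 * a\<^sup>2 + 2 * b\<^sup>2" for a b :: real
        using zero_le_power2[of "a - b"] by (simp add: power2_eq_square algebra_simps)
      from this[of "y v * of_bool (e - {v} \<subseteq> A)" "y w * of_bool (e - {w} \<subseteq> A)"]
      have "(y v * of_bool (e - {v} \<subseteq> A) + y w * of_bool (e - {w} \<subseteq> A))\<^sup>2
        \<le> 2 * ((y v)\<^sup>2 * of_bool (e - {v} \<subseteq> A)) + 2 * ((y w)\<^sup>2 * of_bool (e - {w} \<subseteq> A))"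
        unfolding power_mult_distrib by (simp only: of_bool_sq)
      moreover have "(\<Sum>u\<in>e. f u) = f v + f w" for f :: "nat \<Rightarrow> real" using e by simp
      ultimately show "(c e)\<^sup>2 \<le> (\<Sum>v\<in>e. 2 * ((y v)\<^sup>2 * of_bool (e - {v} \<subseteq> A)))"
        unfolding c_def by (simp only:)
    qed
    also have "\<dots> = (\<Sum>v<n. \<Sum>w\<in>{..<n} - {v}. 2 * ((y v)\<^sup>2 * of_bool (w \<in> A)))"
      unfolding sum_pairs by (intro sum.cong refl) (simp add: doubleton_diff)
    also have "\<dots> \<le> (\<Sum>v<n. 2 * ((y v)\<^sup>2 * real (card A)))"
    proof (rule sum_mono)
      fix v
      have "(\<Sum>w\<in>{..<n} - {v}. of_bool (w \<in> A) :: real) \<le> (\<Sum>w<n. of_bool (w \<in> A))"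
        by (intro sum_mono2) auto
      also have "\<dots> = real (card A)" using A by (simp add: Int_absorb1)
      finally show "(\<Sum>w\<in>{..<n} - {v}. 2 * ((y v)\<^sup>2 * of_bool (w \<in> A))) \<le> 2 * ((y v)\<^sup>2 * real (card A))"
        unfolding sum_distrib_left[symmetric] by (intro mult_left_mono) auto
    qed
    also have "\<dots> = 2 * real (card A) * (\<Sum>v<n. (y v)\<^sup>2)" by (simp add: sum_distrib_left mult_ac)
    finally show ?thesis .
  qed
  then have "p * u\<^sup>2 * (\<Sum>e\<in>pairs n. (c e)\<^sup>2) \<le> p * u\<^sup>2 * (2 * real (card A) * (\<Sum>v<n. (y v)\<^sup>2))"
    using p by (intro mult_left_mono) auto
  then have "exp (- u * \<tau> + p * u\<^sup>2 * (\<Sum>e\<in>pairs n. (c e)\<^sup>2))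
    \<le> exp (- u * \<tau> + 2 * p * u\<^sup>2 * real (card A) * (\<Sum>v<n. (y v)\<^sup>2))"
    by (simp add: mult_ac)
  ultimately show ?thesis by (auto intro: order_trans)
qed

lemma prob_UN_le:
  assumes "finite I"
  shows "measure_pmf.prob M (\<Union>i\<in>I. B i) \<le> (\<Sum>i\<in>I. measure_pmf.prob M (B i))"
  by (intro measure_UNION_le) (auto simp: assms)

text \<open>The tolerance 1/200 leaves room for the self-exclusion term \<open>p\<close>, which is
  at most n p/200 once n \<ge> 200, within a total error of one percent in every degree.\<close>

definition regular :: "nat \<Rightarrow> real \<Rightarrow> nat set set \<Rightarrow> bool" where
  "regular n p E \<longleftrightarrow> (\<forall>v<n. \<bar>dev p E {..<n} v\<bar> \<le> real n * p / 200)"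

lemma prob_not_regular:
  assumes p: "p \<in> {0..1}"
  shows "measure_pmf.prob (gnp n p) {E. \<not> regular n p E} \<le> 2 * real n * exp (- (real n * p / 320000))"
proof -
  let ?B = "\<lambda>s v. {E. (\<Sum>w<n. (s * of_bool (w = v)) * dev p E {..<n} w) \<ge> real n * p / 200}"
  have pr: "measure_pmf.prob (gnp n p) (?B s v) \<le> exp (- (real n * p / 320000))" if s: "\<bar>s\<bar> = 1" and v: "v < n" for s v
  proof -
    \<comment> \<open>\<open>u\<close> = 1/800 minimises the exponent -u/200 + 2u^2 (in units of n
      p).\<close>
    have "measure_pmf.prob (gnp n p) (?B s v)
      \<le> exp (- (1/800) * (real n * p / 200) + 2 * p * (1/800)\<^sup>2 * real (card {..<n}) * (\<Sum>w<n. (s * of_bool (w = v))\<^sup>2))"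
      by (rule Chernoff_gnp[where K = 1]) (use p s in auto)
    also have "(\<Sum>w<n. (s * of_bool (w = v))\<^sup>2) = (\<Sum>w\<in>{v}. 1)"
      using v s by (intro sum.mono_neutral_cong_right) (auto simp: power2_eq_square abs_if split: if_splits)
    finally show ?thesis by (simp add: power2_eq_square mult_ac)
  qed
  have "{E. \<not> regular n p E} \<subseteq> (\<Union>v\<in>{..<n}. ?B 1 v \<union> ?B (-1) v)"
  proof
    fix E assume "E \<in> {E. \<not> regular n p E}"
    then obtain v where v: "v < n" "\<bar>dev p E {..<n} v\<bar> > real n * p / 200" by (auto simp: regular_def not_le)
    have "(\<Sum>w<n. (s * of_bool (w = v)) * dev p E {..<n} w) = s * dev p E {..<n} v" for s
    proof -
      have "(\<Sum>w<n. (s * of_bool (w = v)) * dev p E {..<n} w) = (\<Sum>w\<in>{v}. s * dev p E {..<n} w)"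
        using v by (intro sum.mono_neutral_cong_right) auto
      then show ?thesis by simp
    qed
    then have "E \<in> ?B 1 v \<union> ?B (-1) v" unfolding Un_iff mem_Collect_eq using v(2) by (simp only:) linarith
    then show "E \<in> (\<Union>v\<in>{..<n}. ?B 1 v \<union> ?B (-1) v)" using v(1) by blast
  qed
  then have "measure_pmf.prob (gnp n p) {E. \<not> regular n p E} \<le> measure_pmf.prob (gnp n p) (\<Union>v\<in>{..<n}. ?B 1 v \<union> ?B (-1) v)"
    by (intro measure_pmf.finite_measure_mono) auto
  also have "\<dots> \<le> (\<Sum>v<n. measure_pmf.prob (gnp n p) (?B 1 v \<union> ?B (-1) v))" by (intro prob_UN_le) auto
  also have "\<dots> \<le> (\<Sum>v<n. exp (- (real n * p / 320000)) + exp (- (real n * p / 320000)))"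
    by (intro sum_mono order_trans[OF measure_Un_le] add_mono pr) auto
  finally show ?thesis by simp
qed

text \<open>The contribution of one coordinate to the sum over integer vectors in
  \<open>prob_not_expanding\<close>. Since j^2 \<ge> \<bar>j\<bar>, a geometric series of ratio at
  most 16/17 bounds either half by 17.\<close>

lemma sum_exp_neg_sq_le: "(\<Sum>j\<in>{- int L..int L}. exp (- ((real_of_int j)\<^sup>2 / 16))) \<le> 34"
proof -
  have geo: "(\<Sum>i\<le>L. exp (- (real i / 16))) \<le> 17"
  proof -
    define r :: real where "r = exp (- (1/16))"
    have "(1 + 1/16 :: real) \<le> exp (1/16)" by (rule exp_ge_add_one_self)
    then have "1 / exp (1/16) \<le> 1 / (1 + 1/16 :: real)" by (intro divide_left_mono) auto
    then have r: "0 < r" "r \<le> 16/17" by (simp_all add: r_def exp_minus field_simps)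
    have "(\<Sum>i\<le>L. exp (- (real i / 16))) = (\<Sum>i\<le>L. r ^ i)"
      by (intro sum.cong refl) (simp add: r_def exp_of_nat_mult[symmetric])
    also have "\<dots> = (1 - r ^ Suc L) / (1 - r)" using r by (subst sum_gp0) auto
    also have "\<dots> \<le> 1 / (1 - 16/17)" using r by (intro frac_le) auto
    finally show ?thesis by simp
  qed
  have sq: "real i \<le> (real i)\<^sup>2" for i by (cases i) (auto simp: power2_eq_square)
  have "(\<Sum>j\<in>{- int L..int L}. exp (- ((real_of_int j)\<^sup>2 / 16)))
    \<le> (\<Sum>j\<in>(\<lambda>i. int i) ` {..L} \<union> (\<lambda>i. - int i) ` {..L}. exp (- ((real_of_int j)\<^sup>2 / 16)))"
  proof (rule sum_mono2)
    show "{- int L..int L} \<subseteq> (\<lambda>i. int i) ` {..L} \<union> (\<lambda>i. - int i) ` {..L}"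
    proof
      fix j assume j: "j \<in> {- int L..int L}"
      show "j \<in> (\<lambda>i. int i) ` {..L} \<union> (\<lambda>i. - int i) ` {..L}"
      proof (cases "j \<ge> 0")
        case True then show ?thesis using j by (intro UnI1 image_eqI[of _ _ "nat j"]) auto
      next
        case False then show ?thesis using j by (intro UnI2 image_eqI[of _ _ "nat (- j)"]) auto
      qed
    qed
  qed auto
  also have "\<dots> \<le> (\<Sum>j\<in>(\<lambda>i. int i) ` {..L}. exp (- ((real_of_int j)\<^sup>2 / 16)))
      + (\<Sum>j\<in>(\<lambda>i. - int i) ` {..L}. exp (- ((real_of_int j)\<^sup>2 / 16)))"
    by (subst sum_Un) (auto intro!: sum_nonneg)
  also have "\<dots> = (\<Sum>i\<le>L. exp (- ((real i)\<^sup>2 / 16))) + (\<Sum>i\<le>L. exp (- ((real i)\<^sup>2 / 16)))"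
    by (subst (1 2) sum.reindex) (auto simp: inj_on_def)
  also have "\<dots> \<le> (\<Sum>i\<le>L. exp (- (real i / 16))) + (\<Sum>i\<le>L. exp (- (real i / 16)))"
    using sq by (intro add_mono sum_mono) auto
  finally show ?thesis using geo by simp
qed

text \<open>The right side is what deviations of the typical order sqrt(n p) at every vertex would
  give. The constant is 194 = 2 * (96 + 1): 96 is the threshold for the rounded vector, the rest is
  the loss in rounding.\<close>

definition expanding :: "nat \<Rightarrow> real \<Rightarrow> nat set set \<Rightarrow> bool" where
  "expanding n p E \<longleftrightarrow> (\<forall>A\<subseteq>{..<n}. (\<Sum>v<n. (dev p E A v)\<^sup>2) \<le> 194 * real n * (real n * p))"

text \<open>A crude bound, but it confines the rounded deviations to a finite box and bounds the
  coefficients as required by \<open>Chernoff_gnp\<close>.\<close>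

lemma regular_imp_dev_le:
  assumes reg: "regular n p E" and A: "A \<subseteq> {..<n}" and p: "p \<in> {0..1}" and v: "v < n"
  shows "\<bar>dev p E A v\<bar> \<le> 2 * (real n * p)"
proof -
  have np: "0 \<le> real n * p" using p by simp
  have "A - {v} \<subseteq> {..<n}" using A by auto
  then have "p * real (card (A - {v})) \<le> p * real n" "p * real (card ({..<n} - {v})) \<le> p * real n"
    using p A card_mono[of "{..<n}" "A - {v}"] card_mono[of "{..<n}" "{..<n} - {v}"]
    by (auto intro!: mult_left_mono)
  moreover have "real (card (nbrs E v \<inter> A)) \<le> real (card (nbrs E v \<inter> {..<n}))"
    using A by (intro of_nat_mono card_mono) auto
  moreover have "\<bar>dev p E {..<n} v\<bar> \<le> real n * p / 200" using reg v by (simp add: regular_def)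
  moreover have "0 \<le> p * real (card (A - {v}))" using p by simp
  ultimately show ?thesis using np unfolding dev_def by (simp only: mult.commute[of p])
qed

text \<open>For a fixed \<open>A\<close>, the vector of deviations is rounded to an integer vector, after scaling by the
  typical deviation \<open>sqrt (n p)\<close>. Sub-Gaussian tails make the probability that a
  given integer vector \<open>y\<close> occurs at most \<open>exp (- \<bar>y\<bar>\<^sup>2 / 8)\<close>, so that summing over
  all \<open>y\<close> with \<open>\<bar>y\<bar>\<^sup>2 \<ge> 96 n\<close> and over all \<open>2\<^sup>n\<close> sets \<open>A\<close> still gives an exponentially
  small bound.\<close>

lemma prob_not_expanding:
  assumes p: "p \<in> {0..1}" and np: "real n * p > 0"
  shows "measure_pmf.prob (gnp n p) {E. regular n p E \<and> \<not> expanding n p E} \<le> exp (- real n)"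
proof -
  define q where "q = sqrt (real n * p)"
  have q: "q > 0" "q\<^sup>2 = real n * p" using np by (auto simp: q_def)
  define L where "L = nat \<lfloor>2 * q\<rfloor>"
  have L: "real L \<le> 2 * q" using q by (simp add: L_def)
  define Y where "Y = {y \<in> {..<n} \<rightarrow>\<^sub>E {- int L..int L}. 96 * real n \<le> (\<Sum>v<n. (real_of_int (y v))\<^sup>2)}"
  have Y_sub: "Y \<subseteq> {..<n} \<rightarrow>\<^sub>E {- int L..int L}" unfolding Y_def by (rule Collect_restrict)
  have finP: "finite ({..<n} \<rightarrow>\<^sub>E {- int L..int L})" by (intro finite_PiE) auto
  have finY: "finite Y" by (rule finite_subset[OF Y_sub finP])
  let ?B = "\<lambda>A y. {E. (\<Sum>v<n. real_of_int (y v) * dev p E A v) \<ge> q * (\<Sum>v<n. (real_of_int (y v))\<^sup>2)}"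
  have pr: "measure_pmf.prob (gnp n p) (?B A y) \<le> exp (- 6 * real n) * (\<Prod>v<n. exp (- ((real_of_int (y v))\<^sup>2 / 16)))"
    if A: "A \<subseteq> {..<n}" and y: "y \<in> Y" for A y
  proof -
    let ?R = "\<Sum>v<n. (real_of_int (y v))\<^sup>2"
    \<comment> \<open>\<open>u\<close> = 1/(4q) is the largest value allowed for coefficients up to
      2q; the exponent is then at most -R/4 + R/8, with R the sum of squares.\<close>
    have "measure_pmf.prob (gnp n p) (?B A y)
      \<le> exp (- (1 / (4 * q)) * (q * ?R) + 2 * p * (1 / (4 * q))\<^sup>2 * real (card A) * ?R)"
    proof (rule Chernoff_gnp[where K = "2 * q"])
      fix v assume "v < n"
      then have "y v \<in> {- int L..int L}" using y Y_sub by (auto dest!: subsetD PiE_mem)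
      then have "\<bar>real_of_int (y v)\<bar> \<le> real L" by auto
      then show "\<bar>real_of_int (y v)\<bar> \<le> 2 * q" using L by simp
    qed (use p A q in auto)
    also have "\<dots> \<le> exp (- (?R / 8))"
    proof -
      have "card A \<le> n" using A card_mono[of "{..<n}" A] by simp
      then have "2 * p * (1 / (4 * q))\<^sup>2 * real (card A) * ?R \<le> 2 * p * (1 / (4 * q))\<^sup>2 * real n * ?R"
        using p by (intro mult_right_mono mult_left_mono sum_nonneg) auto
      also have "\<dots> = ?R / 8"
      proof -
        have "2 * p * (1 / (4 * q))\<^sup>2 * real n = 2 * (real n * p) / (16 * q\<^sup>2)"
          by (simp add: power_divide power_mult_distrib)
        moreover have "2 * x / (16 * x) = 1/8" if "x > 0" for x :: real using that by simp
        from this[OF np] have "2 * (real n * p) / (16 * q\<^sup>2) = 1/8" unfolding q(2) .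
        ultimately show ?thesis by simp
      qed
      finally show ?thesis using q by simp
    qed
    \<comment> \<open>Half of R/8 is at least 6n because R \<ge> 96 n; the other half is kept to
      make the sum over \<open>y\<close> converge.\<close>
    also have "\<dots> \<le> exp (- 6 * real n + (\<Sum>v<n. - ((real_of_int (y v))\<^sup>2 / 16)))"
      using y by (simp add: Y_def sum_negf sum_divide_distrib[symmetric])
    also have "\<dots> = exp (- 6 * real n) * (\<Prod>v<n. exp (- ((real_of_int (y v))\<^sup>2 / 16)))"
      by (simp only: exp_add exp_sum[OF finite_lessThan])
    finally show ?thesis .
  qed
  have "{E. regular n p E \<and> \<not> expanding n p E} \<subseteq> (\<Union>(A, y)\<in>Pow {..<n} \<times> Y. ?B A y)"
  proof
    fix E assume "E \<in> {E. regular n p E \<and> \<not> expanding n p E}"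
    then obtain A where reg: "regular n p E" and A: "A \<subseteq> {..<n}"
      and large: "(\<Sum>v<n. (dev p E A v)\<^sup>2) > 194 * real n * (real n * p)" by (auto simp: expanding_def not_le)
    define d where "d v = dev p E A v" for v
    \<comment> \<open>Rounding towards 0 makes y d \<ge> q y^2 for either sign, so that the
      deviations are large in the direction of \<open>y\<close> itself, and loses less than 1 in
      each coordinate.\<close>
    define y where "y = (\<lambda>v\<in>{..<n}. if d v \<ge> 0 then \<lfloor>d v / q\<rfloor> else \<lceil>d v / q\<rceil>)"
    have y_le: "q * (real_of_int (y v))\<^sup>2 \<le> real_of_int (y v) * d v" if v: "v < n" for v
    proof (cases "d v \<ge> 0")
      case True
      then have "y v \<ge> 0" "q * real_of_int (y v) \<le> d v"
        using q v floor_divide_lower[of q "d v"] by (auto simp: y_def mult.commute)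
      then show ?thesis using mult_left_mono[of "q * real_of_int (y v)" "d v" "real_of_int (y v)"]
        by (simp add: power2_eq_square mult_ac)
    next
      case False
      have "d v / q \<le> 0" using False q by (simp add: divide_nonpos_pos)
      then have "y v \<le> 0" using False v by (simp add: y_def ceiling_le_iff)
      moreover have "d v / q \<le> real_of_int (y v)" using False v by (simp add: y_def)
      then have "d v \<le> q * real_of_int (y v)" using q by (simp add: divide_le_eq mult.commute)
      ultimately show ?thesis using mult_left_mono_neg[of "d v" "q * real_of_int (y v)" "real_of_int (y v)"]
        by (simp add: power2_eq_square mult_ac)
    qed
    have y_ge: "(d v)\<^sup>2 \<le> 2 * q\<^sup>2 * ((real_of_int (y v))\<^sup>2 + 1)" if v: "v < n" for v
    proof -
      have "\<bar>d v / q\<bar> \<le> \<bar>real_of_int (y v)\<bar> + 1" using v unfolding y_def by auto linarith+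
      then have "\<bar>d v / q\<bar>\<^sup>2 \<le> (\<bar>real_of_int (y v)\<bar> + 1)\<^sup>2" by (intro power_mono) auto
      also have "\<dots> \<le> 2 * ((real_of_int (y v))\<^sup>2 + 1)"
        using zero_le_power2[of "\<bar>real_of_int (y v)\<bar> - 1"] by (simp add: power2_eq_square algebra_simps)
      finally have "(d v)\<^sup>2 / q\<^sup>2 \<le> 2 * ((real_of_int (y v))\<^sup>2 + 1)" by (simp add: power_divide)
      then show ?thesis using q(1) by (simp add: pos_divide_le_eq algebra_simps)
    qed
    have "y \<in> {..<n} \<rightarrow>\<^sub>E {- int L..int L}"
    proof (rule PiE_I)
      fix v assume v: "v \<in> {..<n}"
      have "\<bar>d v\<bar> \<le> 2 * q\<^sup>2" using regular_imp_dev_le[OF reg A p, of v] v by (simp add: d_def q)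
      then have "\<bar>d v / q\<bar> \<le> 2 * q" using q by (simp add: divide_le_eq power2_eq_square mult_ac)
      then have "\<lfloor>\<bar>d v / q\<bar>\<rfloor> \<le> \<lfloor>2 * q\<rfloor>" by (rule floor_mono)
      moreover have "int L = \<lfloor>2 * q\<rfloor>" using q by (simp add: L_def)
      moreover have "d v / q \<ge> 0 \<longleftrightarrow> d v \<ge> 0" using q by (simp add: zero_le_divide_iff)
      ultimately show "y v \<in> {- int L..int L}" using v 
        by (auto simp: y_def abs_if ceiling_def not_le split: if_splits) linarith+
    qed (simp add: y_def)
    moreover have "96 * real n \<le> (\<Sum>v<n. (real_of_int (y v))\<^sup>2)"
    proof -
      have "194 * real n * q\<^sup>2 < (\<Sum>v<n. (d v)\<^sup>2)" using large by (simp add: d_def q)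
      also have "\<dots> \<le> (\<Sum>v<n. 2 * q\<^sup>2 * ((real_of_int (y v))\<^sup>2 + 1))" by (intro sum_mono y_ge) auto
      also have "\<dots> = (2 * ((\<Sum>v<n. (real_of_int (y v))\<^sup>2) + real n)) * q\<^sup>2"
        by (simp add: sum_distrib_left[symmetric] sum.distrib)
      finally have "194 * real n < 2 * ((\<Sum>v<n. (real_of_int (y v))\<^sup>2) + real n)"
        by (rule mult_right_less_imp_less) simp
      then show ?thesis by simp
    qed
    moreover have "E \<in> ?B A y"
      using y_le unfolding d_def by (auto simp: sum_distrib_left intro!: sum_mono)
    ultimately show "E \<in> (\<Union>(A, y)\<in>Pow {..<n} \<times> Y. ?B A y)" using A by (auto simp: Y_def)
  qed
  then have "measure_pmf.prob (gnp n p) {E. regular n p E \<and> \<not> expanding n p E}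
    \<le> measure_pmf.prob (gnp n p) (\<Union>x\<in>Pow {..<n} \<times> Y. ?B (fst x) (snd x))"
    by (intro measure_pmf.finite_measure_mono) (auto simp: case_prod_unfold)
  also have "\<dots> \<le> (\<Sum>x\<in>Pow {..<n} \<times> Y. measure_pmf.prob (gnp n p) (?B (fst x) (snd x)))"
    using finY by (intro prob_UN_le) auto
  also have "\<dots> \<le> (\<Sum>x\<in>Pow {..<n} \<times> Y. exp (- 6 * real n) * (\<Prod>v<n. exp (- ((real_of_int (snd x v))\<^sup>2 / 16))))"
    by (intro sum_mono pr) auto
  also have "\<dots> = (\<Sum>A\<in>Pow {..<n}. \<Sum>y\<in>Y. exp (- 6 * real n) * (\<Prod>v<n. exp (- ((real_of_int (y v))\<^sup>2 / 16))))"
    by (simp only: sum.cartesian_product case_prod_unfold)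
  also have "\<dots> = 2 ^ n * (exp (- 6 * real n) * (\<Sum>y\<in>Y. \<Prod>v<n. exp (- ((real_of_int (y v))\<^sup>2 / 16))))"
    by (simp add: card_Pow sum_distrib_left)
  also have "\<dots> \<le> 2 ^ n * (exp (- 6 * real n) * 34 ^ n)"
  proof (intro mult_left_mono)
    have "(\<Sum>y\<in>Y. \<Prod>v<n. exp (- ((real_of_int (y v))\<^sup>2 / 16)))
      \<le> (\<Sum>y\<in>{..<n} \<rightarrow>\<^sub>E {- int L..int L}. \<Prod>v<n. exp (- ((real_of_int (y v))\<^sup>2 / 16)))"
      by (intro sum_mono2 finP Y_sub prod_nonneg) auto
    also have "\<dots> = (\<Prod>v<n. \<Sum>j\<in>{- int L..int L}. exp (- ((real_of_int j)\<^sup>2 / 16)))"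
      by (rule prod_sum_PiE[symmetric]) auto
    also have "\<dots> \<le> (\<Prod>v<n. 34)" by (intro prod_mono conjI sum_nonneg sum_exp_neg_sq_le) auto
    finally show "(\<Sum>y\<in>Y. \<Prod>v<n. exp (- ((real_of_int (y v))\<^sup>2 / 16))) \<le> 34 ^ n" by simp
  qed auto
  \<comment> \<open>Each vertex costs a factor 2 for the choice of \<open>A\<close> and 34 for its
    coordinate of \<open>y\<close>; 68 is below the fifth power of e.\<close>
  also have "\<dots> = 68 ^ n * exp (- 6 * real n)"
    by (simp add: power_mult_distrib[symmetric])
  also have "\<dots> \<le> exp (5 * real n) * exp (- 6 * real n)"
  proof (rule mult_right_mono)
    have "(5/2 :: real) ^ 5 \<le> exp 1 ^ 5" using exp_lower_Taylor_quadratic[of 1] by (intro power_mono) auto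
    then have "68 \<le> exp (5 :: real)" by (simp add: exp_of_nat_mult[of 5 1, symmetric] power_divide)
    then have "(68 :: real) ^ n \<le> exp 5 ^ n" by (intro power_mono) auto
    also have "\<dots> = exp (5 * real n)" by (simp add: exp_of_nat_mult[symmetric] mult.commute)
    finally show "(68 :: real) ^ n \<le> exp (5 * real n)" .
  qed simp
  also have "\<dots> = exp (- real n)" by (simp add: exp_add[symmetric])
  finally show ?thesis .
qed

text \<open>The threshold fits the gap between what an exceptional vertex sees of \<open>B\<close>,
  at least 7/16 of its degree, and what it should see when the mass of \<open>B\<close> is at most
  3/8.\<close>

definition no_dense_pair :: "nat \<Rightarrow> nat \<Rightarrow> real \<Rightarrow> nat set set \<Rightarrow> bool" where
  "no_dense_pair k n p E \<longleftrightarrow>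
    (\<forall>B\<subseteq>{..<n}. k * card {v. v < n \<and> dev p E B v \<ge> real n * p / 32} \<le> card B)"

text \<open>Weighting every set by n^(-size) makes the union over sets of all sizes cost only a
  constant.\<close>

lemma sum_inverse_power_card:
  assumes "n \<ge> 1"
  shows "(\<Sum>B\<in>Pow {..<n}. (1 / real n) ^ card B) \<le> 3"
proof -
  have "(\<Sum>B\<in>Pow {..<n}. (1 / real n) ^ card B) = (\<Prod>v<n. 1 / real n + 1)"
    by (subst prod_add) auto
  also have "\<dots> \<le> exp (1 / real n) ^ n"
    using exp_ge_add_one_self[of "1 / real n"] by (auto intro!: power_mono simp: add.commute)
  also have "\<dots> = exp 1" using assms by (simp add: exp_of_nat_mult[symmetric])
  also have "\<dots> \<le> 3" by (rule exp_le)
  finally show ?thesis .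
qed

text \<open>Union bound over \<open>B\<close> and the set \<open>S\<close> of its exceptional
  vertices. With \<open>u\<close> = 1/128 the Chernoff bound is \<epsilon>^|S|. As |B| \<le> k|S|, a
  factor n^k per vertex of \<open>S\<close> pays for the weight of \<open>B\<close>, and one more n
  for that of \<open>S\<close>. The powers of n^(k+1) \<epsilon> reduce to the first one if this
  number is at most 1; otherwise the claim is trivial.\<close>

lemma prob_dense_pair:
  assumes p: "p \<in> {0..1}" and n: "n \<ge> 1"
  shows "measure_pmf.prob (gnp n p) {E. \<not> no_dense_pair k n p E} \<le> 9 * real n ^ (k+1) * exp (- (real n * p / 8192))"
proof (cases "real n ^ (k+1) * exp (- (real n * p / 8192)) \<le> 1")
  case False
  then have "1 \<le> 9 * real n ^ (k+1) * exp (- (real n * p / 8192))" by simp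
  then show ?thesis using measure_pmf.prob_le_1 order_trans by blast
next
  case True
  define \<epsilon> where "\<epsilon> = exp (- (real n * p / 8192))"
  define I where "I = {(S, B). S \<subseteq> {..<n} \<and> B \<subseteq> {..<n} \<and> S \<noteq> {} \<and> card B \<le> k * card S}"
  have I_sub: "I \<subseteq> Pow {..<n} \<times> Pow {..<n}" by (auto simp: I_def)
  then have finI: "finite I" by (rule finite_subset) auto
  let ?B = "\<lambda>S B. {E. (\<Sum>v<n. of_bool (v \<in> S) * dev p E B v) \<ge> real (card S) * (real n * p / 32)}"
  have pr: "measure_pmf.prob (gnp n p) (?B S B) \<le> (real n ^ (k+1) * \<epsilon>) * ((1 / real n) ^ card S * (1 / real n) ^ card B)"
    if SB: "(S, B) \<in> I" for S B
  proof -
    have S: "S \<subseteq> {..<n}" "S \<noteq> {}" and B: "B \<subseteq> {..<n}" "card B \<le> k * card S" using SB by (auto simp: I_def)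
    have s1: "card S \<ge> 1" using S finite_subset[of S "{..<n}"] by (simp add: Suc_le_eq card_gt_0_iff)
    have "measure_pmf.prob (gnp n p) (?B S B)
      \<le> exp (- (1/128) * (real (card S) * (real n * p / 32)) + 2 * p * (1/128)\<^sup>2 * real (card B) * (\<Sum>v<n. (of_bool (v \<in> S))\<^sup>2))"
      by (rule Chernoff_gnp[where K = 1]) (use p B in auto)
    also have "(\<Sum>v<n. (of_bool (v \<in> S))\<^sup>2 :: real) = real (card S)"
      using S by (simp add: power2_eq_square Int_absorb1)
    also have "exp (- (1/128) * (real (card S) * (real n * p / 32)) + 2 * p * (1/128)\<^sup>2 * real (card B) * real (card S))
      \<le> exp (- (real (card S) * (real n * p / 8192)))"
    proof -
      have "card B \<le> n" using B card_mono[of "{..<n}" B] by simp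
      then have "2 * p * (1/128)\<^sup>2 * real (card B) * real (card S) \<le> 2 * p * (1/128)\<^sup>2 * real n * real (card S)"
        using p by (intro mult_right_mono mult_left_mono) auto
      then show ?thesis by (simp add: power2_eq_square algebra_simps)
    qed
    also have "\<dots> = \<epsilon> ^ card S" by (simp add: \<epsilon>_def exp_of_nat_mult[symmetric])
    also have "\<dots> \<le> \<epsilon> ^ card S * (real n ^ (k * card S) * (1 / real n) ^ card B)"
    proof -
      have "real n ^ card B \<le> real n ^ (k * card S)" using B n by (intro power_increasing) auto
      then have "1 \<le> real n ^ (k * card S) * (1 / real n) ^ card B"
        using n by (simp add: power_divide le_divide_eq)
      then show ?thesis by (simp add: \<epsilon>_def mult_le_cancel_left1)
    qed
    also have "\<dots> = (real n ^ (k+1) * \<epsilon>) ^ card S * ((1 / real n) ^ card S * (1 / real n) ^ card B)"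
    proof -
      have "(real n ^ (k+1) * \<epsilon>) ^ card S * (1 / real n) ^ card S = (real n ^ k * \<epsilon>) ^ card S"
        unfolding power_mult_distrib[symmetric] using n by simp
      also have "\<dots> = real n ^ (k * card S) * \<epsilon> ^ card S" by (simp add: power_mult_distrib power_mult)
      finally show ?thesis by (simp add: mult_ac)
    qed
    also have "\<dots> \<le> (real n ^ (k+1) * \<epsilon>) ^ 1 * ((1 / real n) ^ card S * (1 / real n) ^ card B)"
      using True s1 by (intro mult_right_mono power_decreasing) (auto simp: \<epsilon>_def)
    finally show ?thesis by simp
  qed
  have "{E. \<not> no_dense_pair k n p E} \<subseteq> (\<Union>x\<in>I. ?B (fst x) (snd x))"
  proof
    fix E assume "E \<in> {E. \<not> no_dense_pair k n p E}"
    then obtain B where B: "B \<subseteq> {..<n}" "card B < k * card {v. v < n \<and> dev p E B v \<ge> real n * p / 32}"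
      by (auto simp: no_dense_pair_def not_le)
    define S where "S = {v. v < n \<and> dev p E B v \<ge> real n * p / 32}"
    have S: "S \<subseteq> {..<n}" by (auto simp: S_def)
    have card_BS: "card B < k * card S" using B(2) by (simp only: S_def)
    then have "S \<noteq> {}" by auto
    then have I: "(S, B) \<in> I" using B(1) S card_BS by (auto simp: I_def)
    have "real (card S) * (real n * p / 32) \<le> (\<Sum>v\<in>S. dev p E B v)"
      by (intro sum_bounded_below) (auto simp: S_def)
    moreover have "(\<Sum>v\<in>S. dev p E B v) = (\<Sum>v<n. of_bool (v \<in> S) * dev p E B v)"
      using S by (intro sum.mono_neutral_cong_left) auto
    ultimately have "E \<in> ?B S B" by (simp only: mem_Collect_eq)
    then show "E \<in> (\<Union>x\<in>I. ?B (fst x) (snd x))" by (intro UN_I[OF I]) simp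
  qed
  then have "measure_pmf.prob (gnp n p) {E. \<not> no_dense_pair k n p E} \<le> measure_pmf.prob (gnp n p) (\<Union>x\<in>I. ?B (fst x) (snd x))"
    by (intro measure_pmf.finite_measure_mono) auto
  also have "\<dots> \<le> (\<Sum>x\<in>I. measure_pmf.prob (gnp n p) (?B (fst x) (snd x)))"
    by (rule prob_UN_le[OF finI])
  also have "\<dots> \<le> (\<Sum>x\<in>I. (real n ^ (k+1) * \<epsilon>) * ((1 / real n) ^ card (fst x) * (1 / real n) ^ card (snd x)))"
    by (intro sum_mono pr) auto
  also have "\<dots> \<le> (\<Sum>x\<in>Pow {..<n} \<times> Pow {..<n}. (real n ^ (k+1) * \<epsilon>) * ((1 / real n) ^ card (fst x) * (1 / real n) ^ card (snd x)))"
    using I_sub by (intro sum_mono2) (auto simp: \<epsilon>_def)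
  also have "\<dots> = (real n ^ (k+1) * \<epsilon>) * ((\<Sum>S\<in>Pow {..<n}. (1 / real n) ^ card S) * (\<Sum>B\<in>Pow {..<n}. (1 / real n) ^ card B))"
    unfolding sum_product sum.cartesian_product case_prod_unfold by (simp only: sum_distrib_left)
  also have "\<dots> \<le> (real n ^ (k+1) * \<epsilon>) * (3 * 3)"
    by (intro mult_left_mono mult_mono sum_inverse_power_card n sum_nonneg) (auto simp: \<epsilon>_def)
  finally show ?thesis by (simp add: \<epsilon>_def)
qed

section \<open>Consensus time\<close>

text \<open>Regularity makes all weights 1/n up to two percent or so. The mean-square deviation
  gives a variance O(1/(n p)) of the fractions, and n p \<ge> c k sqrt n turns this into
  \<open>spread\<close> with \<open>Q\<close> = 1200/c.\<close>

lemma good_graph_if: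
  fixes n k :: nat and p c \<kappa> :: real
  assumes E: "E \<subseteq> pairs n" "regular n p E" "expanding n p E" "no_dense_pair k n p E"
    and n: "n \<ge> 200" and p: "p \<in> {0..1}" and c: "c > 0" and np: "c * real k * sqrt (real n) \<le> real n * p"
    and \<kappa>: "\<kappa> ^ 4 = real k" "\<kappa> \<ge> 4" "32 * (1200 / c) \<le> \<kappa>" "2048 * \<kappa> \<le> sqrt (real n)"
  shows "good_graph {..<n} E k (real n) (1200 / c) \<kappa>"
proof -
  define d where "d = real n * p"
  have k0: "real k > 0" using \<kappa>(1,2) by (metis zero_less_power less_le_trans zero_less_numeral)
  have n0: "real n > 0" using n by simp
  have d0: "d > 0" using np c k0 n0 unfolding d_def by (smt (verit) mult_pos_pos real_sqrt_gt_zero)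
  have nbrs: "nbrs E v \<subseteq> {..<n}" for v using E(1) by (auto simp: nbrs_def pairs_def)
  have pd: "p * 200 \<le> d" using n p by (simp add: d_def mult.commute mult_left_mono)
  have card_Diff: "real (card ({..<n} - {v})) = real n - 1" if "v < n" for v using that n by simp
  have deg: "99/100 * d \<le> real (card (nbrs E v))" "real (card (nbrs E v)) \<le> 101/100 * d" if v: "v < n" for v
  proof -
    have "\<bar>dev p E {..<n} v\<bar> \<le> d / 200" using E(2) v by (simp add: regular_def d_def)
    moreover have "dev p E {..<n} v = real (card (nbrs E v)) - d + p"
      unfolding dev_def card_Diff[OF v] using nbrs[of v] by (simp add: Int_absorb2 d_def algebra_simps)
    ultimately have "\<bar>real (card (nbrs E v)) - d + p\<bar> \<le> d / 200" by simp
    note abs_le_D1[OF this] abs_le_D2[OF this]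
    then show "99/100 * d \<le> real (card (nbrs E v))" "real (card (nbrs E v)) \<le> 101/100 * d"
      using pd p d0 by auto
  qed
  interpret no_isolated "{..<n}" E
  proof
    show "nbrs E v \<noteq> {}" if "v \<in> {..<n}" for v
    proof
      assume "nbrs E v = {}"
      then show False using deg(1)[of v] that d0 by simp
    qed
  qed (use nbrs n in \<open>auto simp: lessThan_empty_iff\<close>)
  have vol: "real n * (99/100 * d) \<le> vol" "vol \<le> real n * (101/100 * d)"
  proof -
    have "(\<Sum>v<n. 99/100 * d) \<le> vol" unfolding vol_def by (intro sum_mono deg) auto
    then show "real n * (99/100 * d) \<le> vol" by simp
    have "vol \<le> (\<Sum>v<n. 101/100 * d)" unfolding vol_def by (intro sum_mono deg) auto
    then show "vol \<le> real n * (101/100 * d)" by simp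
  qed
  have wt: "99 / 101 / real n \<le> wt v" "wt v \<le> 101 / 99 / real n" if v: "v \<in> {..<n}" for v
  proof -
    have "(99/100 * d) / (real n * (101/100 * d)) \<le> wt v"
      unfolding wt_def using deg v vol vol_pos d0 by (intro frac_le) auto
    then show "99 / 101 / real n \<le> wt v" using d0 by simp
    have "wt v \<le> (101/100 * d) / (real n * (99/100 * d))"
      unfolding wt_def using deg v vol d0 n0 by (intro frac_le) auto
    then show "wt v \<le> 101 / 99 / real n" using d0 by simp
  qed
  have mass_le: "mass A \<le> 101 / 99 * (real (card A) / real n)" and mass_ge: "99 / 101 * (real (card A) / real n) \<le> mass A"
    if A: "A \<subseteq> {..<n}" for A
  proof -
    have card_A: "(\<Sum>v<n. of_bool (v \<in> A)) = real (card A)" using A by (simp add: Int_absorb1)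
    have "mass A \<le> (\<Sum>v<n. 101 / 99 / real n * of_bool (v \<in> A))"
      unfolding mass_def using wt by (intro sum_mono mult_right_mono) auto
    then show "mass A \<le> 101 / 99 * (real (card A) / real n)"
      unfolding sum_distrib_left[symmetric] card_A by simp
    have "(\<Sum>v<n. 99 / 101 / real n * of_bool (v \<in> A)) \<le> mass A"
      unfolding mass_def using wt by (intro sum_mono mult_right_mono) auto
    then show "99 / 101 * (real (card A) / real n) \<le> mass A"
      unfolding sum_distrib_left[symmetric] card_A by simp
  qed
  show ?thesis
  proof
    fix v assume v: "v \<in> {..<n}"
    show "wt v \<le> 2 / real n" "1 / (2 * real n) \<le> wt v" using wt[OF v] n0 by (auto simp: field_simps)
  next
    fix A assume A: "A \<subseteq> {..<n}"
    \<comment> \<open>\<open>dev\<close> is centred at the proportion of vertices, not at the mass.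
      Replacing the mass by this proportion can only increase the sum, as the mass is the weighted
      mean.\<close>
    define b where "b = real (card A) / real n"
    have b: "0 \<le> b" "b \<le> 1" using card_mono[OF _ A] n0 by (auto simp: b_def divide_le_eq_1)
    have "(\<Sum>v<n. wt v * (nfrac A v - mass A)\<^sup>2) = (\<Sum>v<n. wt v * (nfrac A v - b)\<^sup>2) - (mass A - b)\<^sup>2"
    proof -
      have "wt v * (nfrac A v - mass A)\<^sup>2 = wt v * (nfrac A v - b)\<^sup>2
        - 2 * (mass A - b) * (wt v * nfrac A v) + ((mass A)\<^sup>2 - b\<^sup>2) * wt v" for v
        by (simp add: power2_eq_square algebra_simps)
      then have "(\<Sum>v<n. wt v * (nfrac A v - mass A)\<^sup>2) = (\<Sum>v<n. wt v * (nfrac A v - b)\<^sup>2)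
        - 2 * (mass A - b) * (\<Sum>v<n. wt v * nfrac A v) + ((mass A)\<^sup>2 - b\<^sup>2) * (\<Sum>v<n. wt v)"
        by (simp add: sum.distrib sum_subtractf sum_distrib_left)
      moreover have "2 * (mass A - b) * mass A - ((mass A)\<^sup>2 - b\<^sup>2) * 1 = (mass A - b)\<^sup>2"
        by (simp add: power2_eq_square algebra_simps)
      ultimately show ?thesis unfolding sum_wt sum_wt_nfrac by linarith
    qed
    then have "(\<Sum>v<n. wt v * (nfrac A v - mass A)\<^sup>2) \<le> (\<Sum>v<n. wt v * (nfrac A v - b)\<^sup>2)" by simp
    also have "\<dots> \<le> (\<Sum>v<n. 1 / (49/50 * real n * d\<^sup>2) * (3 * ((dev p E A v)\<^sup>2 + (dev p E {..<n} v)\<^sup>2 + p\<^sup>2)))"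
    proof (rule sum_mono)
      fix v assume v: "v \<in> {..<n}"
      let ?deg = "real (card (nbrs E v))"
      let ?X = "real (card (nbrs E v \<inter> A)) - b * ?deg"
      have deg0: "?deg > 0" using card_nbrs_pos[OF v] by simp
      have card_A: "real (card (A - {v})) = real (card A) - of_bool (v \<in> A)"
        using finite_subset[OF A] card_gt_0_iff[of A] by (cases "v \<in> A") (auto simp: card_Diff_singleton of_nat_diff Suc_le_eq)
      have bn: "real (card A) = b * real n" using n0 by (simp add: b_def)
      have nbrs_V: "nbrs E v \<inter> {..<n} = nbrs E v" using nbrs by auto
      have card_V: "real (card ({..<n} - {v})) = real n - 1" using v by (intro card_Diff) auto
      \<comment> \<open>The main terms b n p cancel; what remains beyond the deviations comes from
        excluding \<open>v\<close> and is at most \<open>p\<close>.\<close>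
      have X: "?X = dev p E A v + (- b * dev p E {..<n} v) + p * (b - of_bool (v \<in> A))"
        unfolding dev_def card_A bn nbrs_V card_V by (simp add: algebra_simps)
      have sq3: "(x + y + z)\<^sup>2 \<le> 3 * (x\<^sup>2 + y\<^sup>2 + z\<^sup>2)" for x y z :: real
        using zero_le_power2[of "x - y"] zero_le_power2[of "y - z"] zero_le_power2[of "x - z"]
        by (simp add: power2_eq_square algebra_simps)
      have "(- b * dev p E {..<n} v)\<^sup>2 \<le> 1 * (dev p E {..<n} v)\<^sup>2"
        unfolding power_mult_distrib using b by (intro mult_right_mono) (auto simp: power_le_one)
      moreover have "(p * (b - of_bool (v \<in> A)))\<^sup>2 \<le> p\<^sup>2 * 1"
        unfolding power_mult_distrib using b by (intro mult_left_mono) (auto simp: abs_square_le_1 of_bool_def)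
      ultimately have X2: "?X\<^sup>2 \<le> 3 * ((dev p E A v)\<^sup>2 + (dev p E {..<n} v)\<^sup>2 + p\<^sup>2)"
        unfolding X by (intro order_trans[OF sq3] mult_left_mono add_mono) auto
      have "nfrac A v - b = ?X / ?deg" using deg0 by (simp add: nfrac_def field_simps)
      then have "wt v * (nfrac A v - b)\<^sup>2 = 1 / (?deg * vol) * ?X\<^sup>2"
        using deg0 by (simp add: wt_def power_divide power2_eq_square)
      also have "\<dots> \<le> 1 / (49/50 * real n * d\<^sup>2) * ?X\<^sup>2"
      proof (intro mult_right_mono divide_left_mono)
        have "49/50 * real n * d\<^sup>2 \<le> (99/100 * d) * (real n * (99/100 * d))" using d0 n0 by (simp add: power2_eq_square)
        also have "\<dots> \<le> ?deg * vol" using deg v vol d0 n0 by (intro mult_mono) auto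
        finally show "49/50 * real n * d\<^sup>2 \<le> ?deg * vol" .
      qed (use deg0 vol_pos d0 n0 in auto)
      also have "\<dots> \<le> 1 / (49/50 * real n * d\<^sup>2) * (3 * ((dev p E A v)\<^sup>2 + (dev p E {..<n} v)\<^sup>2 + p\<^sup>2))"
        using X2 n0 by (intro mult_left_mono) auto
      finally show "wt v * (nfrac A v - b)\<^sup>2 \<le> 1 / (49/50 * real n * d\<^sup>2) * (3 * ((dev p E A v)\<^sup>2 + (dev p E {..<n} v)\<^sup>2 + p\<^sup>2))" .
    qed
    also have "\<dots> = 1 / (49/50 * real n * d\<^sup>2) * (3 * ((\<Sum>v<n. (dev p E A v)\<^sup>2) + (\<Sum>v<n. (dev p E {..<n} v)\<^sup>2) + real n * p\<^sup>2))"
      unfolding sum_distrib_left[symmetric] by (simp add: sum.distrib)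
    \<comment> \<open>3 (194 + 194 + 1) = 1167, and 1167/(49/50) is below 1200.\<close>
    also have "\<dots> \<le> 1 / (49/50 * real n * d\<^sup>2) * (3 * (194 * real n * d + 194 * real n * d + real n * d))"
    proof (intro mult_left_mono add_mono)
      show "(\<Sum>v<n. (dev p E A v)\<^sup>2) \<le> 194 * real n * d" "(\<Sum>v<n. (dev p E {..<n} v)\<^sup>2) \<le> 194 * real n * d"
        using E(3) A unfolding expanding_def d_def by auto
      have "p * p \<le> p * 1" using p by (intro mult_left_mono) auto
      then show "p\<^sup>2 \<le> d" using pd p by (simp add: power2_eq_square)
    qed (use n0 in auto)
    also have "\<dots> = 1167 / (49/50) / d" using n0 d0 by (simp add: field_simps power2_eq_square)
    also have "\<dots> \<le> 1200 / d" using d0 by (intro divide_right_mono) auto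
    also have "\<dots> \<le> 1200 / (c * real k * sqrt (real n))"
      using np c k0 n0 d0 by (intro divide_left_mono mult_pos_pos) (auto simp: d_def[symmetric])
    also have "\<dots> = 1200 / c / (real k * sqrt (real n))" by simp
    finally show "(\<Sum>v<n. wt v * (nfrac A v - mass A)\<^sup>2) \<le> 1200 / c / (real k * sqrt (real n))" .
  next
    fix B assume B: "B \<subseteq> {..<n}" "mass B \<le> 3/8"
    let ?H = "{v \<in> {..<n}. 7/16 < nfrac B v}"
    have "99 / 101 * (real (card B) / real n) \<le> 3/8" using mass_ge[OF B(1)] B(2) by linarith
    \<comment> \<open>3/8 * 101/99 is below 0.383, while 7/16 of a degree is at least 0.433 n p; the
      gap exceeds n p/32.\<close>
    then have card_B: "real (card B) \<le> 383/1000 * real n" using n0 by (simp add: field_simps)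
    have "?H \<subseteq> {v. v < n \<and> dev p E B v \<ge> real n * p / 32}"
    proof
      fix v assume "v \<in> ?H"
      then have v: "v < n" "7/16 < nfrac B v" by auto
      have "7/16 * real (card (nbrs E v)) \<le> real (card (nbrs E v \<inter> B))"
        using v card_nbrs_pos[of v] by (simp add: nfrac_def field_simps)
      then have "7/16 * (99/100 * d) \<le> real (card (nbrs E v \<inter> B))" using deg(1)[OF v(1)] by linarith
      moreover have "p * real (card (B - {v})) \<le> p * (383/1000 * real n)"
      proof (rule mult_left_mono)
        have "card (B - {v}) \<le> card B" using finite_subset[OF B(1)] by (intro card_mono) auto
        then show "real (card (B - {v})) \<le> 383/1000 * real n" using card_B by linarith
      qed (use p in auto)
      then have "p * real (card (B - {v})) \<le> 383/1000 * d" by (simp add: d_def mult_ac)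
      ultimately have "d / 32 \<le> dev p E B v" unfolding dev_def using d0 by linarith
      then show "v \<in> {v. v < n \<and> dev p E B v \<ge> real n * p / 32}" using v by (simp add: d_def)
    qed
    then have "card ?H \<le> card {v. v < n \<and> dev p E B v \<ge> real n * p / 32}" by (intro card_mono) auto
    then have "k * card ?H \<le> k * card {v. v < n \<and> dev p E B v \<ge> real n * p / 32}" by simp
    also have "\<dots> \<le> card B" using E(4) B by (simp add: no_dense_pair_def)
    finally have "real k * real (card ?H) \<le> real (card B)" by (metis of_nat_le_iff of_nat_mult)
    then have "real (card ?H) \<le> real (card B) / real k" using k0 by (simp add: field_simps)
    then have "101 / 99 * (real (card ?H) / real n) \<le> 101 / 99 * (real (card B) / real k / real n)"
      using n0 by (intro mult_left_mono divide_right_mono) auto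
    then have "mass ?H \<le> 101 / 99 * (real (card B) / real k / real n)" 
      by (rule order_trans[OF mass_le[OF Collect_restrict]])
    also have "\<dots> = 101 / 99 * (101 / 99) * (99 / 101 * (real (card B) / real n)) / real k" by simp
    also have "\<dots> \<le> 101 / 99 * (101 / 99) * mass B / real k"
      using mass_ge[OF B(1)] k0 by (intro divide_right_mono mult_left_mono) auto
    also have "\<dots> \<le> 4 * mass B / real k"
      using mass_nonneg[of B] k0 by (intro divide_right_mono mult_right_mono) auto
    finally show "mass ?H \<le> 4 * mass B / real k" .
  qed (use n \<kappa> c in auto)
qed

text \<open>Half of the exponent in \<delta> = k^(1/16) absorbs the constant 522, so a round gains
  k^(-1/32). As 160 = 5 * 32, the rounds together give n^(-5) up to a factor k^(1/32) for rounding
  down. The hypothesis on \<open>\<delta> ^ 4\<close> says k \<le> n^2, hence the prefactor is at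
  most 2 n^2.\<close>

lemma failure_bound:
  fixes n k \<delta> :: real
  assumes n: "n \<ge> 2" and k: "k > 1" "\<delta> = k powr (1/16)" "522 \<le> k powr (1/32)" and \<kappa>: "\<delta> ^ 4 \<le> sqrt n"
    and T: "160 * (ln n / ln k) - 1 \<le> real T"
  shows "2 * n * sqrt n * \<delta> ^ 4 * (522 / \<delta>) ^ T \<le> n powr (-1)"
proof -
  have lk: "ln k > 0" using k by simp
  have ln2: "0 < ln n" "ln 2 \<le> ln n" using n by auto
  have \<delta>: "\<delta> = exp (ln k / 16)" using k by (simp add: powr_def)
  then have d4: "\<delta> ^ 4 = exp (ln k / 4)" by (simp add: exp_of_nat_mult[symmetric])
  have sn: "sqrt n = exp (ln n / 2)" using n by (simp add: powr_half_sqrt[symmetric] powr_def)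
  have "ln k / 4 \<le> ln n / 2" using \<kappa> unfolding d4 sn by simp
  have "522 / \<delta> \<le> exp (ln k / 32) / exp (ln k / 16)"
    unfolding \<delta> using k by (intro divide_right_mono) (auto simp: powr_def)
  also have "\<dots> = exp (- (ln k / 32))" by (simp add: exp_diff[symmetric])
  finally have "(522 / \<delta>) ^ T \<le> exp (- (ln k / 32)) ^ T" using \<delta> by (intro power_mono) auto
  also have "\<dots> = exp (- (real T * ln k / 32))" by (simp add: exp_of_nat_mult[symmetric])
  also have "\<dots> \<le> exp (- 5 * ln n + ln k / 32)"
  proof -
    have "(160 * (ln n / ln k) - 1) * ln k \<le> real T * ln k" using T lk by (intro mult_right_mono) auto
    then have "160 * ln n - ln k \<le> real T * ln k" using lk by (simp add: algebra_simps)
    then show ?thesis by simp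
  qed
  finally have "2 * n * sqrt n * \<delta> ^ 4 * (522 / \<delta>) ^ T
    \<le> exp (ln 2) * exp (ln n) * exp (ln n / 2) * exp (ln k / 4) * exp (- 5 * ln n + ln k / 32)"
    unfolding d4 sn using n by (intro mult_mono) (auto simp: \<delta>)
  also have "\<dots> = exp (ln 2 + ln n + ln n / 2 + ln k / 4 + (- 5 * ln n + ln k / 32))"
    by (simp only: exp_add)
  also have "\<dots> \<le> exp (- ln n)" using \<open>ln k / 4 \<le> ln n / 2\<close> ln2 by simp
  also have "\<dots> = n powr (-1)" using n by (simp add: powr_def)
  finally show ?thesis .
qed

text \<open>Each of the three properties fails with probability at most 1/(3n).\<close>

lemma prob_bad_graph:
  fixes k :: "nat \<Rightarrow> nat" and p :: "nat \<Rightarrow> real" and c :: real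
  assumes c: "c > 0" and k: "\<And>n. k n \<ge> 1" and p: "\<And>n. p n \<in> {0..1}"
    and np: "\<forall>\<^sub>F n in sequentially. c * real (k n) * sqrt (real n) \<le> real n * p n"
  shows "\<forall>\<^sub>F n in sequentially. measure_pmf.prob (gnp n (p n))
    {E. \<not> (regular n (p n) E \<and> expanding n (p n) E \<and> no_dense_pair (k n) n (p n) E)} \<le> real n powr (-1)"
proof -
  have 1: "\<forall>\<^sub>F n in sequentially. 2 * real n * exp (- (c * sqrt (real n) / 320000)) \<le> 1 / (3 * real n)"
    using c by real_asymp
  have 2: "\<forall>\<^sub>F n in sequentially. exp (- real n) \<le> 1 / (3 * real n)"
    by real_asymp
  have 3: "\<forall>\<^sub>F n in sequentially. 9 * exp (2 * ln (real n) - c * sqrt (real n) / 8192) \<le> 1 / (3 * real n)"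
    using c by real_asymp
  have 4: "\<forall>\<^sub>F n in sequentially. 2 * ln (real n) - c * sqrt (real n) / 8192 \<le> 0"
    using c by real_asymp
  show ?thesis
    using 1 2 3 4 np eventually_gt_at_top[of 0]
  proof eventually_elim
    case (elim n)
    have n1: "real n \<ge> 1" using elim by simp
    have "c * 1 * sqrt (real n) \<le> c * real (k n) * sqrt (real n)"
      using c k[of n] by (intro mult_right_mono mult_left_mono) auto
    then have cs: "c * sqrt (real n) \<le> real n * p n" using elim by simp
    have np0: "real n * p n > 0" using cs c n1 by (smt (verit) mult_pos_pos real_sqrt_gt_zero)
    have "2 * real n * exp (- (real n * p n / 320000)) \<le> 2 * real n * exp (- (c * sqrt (real n) / 320000))"
      using cs by (intro mult_left_mono) auto
    then have R: "measure_pmf.prob (gnp n (p n)) {E. \<not> regular n (p n) E} \<le> 1 / (3 * real n)"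
      using prob_not_regular[OF p, of n n] elim by linarith
    have X: "measure_pmf.prob (gnp n (p n)) {E. regular n (p n) E \<and> \<not> expanding n (p n) E} \<le> 1 / (3 * real n)"
      using prob_not_expanding[OF p np0] elim by linarith
    \<comment> \<open>The cost n^(k+1) of the union bound is absorbed by the factor k in n p \<ge> c
      k sqrt n: the exponent is at most k times a bracket that is eventually nonpositive, so k may
      be replaced by 1.\<close>
    have "real n ^ (k n + 1) * exp (- (real n * p n / 8192)) \<le> exp (2 * ln (real n) - c * sqrt (real n) / 8192)"
    proof -
      have "real n ^ (k n + 1) = exp (real (k n + 1) * ln (real n))"
        using n1 by (subst exp_of_nat_mult) simp
      then have "real n ^ (k n + 1) * exp (- (real n * p n / 8192))
        = exp (real (k n + 1) * ln (real n) - real n * p n / 8192)" by (simp only: mult_exp_exp diff_conv_add_uminus)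
      moreover have "real (k n + 1) * ln (real n) - real n * p n / 8192
        \<le> real (k n) * (2 * ln (real n) - c * sqrt (real n) / 8192)"
      proof -
        have "real (k n + 1) * ln (real n) \<le> (2 * real (k n)) * ln (real n)"
          using k[of n] n1 by (intro mult_right_mono) auto
        moreover have "c * real (k n) * sqrt (real n) / 8192 \<le> real n * p n / 8192" using elim by simp
        ultimately show ?thesis by (simp add: algebra_simps)
      qed
      moreover have "real (k n) * (2 * ln (real n) - c * sqrt (real n) / 8192)
        \<le> 1 * (2 * ln (real n) - c * sqrt (real n) / 8192)"
        using k[of n] elim by (intro mult_right_mono_neg) auto
      ultimately show ?thesis by simp
    qed
    then have D: "measure_pmf.prob (gnp n (p n)) {E. \<not> no_dense_pair (k n) n (p n) E} \<le> 1 / (3 * real n)"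
      using prob_dense_pair[OF p, of n n "k n"] elim by linarith
    have "measure_pmf.prob (gnp n (p n)) {E. \<not> (regular n (p n) E \<and> expanding n (p n) E \<and> no_dense_pair (k n) n (p n) E)}
      \<le> measure_pmf.prob (gnp n (p n)) (({E. \<not> regular n (p n) E} \<union> {E. regular n (p n) E \<and> \<not> expanding n (p n) E})
          \<union> {E. \<not> no_dense_pair (k n) n (p n) E})"
      by (intro measure_pmf.finite_measure_mono) auto
    also have "\<dots> \<le> (1 / (3 * real n) + 1 / (3 * real n)) + 1 / (3 * real n)"
      by (intro order_trans[OF measure_Un_le] add_mono R X D) auto
    also have "\<dots> = real n powr (-1)" using n1 by (simp add: powr_minus field_simps)
    finally show ?case .
  qed
qed

theorem corollary1p9:
  fixes k :: "nat \<Rightarrow> nat" and p :: "nat \<Rightarrow> real"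
  assumes k_pos: "\<And>n. k n \<ge> 1"
    and k_omega: "(\<lambda>n. real (k n)) \<in> \<omega>(\<lambda>_. 1)"
    and k_bigo: "(\<lambda>n. real (k n)) \<in> O(\<lambda>n. sqrt (real n))"
    and p_prob: "\<And>n. 0 \<le> p n \<and> p n \<le> 1"
    and p_Omega: "p \<in> \<Omega>(\<lambda>n. real (k n) / sqrt (real n))"
  shows "\<exists>C>0. \<exists>c>0. \<exists>c'>0. \<forall>\<^sub>F n in sequentially.
    measure_pmf.prob (gnp n (p n))
      {E. \<forall>A\<subseteq>{..<n}.
         \<P>(\<omega> in voting_space (2 * k n + 1) {..<n} E.
            ereal_of_enat (T_cons (2 * k n + 1) {..<n} A \<omega>)
              \<le> ereal (C * (ln (real n) / ln (real (k n)))))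
         \<ge> 1 - real n powr (- c')}
    \<ge> 1 - real n powr (- c)"
proof -
  obtain c where c: "c > 0"
    and ev_p: "\<forall>\<^sub>F n in sequentially. norm (p n) \<ge> c * norm (real (k n) / sqrt (real n))"
    using landau_omega.bigE[OF p_Omega] by auto
  obtain C0 where C0: "C0 > 0"
    and ev_k: "\<forall>\<^sub>F n in sequentially. norm (real (k n)) \<le> C0 * norm (sqrt (real n))"
    using landau_o.bigE[OF k_bigo] by auto
  have p01: "p n \<in> {0..1}" for n using p_prob[of n] by simp
  \<comment> \<open>Thresholds for k: \<kappa> \<ge> 4, then \<kappa> \<ge> 32 Q with
    \<open>Q\<close> = 1200/c, and k^(1/32) \<ge> 522.\<close>
  define K where "K = Max {4 ^ 4, (38400 / c) ^ 4, 522 ^ 32}"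
  have K: "4 ^ 4 \<le> K" "(38400 / c) ^ 4 \<le> K" "522 ^ 32 \<le> K" "K > 0"
    by (auto simp: K_def less_max_iff_disj)
  have ev_K: "\<forall>\<^sub>F n in sequentially. K \<le> real (k n)"
    using landau_omega.smallD[OF k_omega K(4)] by simp
  have ev_np: "\<forall>\<^sub>F n in sequentially. c * real (k n) * sqrt (real n) \<le> real n * p n"
    using ev_p eventually_gt_at_top[of 0]
  proof eventually_elim
    case (elim n)
    have "real n * (c * (real (k n) / sqrt (real n))) \<le> real n * p n"
      using elim p_prob[of n] by (intro mult_left_mono) auto
    moreover have "real n * (c * (real (k n) / sqrt (real n))) = c * real (k n) * (real n / sqrt (real n))" by simp
    ultimately show ?case using elim by (simp add: real_div_sqrt)
  qed
  \<comment> \<open>Here k = O(sqrt n) enters: it makes \<kappa> of order at most n^(1/8), far below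
    sqrt n.\<close>
  have ev_sqrt: "\<forall>\<^sub>F n in sequentially. 2048 * (C0 * sqrt (real n)) powr (1/4) \<le> sqrt (real n)"
    using C0 by real_asymp
  \<comment> \<open>The constants C = 160 and c = c' = 1 do not depend on those hidden in the
    hypotheses, which only affect how large n must be.\<close>
  have "\<forall>\<^sub>F n in sequentially.
    measure_pmf.prob (gnp n (p n))
      {E. \<forall>A\<subseteq>{..<n}.
         \<P>(\<omega> in voting_space (2 * k n + 1) {..<n} E.
            ereal_of_enat (T_cons (2 * k n + 1) {..<n} A \<omega>)
              \<le> ereal (160 * (ln (real n) / ln (real (k n)))))
         \<ge> 1 - real n powr (- 1)}
    \<ge> 1 - real n powr (- 1)"
    using prob_bad_graph[OF c k_pos p01 ev_np] ev_np ev_K ev_k ev_sqrt eventually_ge_at_top[of 200]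
  proof eventually_elim
    case (elim n)
    define \<delta> where "\<delta> = real (k n) powr (1/16)"
    define \<kappa> where "\<kappa> = real (k n) powr (1/4)"
    have "256 \<le> K" using K(1) by simp
    then have k1: "real (k n) > 1" using elim by linarith
    have powr_root: "x \<le> real (k n) powr (1 / real m)" if "x ^ m \<le> K" "x > 0" "m > 0" for x m
    proof -
      have "x = (x ^ m) powr (1 / real m)" using that by (simp add: powr_realpow[symmetric] powr_powr)
      also have "\<dots> \<le> real (k n) powr (1 / real m)" using that elim by (intro powr_mono2) auto
      finally show ?thesis .
    qed
    have d4: "\<delta> ^ 4 = \<kappa>" using k1 by (simp add: \<delta>_def \<kappa>_def powr_realpow[symmetric] powr_powr)
    have d1: "\<delta> \<ge> 1" using k1 by (simp add: \<delta>_def ge_one_powr_ge_zero)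
    have \<kappa>: "\<kappa> ^ 4 = real (k n)" "\<kappa> \<ge> 4" "32 * (1200 / c) \<le> \<kappa>" "2048 * \<kappa> \<le> sqrt (real n)"
    proof -
      show "\<kappa> ^ 4 = real (k n)" using k1 by (simp add: \<kappa>_def powr_realpow[symmetric] powr_powr)
      show "\<kappa> \<ge> 4" using powr_root[of 4 4] K by (simp add: \<kappa>_def)
      show "32 * (1200 / c) \<le> \<kappa>" using powr_root[of "38400 / c" 4] K c by (simp add: \<kappa>_def)
      have "\<kappa> \<le> (C0 * sqrt (real n)) powr (1/4)"
        unfolding \<kappa>_def using elim C0 by (intro powr_mono2) auto
      then show "2048 * \<kappa> \<le> sqrt (real n)" using elim by linarith
    qed
    have k32: "522 \<le> real (k n) powr (1/32)" using powr_root[of 522 32] K by simp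
    define T where "T = nat \<lfloor>160 * (ln (real n) / ln (real (k n)))\<rfloor>"
    have nonneg: "0 \<le> 160 * (ln (real n) / ln (real (k n)))" using k1 elim by simp
    have T: "real T \<le> 160 * (ln (real n) / ln (real (k n)))" "160 * (ln (real n) / ln (real (k n))) - 1 \<le> real T"
      using nonneg unfolding T_def by linarith+
    have fail: "2 * real n * sqrt (real n) * \<kappa> * (522 / \<delta>) ^ T \<le> real n powr (- 1)"
    proof -
      have "\<delta> ^ 4 \<le> sqrt (real n)" using \<kappa> by (simp add: d4)
      moreover have "real n \<ge> 2" using elim by simp
      ultimately show ?thesis using failure_bound[OF _ k1 \<delta>_def k32 _ T(2)] unfolding d4 by blast
    qed
    let ?G = "{E. regular n (p n) E \<and> expanding n (p n) E \<and> no_dense_pair (k n) n (p n) E}"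
    let ?Q = "{E. \<forall>A\<subseteq>{..<n}.
         \<P>(\<omega> in voting_space (2 * k n + 1) {..<n} E.
            ereal_of_enat (T_cons (2 * k n + 1) {..<n} A \<omega>)
              \<le> ereal (160 * (ln (real n) / ln (real (k n)))))
         \<ge> 1 - real n powr (- 1)}"
    have sub: "E \<in> ?Q" if E: "E \<in> ?G" "E \<subseteq> pairs n" for E
    proof -
      interpret good_graph "{..<n}" E "k n" "real n" "1200 / c" \<kappa>
        using E elim p01 c \<kappa> by (intro good_graph_if) auto
      show ?thesis
      proof (intro CollectI allI impI)
        fix A assume A: "A \<subseteq> {..<n}"
        have "1 - real n powr (- 1) \<le> 1 - 2 * real n * sqrt (real n) * \<kappa> * (522 / \<delta>) ^ T" using fail by simp
        also have "\<dots> \<le> \<P>(\<omega> in voting_space (2 * k n + 1) {..<n} E. opinion0 (2 * k n + 1) {..<n} A \<omega> T \<in> {{}, {..<n}})"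
          by (rule prob_consensus_ge[OF A d4 d1])
        also have "\<dots> \<le> \<P>(\<omega> in voting_space (2 * k n + 1) {..<n} E.
            ereal_of_enat (T_cons (2 * k n + 1) {..<n} A \<omega>) \<le> ereal (160 * (ln (real n) / ln (real (k n)))))"
          by (rule prob_T_cons_ge[OF finite_lessThan A T(1)])
        finally show "1 - real n powr (- 1) \<le> \<P>(\<omega> in voting_space (2 * k n + 1) {..<n} E.
            ereal_of_enat (T_cons (2 * k n + 1) {..<n} A \<omega>) \<le> ereal (160 * (ln (real n) / ln (real (k n)))))" .
      qed
    qed
    have "- ?G = {E. \<not> (regular n (p n) E \<and> expanding n (p n) E \<and> no_dense_pair (k n) n (p n) E)}"
      by (rule Collect_neg_eq[symmetric])
    then have "1 - real n powr (- 1) \<le> 1 - measure_pmf.prob (gnp n (p n)) (- ?G)"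
      using elim(1) by (simp only:)
    also have "\<dots> = measure_pmf.prob (gnp n (p n)) ?G"
      using measure_pmf.prob_compl[of ?G "gnp n (p n)"] by (simp add: Compl_eq_Diff_UNIV)
    also have "\<dots> \<le> measure_pmf.prob (gnp n (p n)) ?Q"
    proof (rule measure_pmf.finite_measure_mono_AE)
      have "E \<subseteq> pairs n" if "E \<in> set_pmf (gnp n (p n))" for E
        using that set_rand_subset[of "pairs n"] unfolding gnp_eq by blast
      then show "AE E in gnp n (p n). E \<in> ?G \<longrightarrow> E \<in> ?Q" using sub by (intro AE_pmfI) blast
    qed simp
    finally show ?case .
  qed
  then show ?thesis by (intro exI[of _ "160::real"] exI[of _ "1::real"] conjI) auto
qed

end
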